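(* Under the standing assumptions on $G_n$, $\mathcal S$ and the weights given in the context, let $\beta\in[0,\infty)$ and $\pi\sim\mathbb P_{\beta,\boldsymbol\omega}$. Then $$\frac1{\sqrt m}\left(W(\pi)+m\psi'(\beta)\right)\Rightarrow\mathrm N\left(0,\psi''(\beta)\right)$$ as $n\to\infty$, with high probability in $\boldsymbol\omega$; that is, the (random) law of $m^{-1/2}(W(\pi)+m\psi'(\beta))$ under $\mathbb P_{\beta,\boldsymbol\omega}$ converges weakly to $\mathrm N(0,\psi''(\beta))$, in probability with respect to $\boldsymbol\omega$.
   Context: Graphs: $G_n=(V_n,E_n)$, $n\in\mathbb N$, is a sequence of finite undirected edge-transitive graphs with $|V_n|=c\cdot n$ for some fixed $c\in\mathbb N$ and $|E_n|=\Theta(|V_n|^2)$. Weights: $\boldsymbol\omega=\{\omega_e\}_{e\in E_n}$ are i.i.d. with a law not depending on $n$ and such that $\psi(\beta):=\log\mathbb E e^{-\beta\omega_e}<\infty$ for all $\beta\in[0,\infty)$. Weights may equal $+\infty$ with positive probability (but not almost surely), with the conventions $e^{-\beta\cdot(+\infty)}=0$ for every $\beta\ge0$ and $(+\infty)\cdot0=0$. Derivatives of $\psi$ at $0$ are right derivatives; derivatives appearing in the statement are understood to exist and be finite. Optimization problem: $\mathcal S=\mathcal S(n)$ is a nonempty collection of spanning subgraphs of $G_n$, identified with their edge sets; $\widetilde{\mathcal S}$ is the collection of all subsets of elements of $\mathcal S$. A partial matching is a set of pairwise vertex-disjoint edges. $\mathbb P_0$ denotes the law of $\pi$ uniform on $\mathcal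 S$. It is assumed that: (1) all elements of $\mathcal S$ have the same number of edges $m=m(n)$, and $\lim_{n\to\infty} m^2/(2|E_n|)=\gamma\in(0,\infty)$; (2) for every partial matching $\Gamma\subseteq E_n$ there is $\pi\in\mathcal S$ with $\Gamma\subseteq\pi$; (3) there is a constant $\rho\in(0,\infty)$ (independent of $n$) such that for every $k\in\mathbb N$ and every partial matching $\Gamma$ with $k$ edges, $\left|\frac{\mathbb P_0(\Gamma\subseteq\pi)}{\prod_{e\in\Gamma}\mathbb P_0(e\in\pi)}-1\right|\le \frac{\rho^k}{\sqrt m}$; (4) there is a constant $\rho\in(0,\infty)$ (independent of $n$) such that for every $k\in\mathbb N$ and every $\Gamma\in\widetilde{\mathcal S}$ with $k$ edges that is not a partial matching, $\mathbb P_0(\Gamma\subseteq\pi)\le\rho^k\prod_{e\in\Gamma}\mathbb P_0(e\in\pi)$. Moreover $\mathbb P_0(e\in\pi)=p:=m/|E_n|$ for every $e\in E_n$. Gibbs measure: $W(\pi)=\sum_{e\in\pi}\omega_e$, $Z(\beta,\boldsymbol\omega)=\frac1{|\mathcal S|}\sum_{\pi\in\mathcal S}e^{-\beta W(\pi)}$, $\mathbb P_{\beta,\boldsymbol\omega}(\pi)=\frac{1}{Z(\beta,\boldsymbol\omega)|\mathcal S|}e^{-\beta W(\pi)}$ for $\pi\in\mathcal S$ (uniform if $Z=0$). $\mathrm N(\mu,\sigma^2)$ is the normal law with mean $\mu$ and variance $\sigma^2$. *)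

theory Defs
  imports "HOL-Probability.Probability"
begin

text \<open>Finite simple undirected graphs are given by a vertex set \<open>V\<close> and a set \<open>E\<close> of two-element
  subsets of \<open>V\<close>.\<close>

definition finite_simple_graph :: "'v set \<Rightarrow> 'v set set \<Rightarrow> bool" where
  "finite_simple_graph V E \<longleftrightarrow> finite V \<and> (\<forall>e\<in>E. e \<subseteq> V \<and> card e = 2)"

definition graph_automorphism :: "'v set \<Rightarrow> 'v set set \<Rightarrow> ('v \<Rightarrow> 'v) \<Rightarrow> bool" where
  "graph_automorphism V E \<phi> \<longleftrightarrow>
     bij_betw \<phi> V V \<and> (\<forall>u\<in>V. \<forall>v\<in>V. {\<phi> u, \<phi> v} \<in> E \<longleftrightarrow> {u, v} \<in> E)"

definition edge_transitive :: "'v set \<Rightarrow> 'v set set \<Rightarrow> bool" where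
  "edge_transitive V E \<longleftrightarrow> (\<forall>e\<in>E. \<forall>f\<in>E. \<exists>\<phi>. graph_automorphism V E \<phi> \<and> \<phi> ` e = f)"

definition partial_matching :: "'v set set \<Rightarrow> 'v set set \<Rightarrow> bool" where
  "partial_matching E \<Gamma> \<longleftrightarrow> \<Gamma> \<subseteq> E \<and> pairwise disjnt \<Gamma>"

text \<open>A spanning subgraph keeps all vertices and is therefore determined by its edge set; a
  collection of spanning subgraphs is a set \<open>S\<close> of edge sets. The next definition is the
  collection of all subsets of elements of \<open>S\<close>.\<close>

definition sub_collection :: "'v set set set \<Rightarrow> 'v set set set" where
  "sub_collection S = (\<Union>\<pi>\<in>S. Pow \<pi>)"

text \<open>\<open>prob0 S \<Gamma>\<close> is the probability that a uniformly chosen \<open>\<pi> \<in> S\<close> contains \<open>\<Gamma>\<close>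
  (for \<open>S\<close> finite and nonempty).\<close>

definition prob0 :: "'v set set set \<Rightarrow> 'v set set \<Rightarrow> real" where
  "prob0 S \<Gamma> = measure_pmf.prob (pmf_of_set S) {\<pi>. \<Gamma> \<subseteq> \<pi>}"

text \<open>The factor \<open>e\<^sup>-\<^sup>\<beta>\<^sup>w\<close> for a weight \<open>w\<close> that is real or \<open>+\<infinity>\<close>. It vanishes at \<open>w = \<infinity>\<close> for
  every \<open>\<beta> \<ge> 0\<close>, including \<open>\<beta> = 0\<close>. The value at \<open>w = -\<infinity>\<close> is irrelevant: weights are almost
  surely different from \<open>-\<infinity>\<close>.\<close>

definition boltzmann :: "real \<Rightarrow> ereal \<Rightarrow> real" where
  "boltzmann \<beta> w = (if w = \<infinity> then 0 else exp (- \<beta> * real_of_ereal w))"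

text \<open>\<open>\<psi>(\<beta>)\<close> for weights with law \<open>\<mu>\<close>; in particular \<open>\<psi>(0) = ln (\<mu> {w. w < \<infinity>})\<close>.\<close>

definition log_laplace :: "ereal measure \<Rightarrow> real \<Rightarrow> real" where
  "log_laplace \<mu> \<beta> = ln (\<integral>w. boltzmann \<beta> w \<partial>\<mu>)"

definition total_weight :: "('v set \<Rightarrow> ereal) \<Rightarrow> 'v set set \<Rightarrow> ereal" where
  "total_weight \<omega> \<pi> = (\<Sum>e\<in>\<pi>. \<omega> e)"

definition partition_function :: "'v set set set \<Rightarrow> real \<Rightarrow> ('v set \<Rightarrow> ereal) \<Rightarrow> real" where
  "partition_function S \<beta> \<omega> = (1 / real (card S)) * (\<Sum>\<pi>\<in>S. boltzmann \<beta> (total_weight \<omega> \<pi>))"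

definition gibbs ::
  "'v set set set \<Rightarrow> real \<Rightarrow> ('v set \<Rightarrow> ereal) \<Rightarrow> 'v set set measure" where
  "gibbs S \<beta> \<omega> = point_measure S (\<lambda>\<pi>. ennreal (
     if partition_function S \<beta> \<omega> = 0 then 1 / real (card S)
     else boltzmann \<beta> (total_weight \<omega> \<pi>) / (partition_function S \<beta> \<omega> * real (card S))))"

text \<open>The law of \<open>m\<^sup>-\<^sup>1\<^sup>/\<^sup>2 (W(\<pi>) + m d)\<close> under the Gibbs measure. It lives on the extended reals since
  \<open>W(\<pi>) = \<infinity>\<close> is possible when the partition function vanishes.\<close>

definition rescaled_weight_law ::
  "'v set set set \<Rightarrow> nat \<Rightarrow> real \<Rightarrow> real \<Rightarrow> ('v set \<Rightarrow> ereal) \<Rightarrow> ereal measure" where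
  "rescaled_weight_law S m d \<beta> \<omega> = distr (gibbs S \<beta> \<omega>) borel
     (\<lambda>\<pi>. ereal (1 / sqrt (real m)) * (total_weight \<omega> \<pi> + ereal (real m * d)))"

text \<open>The second argument is the variance (whereas \<^const>\<open>normal_density\<close> takes the standard
  deviation); variance \<open>0\<close> gives a point mass.\<close>

definition normal_law :: "real \<Rightarrow> real \<Rightarrow> real measure" where
  "normal_law a v = (if v = 0 then return borel a
     else density lborel (\<lambda>x. ennreal (normal_density a (sqrt v) x)))"

text \<open>Weak convergence, in probability, of random measures \<open>\<nu> n\<close>, defined on probability spaces
  \<open>M n\<close>, to a deterministic measure \<open>N\<close>: integrals of bounded continuous functions converge in
  probability.\<close>

definition weak_conv_in_prob ::
  "(nat \<Rightarrow> 'w measure) \<Rightarrow> (nat \<Rightarrow> 'w \<Rightarrow> 'a::topological_space measure) \<Rightarrow> 'a measure \<Rightarrow> bool" where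
  "weak_conv_in_prob M \<nu> N \<longleftrightarrow>
     (\<forall>f :: 'a \<Rightarrow> real. continuous_on UNIV f \<longrightarrow> bounded (range f) \<longrightarrow>
       (\<forall>\<epsilon>>0. (\<lambda>n. measure (M n)
          {x \<in> space (M n). \<bar>(\<integral>y. f y \<partial>\<nu> n x) - (\<integral>y. f y \<partial>N)\<bar> > \<epsilon>}) \<longlonglongrightarrow> 0))"

end

theory Submission
  imports Defs
begin

text \<open>Let \<open>w\<^sub>e\<close> be the Boltzmann factor of the edge \<open>e\<close> divided by its expectation and let \<open>x\<^sub>e\<close> be its
  weight plus \<open>\<psi>'(\<beta>)\<close>. Put \<open>h = f - \<integral>f dN\<close>, where \<open>N\<close> is the limiting normal law, and let
  \<open>Y(h)\<close> be the average over \<open>\<pi> \<in> S\<close> of \<open>(\<Prod>e\<in>\<pi>. w\<^sub>e) h(m\<^sup>-\<^sup>1\<^sup>/\<^sup>2 (\<Sum>e\<in>\<pi>. x\<^sub>e))\<close>.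
  The Gibbs average of \<open>f\<close> differs from \<open>\<integral>f dN\<close> by \<open>Y(h) / Y(1)\<close>.

  The numerator tends to \<open>0\<close> in \<open>L\<^sup>2\<close>: its second moment is an average over pairs \<open>\<pi>, \<pi>'\<close>, and up to
  an error controlled by the overlap \<open>\<bar>\<pi> \<inter> \<pi>'\<bar>\<close> the two factors are independent, each with
  vanishing mean by the central limit theorem under the tilted law. The overlap has bounded exponential
  moments, because the average of \<open>(1 + \<theta>)\<^bsup>\<bar>\<pi> \<inter> \<pi>'\<bar>\<^esup>\<close> is the sum over \<open>\<Gamma> \<subseteq> E\<close> of
  \<open>\<theta>\<^bsup>\<bar>\<Gamma>\<bar>\<^esup>\<close> times the squared probability of \<open>\<Gamma> \<subseteq> \<pi>\<close>.

  The denominator \<open>Y(1)\<close> stays away from \<open>0\<close>: expanding it in the orthogonal products of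
  \<open>w\<^sub>e - 1\<close> shows that it is \<open>L\<^sup>2\<close>-close to the product of \<open>1 + p (w\<^sub>e - 1)\<close> over all edges,
  and the reciprocal of this product has bounded expectation.\<close>

section \<open>Uniform random subgraphs\<close>

text \<open>The scale is set by \<open>p^2 * card E = m^2 / card E\<close>, which tends to
  \<open>2 * \<gamma>\<close>. It stays bounded, so the overlap of two independent subgraphs is of
  order one. It does not vanish, so unless \<open>w\<close> is almost surely constant
  \<open>Y(1)\<close> does not concentrate at its mean 1. This is the obstacle: comparing
  \<open>Y(1)\<close> with 1 in second moment fails, and only a lower bound in probability is
  available. The explicit product takes the place of 1 because it has the same expansion, with
  \<open>p ^ card \<Gamma>\<close> instead of the probability of \<open>\<Gamma>\<close>. The two
  agree on matchings up to a relative error of order \<open>1 / sqrt m\<close>, and sets with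
  touching edges have total weight of order \<open>card V / card E\<close>. Its reciprocal is tame
  since each factor is at least \<open>1 - p\<close>. In the numerator, boundedly many shared edges
  move the total by a bounded amount, which division by \<open>sqrt m\<close> makes negligible. At
  \<open>\<beta> = 0\<close> the Laplace transform is known on one side only, so mean and variance
  of the tilted law must be extracted from one-sided differences.\<close>

lemma prod_one_plus_expand:
  fixes f :: "'a \<Rightarrow> 'b::comm_semiring_1"
  assumes "finite A"
  shows "(\<Prod>x\<in>A. 1 + f x) = (\<Sum>X\<in>Pow A. \<Prod>x\<in>X. f x)"
  using prod_add[OF assms, of f "\<lambda>_. 1"] by (simp add: add.commute)

lemma sum_Pow_power_card:
  fixes s :: "'b::comm_semiring_1"
  assumes "finite A"
  shows "(\<Sum>X\<in>Pow A. s ^ card X) = (1 + s) ^ card A"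
  using prod_one_plus_expand[OF assms, of "\<lambda>_. s"] by simp

lemma sum_supersets_power_card:
  fixes s :: "'b::comm_semiring_1"
  assumes E: "finite E" and A: "A \<subseteq> E"
  shows "(\<Sum>X\<in>{X\<in>Pow E. A \<subseteq> X}. s ^ card X) = s ^ card A * (1 + s) ^ card (E - A)"
proof -
  have "(\<Sum>X\<in>{X\<in>Pow E. A \<subseteq> X}. s ^ card X) = (\<Sum>Y\<in>Pow (E - A). s ^ card (A \<union> Y))"
    by (rule sum.reindex_bij_witness[of _ "\<lambda>Y. A \<union> Y" "\<lambda>X. X - A"])
       (use A in \<open>auto intro!: arg_cong[where f = card] arg_cong[where f = "\<lambda>n. s ^ n"]\<close>)
  also have "\<dots> = (\<Sum>Y\<in>Pow (E - A). s ^ card A * s ^ card Y)"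
  proof (rule sum.cong[OF refl])
    fix Y assume "Y \<in> Pow (E - A)"
    then have "card (A \<union> Y) = card A + card Y"
      using E A by (intro card_Un_disjoint) (auto dest: finite_subset)
    then show "s ^ card (A \<union> Y) = s ^ card A * s ^ card Y"
      by (simp add: power_add)
  qed
  also have "\<dots> = s ^ card A * (1 + s) ^ card (E - A)"
    using E by (simp add: sum_distrib_left[symmetric] sum_Pow_power_card)
  finally show ?thesis .
qed

lemma one_plus_power_le_exp:
  fixes s :: real
  assumes "0 \<le> s"
  shows "(1 + s) ^ n \<le> exp (s * real n)"
proof -
  have "(1 + s) ^ n \<le> exp s ^ n"
    using assms by (intro power_mono exp_ge_add_one_self) auto
  then show ?thesis
    by (simp add: exp_of_nat_mult[symmetric] mult.commute)
qed

lemma sum_Pow_power_card_le_exp: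
  fixes s :: real
  assumes "finite A" "0 \<le> s"
  shows "(\<Sum>X\<in>Pow A. s ^ card X) \<le> exp (s * real (card A))"
  using one_plus_power_le_exp[OF assms(2)] by (simp add: sum_Pow_power_card assms(1))

definition average :: "'a set \<Rightarrow> ('a \<Rightarrow> real) \<Rightarrow> real" where
  "average S f = (\<Sum>\<pi>\<in>S. f \<pi>) / real (card S)"

lemma average_mono:
  assumes "\<And>\<pi>. \<pi> \<in> S \<Longrightarrow> f \<pi> \<le> g \<pi>"
  shows "average S f \<le> average S g"
  unfolding average_def by (intro divide_right_mono sum_mono assms) auto

lemma average_cong: "(\<And>\<pi>. \<pi> \<in> S \<Longrightarrow> f \<pi> = g \<pi>) \<Longrightarrow> average S f = average S g"
  unfolding average_def by simp

lemma average_cmult: "average S (\<lambda>\<pi>. c * f \<pi>) = c * average S f"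
  by (simp add: average_def sum_distrib_left)

lemma average_mult_average:
  "average S f * average S g = average S (\<lambda>\<pi>. average S (\<lambda>\<pi>'. f \<pi> * g \<pi>'))"
  by (simp add: average_def sum_product sum_divide_distrib)

lemma average_sum: "average S (\<lambda>\<pi>. \<Sum>i\<in>I. f i \<pi>) = (\<Sum>i\<in>I. average S (f i))"
  unfolding average_def by (simp add: sum.swap[of _ S I] sum_divide_distrib)

lemma prob0_eq_average:
  assumes "finite S" "S \<noteq> {}"
  shows "prob0 S \<Gamma> = average S (\<lambda>\<pi>. of_bool (\<Gamma> \<subseteq> \<pi>))"
  using assms by (simp add: prob0_def measure_pmf_of_set average_def Collect_conj_eq Int_commute)

text \<open>Expand each product over the subsets of \<open>\<pi>\<close> and exchange the two sums:
  the indicator of \<open>\<Gamma> \<subseteq> \<pi>\<close> averages to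
  \<open>prob0 S \<Gamma>\<close>. With \<open>f = w - 1\<close> this is the expansion of
  \<open>Y(1)\<close>; with a multiple of an indicator it counts overlaps.\<close>

lemma average_prod_expand:
  fixes f :: "'v set \<Rightarrow> real"
  assumes E: "finite E" and S: "S \<noteq> {}" "\<And>\<pi>. \<pi> \<in> S \<Longrightarrow> \<pi> \<subseteq> E"
  shows "average S (\<lambda>\<pi>. \<Prod>e\<in>\<pi>. 1 + f e) = (\<Sum>\<Gamma>\<in>Pow E. prob0 S \<Gamma> * (\<Prod>e\<in>\<Gamma>. f e))"
proof -
  have fS: "finite S" using S(2) E by (meson PowI finite_Pow_iff finite_subset subsetI)
  have "(\<Prod>e\<in>\<pi>. 1 + f e) = (\<Sum>\<Gamma>\<in>Pow E. (\<Prod>e\<in>\<Gamma>. f e) * of_bool (\<Gamma> \<subseteq> \<pi>))" if "\<pi> \<in> S" for \<pi>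
  proof -
    have "(\<Prod>e\<in>\<pi>. 1 + f e) = (\<Sum>\<Gamma>\<in>Pow \<pi>. \<Prod>e\<in>\<Gamma>. f e)"
      using S(2)[OF that] E by (intro prod_one_plus_expand) (auto dest: finite_subset)
    also have "\<dots> = (\<Sum>\<Gamma>\<in>Pow E. (\<Prod>e\<in>\<Gamma>. f e) * of_bool (\<Gamma> \<subseteq> \<pi>))"
      using S(2)[OF that] E by (intro sum.mono_neutral_cong_left) auto
    finally show ?thesis .
  qed
  then have "average S (\<lambda>\<pi>. \<Prod>e\<in>\<pi>. 1 + f e)
    = average S (\<lambda>\<pi>. \<Sum>\<Gamma>\<in>Pow E. (\<Prod>e\<in>\<Gamma>. f e) * of_bool (\<Gamma> \<subseteq> \<pi>))"
    by (rule average_cong)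
  then show ?thesis
    by (simp add: average_sum average_cmult prob0_eq_average[OF fS S(1)] mult.commute)
qed

text \<open>For fixed \<open>\<pi>\<close> the power is a product over the edges of
  \<open>\<pi>'\<close> with factor \<open>1 + \<theta>\<close> on \<open>\<pi>\<close> and 1
  elsewhere, so \<open>average_prod_expand\<close> applies. Averaging over \<open>\<pi>\<close>
  afterwards yields the second factor \<open>prob0 S \<Gamma>\<close>.\<close>

lemma average_power_card_Int:
  fixes \<theta> :: real
  assumes E: "finite E" and S: "S \<noteq> {}" "\<And>\<pi>. \<pi> \<in> S \<Longrightarrow> \<pi> \<subseteq> E"
  shows "average S (\<lambda>\<pi>. average S (\<lambda>\<pi>'. (1 + \<theta>) ^ card (\<pi> \<inter> \<pi>')))
    = (\<Sum>\<Gamma>\<in>Pow E. \<theta> ^ card \<Gamma> * (prob0 S \<Gamma>)\<^sup>2)"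
proof -
  have fS: "finite S" using S(2) E by (meson PowI finite_Pow_iff finite_subset subsetI)
  have "average S (\<lambda>\<pi>'. (1 + \<theta>) ^ card (\<pi> \<inter> \<pi>'))
    = (\<Sum>\<Gamma>\<in>Pow E. prob0 S \<Gamma> * \<theta> ^ card \<Gamma> * of_bool (\<Gamma> \<subseteq> \<pi>))" if "\<pi> \<in> S" for \<pi>
  proof -
    have "average S (\<lambda>\<pi>'. (1 + \<theta>) ^ card (\<pi> \<inter> \<pi>'))
       = average S (\<lambda>\<pi>'. \<Prod>e\<in>\<pi>'. 1 + \<theta> * of_bool (e \<in> \<pi>))"
    proof (rule average_cong)
      fix \<pi>' assume "\<pi>' \<in> S"
      then have "finite \<pi>'" using S(2) E by (auto dest: finite_subset)
      then have "(\<Prod>e\<in>\<pi>'. 1 + \<theta> * of_bool (e \<in> \<pi>)) = (\<Prod>e\<in>\<pi> \<inter> \<pi>'. 1 + \<theta>)"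
        by (intro prod.mono_neutral_cong_right) auto
      then show "(1 + \<theta>) ^ card (\<pi> \<inter> \<pi>') = (\<Prod>e\<in>\<pi>'. 1 + \<theta> * of_bool (e \<in> \<pi>))" by simp
    qed
    also have "\<dots> = (\<Sum>\<Gamma>\<in>Pow E. prob0 S \<Gamma> * (\<Prod>e\<in>\<Gamma>. \<theta> * of_bool (e \<in> \<pi>)))"
      by (rule average_prod_expand[OF E S])
    also have "\<dots> = (\<Sum>\<Gamma>\<in>Pow E. prob0 S \<Gamma> * \<theta> ^ card \<Gamma> * of_bool (\<Gamma> \<subseteq> \<pi>))"
    proof (rule sum.cong[OF refl])
      fix \<Gamma> assume "\<Gamma> \<in> Pow E"
      then have "finite \<Gamma>" using E by (auto dest: finite_subset)
      then have "(\<Prod>e\<in>\<Gamma>. of_bool (e \<in> \<pi>)) = (of_bool (\<Gamma> \<subseteq> \<pi>) :: real)"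
        by (cases "\<Gamma> \<subseteq> \<pi>") (auto simp: subset_eq intro!: prod.neutral)
      then show "prob0 S \<Gamma> * (\<Prod>e\<in>\<Gamma>. \<theta> * of_bool (e \<in> \<pi>))
        = prob0 S \<Gamma> * \<theta> ^ card \<Gamma> * of_bool (\<Gamma> \<subseteq> \<pi>)"
        by (simp add: prod.distrib)
    qed
    finally show ?thesis .
  qed
  then have "average S (\<lambda>\<pi>. average S (\<lambda>\<pi>'. (1 + \<theta>) ^ card (\<pi> \<inter> \<pi>')))
    = average S (\<lambda>\<pi>. \<Sum>\<Gamma>\<in>Pow E. prob0 S \<Gamma> * \<theta> ^ card \<Gamma> * of_bool (\<Gamma> \<subseteq> \<pi>))"
    by (rule average_cong)
  also have "\<dots> = (\<Sum>\<Gamma>\<in>Pow E. prob0 S \<Gamma> * \<theta> ^ card \<Gamma> * prob0 S \<Gamma>)"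
    by (simp add: average_sum average_cmult prob0_eq_average[OF fS S(1), symmetric])
  finally show ?thesis by (simp add: power2_eq_square mult_ac)
qed

section \<open>Edge sets containing two touching edges\<close>

lemma card_adjacent_edges_le:
  assumes G: "finite_simple_graph V E" and e: "e \<in> E"
  shows "card {f\<in>E. \<not> disjnt e f} \<le> 2 * card V"
proof -
  have fV: "finite V" and e2: "e \<subseteq> V" "card e = 2"
    using G e by (auto simp: finite_simple_graph_def)
  have "{f\<in>E. \<not> disjnt e f} \<subseteq> (\<lambda>(u, x). {u, x}) ` (e \<times> V)"
  proof safe
    fix f assume f: "f \<in> E" "\<not> disjnt e f"
    then obtain u where u: "u \<in> e" "u \<in> f" by (auto simp: disjnt_iff)
    have "f \<subseteq> V" "card f = 2" using G f by (auto simp: finite_simple_graph_def)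
    then obtain x where "f = {u, x}" "x \<in> V"
      using u(2) by (auto simp: card_2_iff)
    then show "f \<in> (\<lambda>(u, x). {u, x}) ` (e \<times> V)" using u by force
  qed
  then have "card {f\<in>E. \<not> disjnt e f} \<le> card ((\<lambda>(u, x). {u, x}) ` (e \<times> V))"
    using fV e2 by (intro card_mono) (auto dest: finite_subset)
  also have "\<dots> \<le> card (e \<times> V)"
    using fV e2 by (intro card_image_le) (auto dest: finite_subset)
  finally show ?thesis using e2 by (simp add: card_cartesian_product)
qed

lemma finite_simple_graph_finite_edges:
  "finite_simple_graph V E \<Longrightarrow> finite E"
  unfolding finite_simple_graph_def by (meson PowI finite_Pow_iff finite_subset subsetI)

text \<open>A union bound over ordered pairs of distinct touching edges: there are at most
  \<open>2 * card V * card E\<close> of them, and the supersets of one pair contribute at most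
  \<open>s^2 * exp (s * card E)\<close>. For \<open>s\<close> of order \<open>p^2\<close> the
  exponential is bounded and the whole is of order \<open>card V / card E\<close>.\<close>

lemma sum_nonmatching_le:
  fixes s :: real
  assumes G: "finite_simple_graph V E" and s: "0 \<le> s"
  shows "(\<Sum>\<Gamma>\<in>{\<Gamma>\<in>Pow E. \<not> partial_matching E \<Gamma>}. s ^ card \<Gamma>)
    \<le> 2 * real (card V) * real (card E) * s\<^sup>2 * exp (s * real (card E))"
proof -
  have fE: "finite E" by (rule finite_simple_graph_finite_edges[OF G])
  define A where "A = (SIGMA e:E. {f\<in>E. \<not> disjnt e f} - {e})"
  have fA: "finite A" unfolding A_def using fE by auto
  have cA: "real (card A) \<le> 2 * real (card V) * real (card E)"
  proof -
    have "card A = (\<Sum>e\<in>E. card ({f\<in>E. \<not> disjnt e f} - {e}))"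
      unfolding A_def using fE by (intro card_SigmaI) auto
    also have "\<dots> \<le> (\<Sum>e\<in>E. 2 * card V)"
      by (intro sum_mono order_trans[OF card_mono card_adjacent_edges_le[OF G]]) (use fE in auto)
    finally have "card A \<le> 2 * card V * card E" by (simp add: mult_ac)
    then show ?thesis
      by (metis of_nat_le_iff of_nat_mult of_nat_numeral)
  qed
  have "(\<Sum>\<Gamma>\<in>{\<Gamma>\<in>Pow E. \<not> partial_matching E \<Gamma>}. s ^ card \<Gamma>)
    \<le> (\<Sum>\<Gamma>\<in>{\<Gamma>\<in>Pow E. \<not> partial_matching E \<Gamma>}. \<Sum>a\<in>A. of_bool ({fst a, snd a} \<subseteq> \<Gamma>) * s ^ card \<Gamma>)"
  proof (rule sum_mono)
    fix \<Gamma> assume "\<Gamma> \<in> {\<Gamma>\<in>Pow E. \<not> partial_matching E \<Gamma>}"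
    then obtain e f where ef: "e \<in> \<Gamma>" "f \<in> \<Gamma>" "e \<noteq> f" "\<not> disjnt e f" "e \<in> E" "f \<in> E"
      by (auto simp: partial_matching_def pairwise_def)
    then have "(e, f) \<in> A" by (auto simp: A_def)
    then have "(\<Sum>a\<in>{(e, f)}. of_bool ({fst a, snd a} \<subseteq> \<Gamma>) * s ^ card \<Gamma>)
      \<le> (\<Sum>a\<in>A. of_bool ({fst a, snd a} \<subseteq> \<Gamma>) * s ^ card \<Gamma>)"
      using fA s by (intro sum_mono2) auto
    then show "s ^ card \<Gamma> \<le> (\<Sum>a\<in>A. of_bool ({fst a, snd a} \<subseteq> \<Gamma>) * s ^ card \<Gamma>)"
      using ef by simp
  qed
  also have "\<dots> \<le> (\<Sum>\<Gamma>\<in>Pow E. \<Sum>a\<in>A. of_bool ({fst a, snd a} \<subseteq> \<Gamma>) * s ^ card \<Gamma>)"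
    using fE s by (intro sum_mono2) (auto intro!: sum_nonneg)
  also have "\<dots> = (\<Sum>a\<in>A. \<Sum>\<Gamma>\<in>{\<Gamma>\<in>Pow E. {fst a, snd a} \<subseteq> \<Gamma>}. s ^ card \<Gamma>)"
    using fE by (subst sum.swap) (intro sum.cong refl sum.mono_neutral_cong_right; auto)
  also have "\<dots> \<le> (\<Sum>a\<in>A. s\<^sup>2 * exp (s * real (card E)))"
  proof (rule sum_mono)
    fix a assume "a \<in> A"
    then have a: "fst a \<noteq> snd a" "{fst a, snd a} \<subseteq> E" by (auto simp: A_def)
    have "(\<Sum>\<Gamma>\<in>{\<Gamma>\<in>Pow E. {fst a, snd a} \<subseteq> \<Gamma>}. s ^ card \<Gamma>)
      = s\<^sup>2 * (1 + s) ^ card (E - {fst a, snd a})"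
      using sum_supersets_power_card[OF fE a(2), of s] a(1) by (simp add: power2_eq_square)
    also have "\<dots> \<le> s\<^sup>2 * (1 + s) ^ card E"
      using s fE by (intro mult_left_mono power_increasing card_mono) auto
    also have "\<dots> \<le> s\<^sup>2 * exp (s * real (card E))"
      by (intro mult_left_mono one_plus_power_le_exp s) auto
    finally show "(\<Sum>\<Gamma>\<in>{\<Gamma>\<in>Pow E. {fst a, snd a} \<subseteq> \<Gamma>}. s ^ card \<Gamma>) \<le> s\<^sup>2 * exp (s * real (card E))" .
  qed
  also have "\<dots> \<le> 2 * real (card V) * real (card E) * (s\<^sup>2 * exp (s * real (card E)))"
    using cA by (auto intro!: mult_right_mono)
  finally show ?thesis by (simp add: mult.assoc)
qed

section \<open>Containment probabilities in a single graph\<close>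

locale spread_subgraphs =
  fixes V :: "'v set" and E :: "'v set set" and S :: "'v set set set" and m :: nat and \<rho> R p :: real
  assumes graph: "finite_simple_graph V E"
    and S_nonempty: "S \<noteq> {}"
    and S_subgraphs: "\<And>\<pi>. \<pi> \<in> S \<Longrightarrow> \<pi> \<subseteq> E"
    and S_card: "\<And>\<pi>. \<pi> \<in> S \<Longrightarrow> card \<pi> = m"
    and m_pos: "0 < m" and E_nonempty: "E \<noteq> {}"
    and edge_prob: "\<And>e. e \<in> E \<Longrightarrow> prob0 S {e} = p"
    and p_eq: "p = real m / real (card E)"
    and rho_nonneg: "0 \<le> \<rho>" and rho_le: "1 + \<rho> \<le> R"
    and matching_prob: "\<And>\<Gamma>. partial_matching E \<Gamma> \<Longrightarrow>
      \<bar>prob0 S \<Gamma> / (\<Prod>e\<in>\<Gamma>. prob0 S {e}) - 1\<bar> \<le> \<rho> ^ card \<Gamma> / sqrt (real m)"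
    and nonmatching_prob: "\<And>\<Gamma>. \<Gamma> \<in> sub_collection S \<Longrightarrow> \<not> partial_matching E \<Gamma> \<Longrightarrow>
      prob0 S \<Gamma> \<le> R ^ card \<Gamma> * (\<Prod>e\<in>\<Gamma>. prob0 S {e})"
begin

lemma finite_E: "finite E"
  by (rule finite_simple_graph_finite_edges[OF graph])

lemma finite_S: "finite S"
  using S_subgraphs finite_E by (meson PowI finite_Pow_iff finite_subset subsetI)

lemma card_E_pos: "0 < card E"
  using finite_E E_nonempty by (simp add: card_gt_0_iff)

lemma p_pos: "0 < p"
  using m_pos card_E_pos by (simp add: p_eq)

lemma R_ge_1: "1 \<le> R"
  using rho_nonneg rho_le by simp

lemma prod_edge_prob: "\<Gamma> \<subseteq> E \<Longrightarrow> (\<Prod>e\<in>\<Gamma>. prob0 S {e}) = p ^ card \<Gamma>"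
  using edge_prob by (simp add: subset_eq)

lemma prob0_nonneg: "0 \<le> prob0 S \<Gamma>"
  by (simp add: prob0_def)

lemma matching_deviation:
  assumes "partial_matching E \<Gamma>"
  shows "\<bar>prob0 S \<Gamma> - p ^ card \<Gamma>\<bar> \<le> (\<rho> * p) ^ card \<Gamma> / sqrt (real m)"
proof -
  have sub: "\<Gamma> \<subseteq> E" using assms by (simp add: partial_matching_def)
  have pp: "0 < p ^ card \<Gamma>" using p_pos by simp
  have "\<bar>prob0 S \<Gamma> / p ^ card \<Gamma> - 1\<bar> \<le> \<rho> ^ card \<Gamma> / sqrt (real m)"
    using matching_prob[OF assms] by (simp add: prod_edge_prob[OF sub])
  moreover have "prob0 S \<Gamma> / p ^ card \<Gamma> - 1 = (prob0 S \<Gamma> - p ^ card \<Gamma>) / p ^ card \<Gamma>"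
    using p_pos by (simp add: diff_divide_distrib)
  ultimately have "\<bar>prob0 S \<Gamma> - p ^ card \<Gamma>\<bar> / p ^ card \<Gamma> \<le> \<rho> ^ card \<Gamma> / sqrt (real m)"
    using pp by simp
  then have "\<bar>prob0 S \<Gamma> - p ^ card \<Gamma>\<bar> \<le> \<rho> ^ card \<Gamma> / sqrt (real m) * p ^ card \<Gamma>"
    using pp by (simp add: pos_divide_le_eq)
  then show ?thesis by (simp add: power_mult_distrib)
qed

text \<open>The single constant \<open>R\<close> absorbs both hypotheses: for a nonempty matching
  \<open>p^k + (\<rho> * p)^k\<close> is at most \<open>((1 + \<rho>) * p)^k\<close>, on the other
  members of \<open>sub_collection S\<close> the bound is assumed, and any remaining set has
  probability 0.\<close>

lemma prob0_le:
  assumes "\<Gamma> \<subseteq> E"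
  shows "prob0 S \<Gamma> \<le> (R * p) ^ card \<Gamma>"
proof (cases "partial_matching E \<Gamma>")
  case True
  show ?thesis
  \<comment> \<open>The empty set is separate because \<open>1 + \<rho> ^ 0 = 2\<close> exceeds
    \<open>(1 + \<rho>) ^ 0 = 1\<close>.\<close>
  proof (cases "\<Gamma> = {}")
    case True
    then show ?thesis by (simp add: prob0_def)
  next
    case False
    then have k: "card \<Gamma> \<noteq> 0" using assms finite_E by (auto dest: finite_subset)
    have "prob0 S \<Gamma> \<le> p ^ card \<Gamma> + (\<rho> * p) ^ card \<Gamma> / sqrt (real m)"
      using matching_deviation[OF True] by simp
    also have "\<dots> \<le> p ^ card \<Gamma> + (\<rho> * p) ^ card \<Gamma>"
    proof -
      have "(\<rho> * p) ^ card \<Gamma> / sqrt (real m) \<le> (\<rho> * p) ^ card \<Gamma> / 1"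
        using m_pos rho_nonneg p_pos by (intro divide_left_mono) auto
      then show ?thesis by simp
    qed
    also have "\<dots> = (1 + \<rho> ^ card \<Gamma>) * p ^ card \<Gamma>"
      by (simp add: algebra_simps)
    also have "\<dots> \<le> (1 + \<rho>) ^ card \<Gamma> * p ^ card \<Gamma>"
    proof (intro mult_right_mono)
      obtain j where j: "card \<Gamma> = Suc j" using k not0_implies_Suc by blast
      have "1 + \<rho> ^ Suc j \<le> (1 + \<rho>) ^ Suc j" for j
      proof (induction j)
        case (Suc j)
        have "1 + \<rho> ^ Suc (Suc j) \<le> (1 + \<rho> ^ Suc j) * (1 + \<rho>)"
          using rho_nonneg by (simp add: algebra_simps)
        also have "\<dots> \<le> (1 + \<rho>) ^ Suc j * (1 + \<rho>)"
          using Suc rho_nonneg by (intro mult_right_mono) auto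
        finally show ?case by (simp add: mult_ac)
      qed simp
      then show "1 + \<rho> ^ card \<Gamma> \<le> (1 + \<rho>) ^ card \<Gamma>" by (simp add: j)
    qed (use p_pos in auto)
    also have "\<dots> \<le> R ^ card \<Gamma> * p ^ card \<Gamma>"
      using rho_nonneg rho_le p_pos by (intro mult_right_mono power_mono) auto
    finally show ?thesis by (simp add: power_mult_distrib)
  qed
next
  case False
  show ?thesis
  proof (cases "\<Gamma> \<in> sub_collection S")
    case True
    then show ?thesis
      using nonmatching_prob[OF True False] by (simp add: prod_edge_prob[OF assms] power_mult_distrib)
  next
    case False
    then have "prob0 S \<Gamma> = 0"
      unfolding prob0_eq_average[OF finite_S S_nonempty]
      by (auto simp: average_def sub_collection_def intro!: sum.neutral)
    then show ?thesis using R_ge_1 p_pos by simp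
  qed
qed

text \<open>Bounding each \<open>prob0\<close> by \<open>(R * p) ^ card \<Gamma>\<close> in
  \<open>average_power_card_Int\<close> leaves a binomial sum over all subsets of \<open>E\<close>.
  The exponent contains \<open>p^2 * card E\<close>, which stays bounded along the sequence of
  graphs.\<close>

lemma average_overlap_le:
  assumes "0 \<le> \<theta>"
  shows "average S (\<lambda>\<pi>. average S (\<lambda>\<pi>'. (1 + \<theta>) ^ card (\<pi> \<inter> \<pi>')))
    \<le> exp (\<theta> * R\<^sup>2 * (p\<^sup>2 * real (card E)))"
proof -
  have "average S (\<lambda>\<pi>. average S (\<lambda>\<pi>'. (1 + \<theta>) ^ card (\<pi> \<inter> \<pi>')))
    = (\<Sum>\<Gamma>\<in>Pow E. \<theta> ^ card \<Gamma> * (prob0 S \<Gamma>)\<^sup>2)"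
    by (rule average_power_card_Int[OF finite_E S_nonempty S_subgraphs])
  also have "\<dots> \<le> (\<Sum>\<Gamma>\<in>Pow E. (\<theta> * (R * p)\<^sup>2) ^ card \<Gamma>)"
  proof (rule sum_mono)
    fix \<Gamma> assume "\<Gamma> \<in> Pow E"
    then have "(prob0 S \<Gamma>)\<^sup>2 \<le> ((R * p) ^ card \<Gamma>)\<^sup>2"
      by (intro power_mono prob0_le prob0_nonneg) auto
    then have "\<theta> ^ card \<Gamma> * (prob0 S \<Gamma>)\<^sup>2 \<le> \<theta> ^ card \<Gamma> * ((R * p) ^ card \<Gamma>)\<^sup>2"
      using assms by (intro mult_left_mono) auto
    then show "\<theta> ^ card \<Gamma> * (prob0 S \<Gamma>)\<^sup>2 \<le> (\<theta> * (R * p)\<^sup>2) ^ card \<Gamma>"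
      by (simp add: power_mult_distrib power_mult[symmetric] mult.commute)
  qed
  also have "\<dots> \<le> exp (\<theta> * (R * p)\<^sup>2 * real (card E))"
    using assms by (intro sum_Pow_power_card_le_exp finite_E) auto
  finally show ?thesis by (simp add: power_mult_distrib mult_ac)
qed

text \<open>With \<open>v\<close> the variance of \<open>w\<close>, the left side is the squared
  mean-square distance between \<open>Y(1)\<close> and the explicit product. Matchings enter with a
  squared relative error of order \<open>1 / m\<close>; the other sets are bounded crudely and are
  negligible because they are few.\<close>

lemma sum_deviation_le:
  assumes v: "0 \<le> v"
  shows "(\<Sum>\<Gamma>\<in>Pow E. v ^ card \<Gamma> * (prob0 S \<Gamma> - p ^ card \<Gamma>)\<^sup>2)
    \<le> exp (v * \<rho>\<^sup>2 * (p\<^sup>2 * real (card E))) / real m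
      + 2 * real (card V) / real (card E) * (v * R\<^sup>2 * (p\<^sup>2 * real (card E)))\<^sup>2
        * exp (v * R\<^sup>2 * (p\<^sup>2 * real (card E)))"
proof -
  let ?N = "real (card E)" and ?s = "v * (R * p)\<^sup>2" and ?r = "v * (\<rho> * p)\<^sup>2"
  let ?d = "\<lambda>\<Gamma>. v ^ card \<Gamma> * (prob0 S \<Gamma> - p ^ card \<Gamma>)\<^sup>2"
  have "(\<Sum>\<Gamma>\<in>Pow E. ?d \<Gamma>) \<le> (\<Sum>\<Gamma>\<in>Pow E. ?r ^ card \<Gamma> / real m
      + of_bool (\<not> partial_matching E \<Gamma>) * ?s ^ card \<Gamma>)"
  proof (rule sum_mono)
    fix \<Gamma> assume \<Gamma>: "\<Gamma> \<in> Pow E"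
    show "?d \<Gamma> \<le> ?r ^ card \<Gamma> / real m + of_bool (\<not> partial_matching E \<Gamma>) * ?s ^ card \<Gamma>"
    proof (cases "partial_matching E \<Gamma>")
      case True
      have "(prob0 S \<Gamma> - p ^ card \<Gamma>)\<^sup>2 \<le> ((\<rho> * p) ^ card \<Gamma> / sqrt (real m))\<^sup>2"
        using power_mono[OF matching_deviation[OF True], of 2] by simp
      also have "\<dots> = ((\<rho> * p)\<^sup>2) ^ card \<Gamma> / real m"
        by (simp add: power_divide power_mult[symmetric] mult.commute)
      finally have "?d \<Gamma> \<le> v ^ card \<Gamma> * (((\<rho> * p)\<^sup>2) ^ card \<Gamma> / real m)"
        using v by (intro mult_left_mono) auto
      then show ?thesis using True by (simp add: power_mult_distrib)
    next
      case False
      have "p ^ card \<Gamma> \<le> (R * p) ^ card \<Gamma>"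
        using R_ge_1 p_pos by (intro power_mono) auto
      then have "\<bar>prob0 S \<Gamma> - p ^ card \<Gamma>\<bar> \<le> (R * p) ^ card \<Gamma>"
        using prob0_le[of \<Gamma>] prob0_nonneg[of \<Gamma>] p_pos \<Gamma>
        by (smt (verit) PowD zero_le_power)
      then have "(prob0 S \<Gamma> - p ^ card \<Gamma>)\<^sup>2 \<le> ((R * p) ^ card \<Gamma>)\<^sup>2"
        using power_mono[of "\<bar>prob0 S \<Gamma> - p ^ card \<Gamma>\<bar>" _ 2] by simp
      then have "?d \<Gamma> \<le> v ^ card \<Gamma> * ((R * p)\<^sup>2) ^ card \<Gamma>"
        using v by (intro mult_left_mono) (auto simp: power_mult[symmetric] mult.commute)
      also have "\<dots> = ?s ^ card \<Gamma>" by (simp add: power_mult_distrib)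
      finally show ?thesis using False v by (simp add: add_increasing)
    qed
  qed
  also have "\<dots> = (\<Sum>\<Gamma>\<in>Pow E. ?r ^ card \<Gamma>) / real m
      + (\<Sum>\<Gamma>\<in>Pow E. of_bool (\<not> partial_matching E \<Gamma>) * ?s ^ card \<Gamma>)"
    by (simp add: sum.distrib sum_divide_distrib)
  also have "(\<Sum>\<Gamma>\<in>Pow E. of_bool (\<not> partial_matching E \<Gamma>) * ?s ^ card \<Gamma>)
      = (\<Sum>\<Gamma>\<in>{\<Gamma>\<in>Pow E. \<not> partial_matching E \<Gamma>}. ?s ^ card \<Gamma>)"
    using finite_E by (intro sum.mono_neutral_cong_right) auto
  also have "(\<Sum>\<Gamma>\<in>Pow E. ?r ^ card \<Gamma>) / real m + (\<Sum>\<Gamma>\<in>{\<Gamma>\<in>Pow E. \<not> partial_matching E \<Gamma>}. ?s ^ card \<Gamma>)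
      \<le> exp (?r * ?N) / real m + 2 * real (card V) * ?N * ?s\<^sup>2 * exp (?s * ?N)"
    using v by (intro add_mono divide_right_mono sum_Pow_power_card_le_exp sum_nonmatching_le finite_E graph) auto
  \<comment> \<open>The bounded quantity is \<open>?s * ?N\<close>, so a factor \<open>?N^2\<close>
    is moved into the square and leaves \<open>1 / ?N\<close> behind.\<close>
  also have "2 * real (card V) * ?N * ?s\<^sup>2 = 2 * real (card V) / ?N * (v * R\<^sup>2 * (p\<^sup>2 * ?N))\<^sup>2"
    using card_E_pos by (simp add: power_mult_distrib power2_eq_square)
  finally show ?thesis by (simp add: power_mult_distrib mult_ac)
qed

end

section \<open>Products of independent edge weights\<close>

lemma abs_diff_mult_le:
  fixes a b c d C :: real
  assumes "\<bar>a - c\<bar> \<le> t" "\<bar>b - d\<bar> \<le> t" "\<bar>b\<bar> \<le> C" "\<bar>c\<bar> \<le> C"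
  shows "\<bar>a * b - c * d\<bar> \<le> 2 * C * t"
proof -
  have "a * b - c * d = (a - c) * b + c * (b - d)" by (simp add: algebra_simps)
  then have "\<bar>a * b - c * d\<bar> \<le> \<bar>a - c\<bar> * \<bar>b\<bar> + \<bar>c\<bar> * \<bar>b - d\<bar>"
    by (metis abs_mult abs_triangle_ineq)
  also have "\<dots> \<le> t * C + C * t"
    using assms by (intro add_mono mult_mono) auto
  finally show ?thesis by simp
qed

locale iid_weights = prob_space M for M :: "'w measure" +
  fixes E :: "'e set" and \<omega> :: "'e \<Rightarrow> 'w \<Rightarrow> ereal" and \<mu> :: "ereal measure" and x :: "ereal \<Rightarrow> real"
  assumes finite_index: "finite E"
    and indep: "indep_vars (\<lambda>_. borel) \<omega> E"
    and law: "\<And>e. e \<in> E \<Longrightarrow> distr M borel (\<omega> e) = \<mu>"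
    and mu_prob: "prob_space \<mu>" and mu_sets: "sets \<mu> = sets borel"
    and x_measurable[measurable]: "x \<in> borel_measurable borel"
begin

lemma mu_measurable_eq: "borel_measurable \<mu> = (borel_measurable borel :: (ereal \<Rightarrow> _::topological_space) set)"
  by (rule measurable_cong_sets[OF mu_sets refl])

lemma omega_measurable: "e \<in> E \<Longrightarrow> \<omega> e \<in> borel_measurable M"
  using indep by (simp add: indep_vars_def)

lemma
  fixes f :: "'e \<Rightarrow> ereal \<Rightarrow> 'b::{real_normed_field, banach, second_countable_topology}"
  assumes A: "A \<subseteq> E" and f: "\<And>e. e \<in> A \<Longrightarrow> integrable \<mu> (f e)"
  shows integrable_prod: "integrable M (\<lambda>y. \<Prod>e\<in>A. f e (\<omega> e y))"
    and expectation_prod: "(\<integral>y. (\<Prod>e\<in>A. f e (\<omega> e y)) \<partial>M) = (\<Prod>e\<in>A. \<integral>z. f e z \<partial>\<mu>)"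
proof -
  have fin: "finite A" using A finite_index by (rule finite_subset)
  have meas: "f e \<in> borel_measurable borel" if "e \<in> A" for e
    using borel_measurable_integrable[OF f[OF that]] by (simp add: mu_measurable_eq)
  have ind: "indep_vars (\<lambda>_. borel) (\<lambda>e y. f e (\<omega> e y)) A"
    by (rule indep_vars_compose2[OF indep_vars_subset[OF indep A]]) (rule meas)
  have int: "integrable M (\<lambda>y. f e (\<omega> e y))" if "e \<in> A" for e
    using f[OF that] law[of e] omega_measurable[of e] meas[OF that] A that
    by (subst integrable_distr_eq[symmetric, where N = borel]) auto
  show "integrable M (\<lambda>y. \<Prod>e\<in>A. f e (\<omega> e y))"
    by (rule indep_vars_integrable[OF fin ind int])
  have "(\<integral>y. (\<Prod>e\<in>A. f e (\<omega> e y)) \<partial>M) = (\<Prod>e\<in>A. \<integral>y. f e (\<omega> e y) \<partial>M)"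
    by (rule indep_vars_lebesgue_integral[OF fin ind int])
  also have "\<dots> = (\<Prod>e\<in>A. \<integral>z. f e z \<partial>\<mu>)"
  proof (rule prod.cong[OF refl])
    fix e assume e: "e \<in> A"
    then show "(\<integral>y. f e (\<omega> e y) \<partial>M) = (\<integral>z. f e z \<partial>\<mu>)"
      using law[of e] omega_measurable[of e] meas[OF e] A
      by (subst integral_distr[symmetric, where N = borel]) auto
  qed
  finally show "(\<integral>y. (\<Prod>e\<in>A. f e (\<omega> e y)) \<partial>M) = (\<Prod>e\<in>A. \<integral>z. f e z \<partial>\<mu>)" .
qed

definition total :: "'e set \<Rightarrow> 'w \<Rightarrow> real" where
  "total A y = (\<Sum>e\<in>A. x (\<omega> e y))"

text \<open>Packing the product of factors and the observable of the total into one function of the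
  weights on \<open>A\<close> makes the values on disjoint edge sets independent. For
  \<open>u = w\<close> the expectation is the mean of \<open>h\<close> of the total under the tilted
  law.\<close>

definition weighted :: "(ereal \<Rightarrow> real) \<Rightarrow> (real \<Rightarrow> real) \<Rightarrow> 'e set \<Rightarrow> 'w \<Rightarrow> real" where
  "weighted u h A y = (\<Prod>e\<in>A. u (\<omega> e y)) * h (total A y)"

lemma total_measurable: "A \<subseteq> E \<Longrightarrow> total A \<in> borel_measurable M"
  unfolding total_def
  by (intro borel_measurable_sum measurable_compose[OF omega_measurable x_measurable]) auto

lemma weighted_measurable:
  assumes "A \<subseteq> E" and u: "u \<in> borel_measurable borel" and h: "h \<in> borel_measurable borel"
  shows "weighted u h A \<in> borel_measurable M"
  unfolding weighted_def
  by (intro borel_measurable_times borel_measurable_prod measurable_compose[OF omega_measurable u]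
      measurable_compose[OF total_measurable h] assms) (use assms in auto)

text \<open>Three blocks are what a pair of subgraphs produces: the shared edges and the two
  remainders. Each factor depends on the weights in its own block only, and restrictions of an
  independent family to disjoint index sets are independent.\<close>

lemma
  assumes sub: "A \<subseteq> E" "B \<subseteq> E" "C \<subseteq> E" and disj: "A \<inter> B = {}" "A \<inter> C = {}" "B \<inter> C = {}"
    and u[measurable]: "u1 \<in> borel_measurable borel" "u2 \<in> borel_measurable borel" "u3 \<in> borel_measurable borel"
    and h[measurable]: "h1 \<in> borel_measurable borel" "h2 \<in> borel_measurable borel" "h3 \<in> borel_measurable borel"
    and int: "integrable M (weighted u1 h1 A)" "integrable M (weighted u2 h2 B)" "integrable M (weighted u3 h3 C)"
  shows integrable_weighted_mult:
      "integrable M (\<lambda>y. weighted u1 h1 A y * weighted u2 h2 B y * weighted u3 h3 C y)"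
    and expectation_weighted_mult:
      "(\<integral>y. weighted u1 h1 A y * weighted u2 h2 B y * weighted u3 h3 C y \<partial>M)
        = (\<integral>y. weighted u1 h1 A y \<partial>M) * (\<integral>y. weighted u2 h2 B y \<partial>M) * (\<integral>y. weighted u3 h3 C y \<partial>M)"
proof -
  define L where "L = {0, 1, 2 :: nat}"
  define K where "K j = (if j = 0 then A else if j = 1 then B else C)" for j :: nat
  define u where "u j = (if j = 0 then u1 else if j = 1 then u2 else u3)" for j :: nat
  define h where "h j = (if j = 0 then h1 else if j = 1 then h2 else h3)" for j :: nat
  have um[measurable]: "u j \<in> borel_measurable borel" and hm[measurable]: "h j \<in> borel_measurable borel" for j
    by (auto simp: u_def h_def)
  have K: "K j \<subseteq> E" for j using sub by (simp add: K_def)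
  have "disjoint_family_on K L"
    using disj by (auto simp: disjoint_family_on_def L_def K_def)
  from indep_vars_restrict[OF indep K this]
  have ind: "indep_vars (\<lambda>j. PiM (K j) (\<lambda>_. borel)) (\<lambda>j y. restrict (\<lambda>e. \<omega> e y) (K j)) L" .
  have "indep_vars (\<lambda>_. borel) (\<lambda>j y. weighted (u j) (h j) (K j) y) L"
  proof -
    have "indep_vars (\<lambda>_. borel) (\<lambda>j y. (\<lambda>z. (\<Prod>e\<in>K j. u j (z e)) * h j (\<Sum>e\<in>K j. x (z e)))
      (restrict (\<lambda>e. \<omega> e y) (K j))) L"
      by (rule indep_vars_compose2[OF ind]) measurable
    then show ?thesis
      by (simp add: weighted_def total_def cong: prod.cong sum.cong)
  qed
  moreover have "integrable M (\<lambda>y. weighted (u j) (h j) (K j) y)" if "j \<in> L" for j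
    using int that by (auto simp: u_def h_def K_def L_def)
  moreover have "finite L" by (simp add: L_def)
  ultimately have "integrable M (\<lambda>y. \<Prod>j\<in>L. weighted (u j) (h j) (K j) y)"
    and "(\<integral>y. (\<Prod>j\<in>L. weighted (u j) (h j) (K j) y) \<partial>M)
      = (\<Prod>j\<in>L. \<integral>y. weighted (u j) (h j) (K j) y \<partial>M)"
    by (auto intro: indep_vars_integrable indep_vars_lebesgue_integral)
  then show "integrable M (\<lambda>y. weighted u1 h1 A y * weighted u2 h2 B y * weighted u3 h3 C y)"
    "(\<integral>y. weighted u1 h1 A y * weighted u2 h2 B y * weighted u3 h3 C y \<partial>M)
        = (\<integral>y. weighted u1 h1 A y \<partial>M) * (\<integral>y. weighted u2 h2 B y \<partial>M) * (\<integral>y. weighted u3 h3 C y \<partial>M)"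
    by (simp_all add: L_def u_def h_def K_def mult.assoc)
qed

lemma
  assumes A: "A \<subseteq> E" and u: "integrable \<mu> u"
  shows integrable_weighted_one: "integrable M (weighted u (\<lambda>_. 1) A)"
    and expectation_weighted_one: "(\<integral>y. weighted u (\<lambda>_. 1) A y \<partial>M) = (\<integral>z. u z \<partial>\<mu>) ^ card A"
  using integrable_prod[OF A, of "\<lambda>_. u"] expectation_prod[OF A, of "\<lambda>_. u"] u
  by (simp_all add: weighted_def[abs_def])

lemma integrable_weighted_bounded:
  assumes A: "A \<subseteq> E" and u: "integrable \<mu> u" and h: "h \<in> borel_measurable borel" and b: "\<And>t. \<bar>h t\<bar> \<le> C"
  shows "integrable M (weighted u h A)"
proof (rule Bochner_Integration.integrable_bound[OF integrable_mult_right[OF integrable_weighted_one[OF A u], of C]])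
  show "weighted u h A \<in> borel_measurable M"
    using borel_measurable_integrable[OF u] h by (intro weighted_measurable A) (simp_all add: mu_measurable_eq)
  have "0 \<le> C" using b[of 0] by linarith
  have "\<bar>h (total A y)\<bar> * \<bar>\<Prod>e\<in>A. u (\<omega> e y)\<bar> \<le> C * \<bar>\<Prod>e\<in>A. u (\<omega> e y)\<bar>" for y
    by (intro mult_right_mono b) auto
  then show "AE y in M. norm (weighted u h A y) \<le> norm (C * weighted u (\<lambda>_. 1) A y)"
    using \<open>0 \<le> C\<close> by (auto simp: weighted_def abs_mult mult.commute)
qed

text \<open>By the triangle inequality the total is replaced by a sum over single edges
  \<open>e\<close>; each term is a product over \<open>A\<close> with factor
  \<open>u * \<bar>x\<bar>\<close> at \<open>e\<close> and \<open>u\<close> elsewhere. That the mean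
  of \<open>u\<close> is at least 1 permits the exponent \<open>card A\<close> in place of
  \<open>card A - 1\<close>.\<close>

lemma
  assumes A: "A \<subseteq> E" and u: "integrable \<mu> u" and u0: "\<And>z. 0 \<le> u z" and u1: "1 \<le> (\<integral>z. u z \<partial>\<mu>)"
    and ux: "integrable \<mu> (\<lambda>z. u z * \<bar>x z\<bar>)" "(\<integral>z. u z * \<bar>x z\<bar> \<partial>\<mu>) \<le> D"
  shows integrable_weighted_abs: "integrable M (weighted u abs A)"
    and expectation_weighted_abs_le:
      "(\<integral>y. weighted u abs A y \<partial>M) \<le> real (card A) * (\<integral>z. u z \<partial>\<mu>) ^ card A * D"
proof -
  let ?U = "\<integral>z. u z \<partial>\<mu>"
  have fin: "finite A" using A finite_index by (rule finite_subset)
  define f where "f e g z = u z * (if g = e then \<bar>x z\<bar> else 1)" for e g :: 'e and z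
  have fint: "integrable \<mu> (f e g)" for e g
    using u ux(1) by (cases "g = e") (auto simp: f_def[abs_def])
  have prod_f: "(\<Prod>g\<in>A. f e g (\<omega> g y)) = (\<Prod>g\<in>A. u (\<omega> g y)) * \<bar>x (\<omega> e y)\<bar>" if "e \<in> A" for e y
    using fin that by (simp add: f_def prod.distrib)
  have le: "weighted u abs A y \<le> (\<Sum>e\<in>A. \<Prod>g\<in>A. f e g (\<omega> g y))" for y
  proof -
    have "weighted u abs A y \<le> (\<Prod>g\<in>A. u (\<omega> g y)) * (\<Sum>e\<in>A. \<bar>x (\<omega> e y)\<bar>)"
      unfolding weighted_def total_def by (intro mult_left_mono sum_abs prod_nonneg) (use u0 in auto)
    then show ?thesis by (simp add: prod_f sum_distrib_left)
  qed
  have int: "integrable M (\<lambda>y. \<Sum>e\<in>A. \<Prod>g\<in>A. f e g (\<omega> g y))"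
    by (intro Bochner_Integration.integrable_sum integrable_prod A fint)
  have nonneg: "0 \<le> weighted u abs A y" for y
    unfolding weighted_def by (intro mult_nonneg_nonneg prod_nonneg) (use u0 in auto)
  show int': "integrable M (weighted u abs A)"
    by (rule Bochner_Integration.integrable_bound[OF int])
      (use le nonneg borel_measurable_integrable[OF u] in \<open>auto intro!: weighted_measurable A
         simp: mu_measurable_eq intro: order_trans[OF _ abs_ge_self]\<close>)
  have D: "0 \<le> D" using ux(2) u0 by (intro order_trans[OF _ ux(2)] integral_nonneg_AE) auto
  have "(\<integral>y. weighted u abs A y \<partial>M) \<le> (\<integral>y. (\<Sum>e\<in>A. \<Prod>g\<in>A. f e g (\<omega> g y)) \<partial>M)"
    by (intro integral_mono int int' le)
  also have "\<dots> = (\<Sum>e\<in>A. \<Prod>g\<in>A. \<integral>z. f e g z \<partial>\<mu>)"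
    by (subst Bochner_Integration.integral_sum) (auto intro!: integrable_prod expectation_prod A fint sum.cong)
  also have "\<dots> \<le> (\<Sum>e\<in>A. ?U ^ card A * D)"
  proof (rule sum_mono)
    fix e assume e: "e \<in> A"
    have "(\<Prod>g\<in>A. \<integral>z. f e g z \<partial>\<mu>) = (\<integral>z. u z * \<bar>x z\<bar> \<partial>\<mu>) * ?U ^ (card A - 1)"
      using fin e by (subst prod.remove[OF fin e]) (simp add: f_def[abs_def] card_Diff_singleton)
    also have "\<dots> \<le> D * ?U ^ card A"
      using u1 D ux(2) by (intro mult_mono power_increasing) auto
    finally show "(\<Prod>g\<in>A. \<integral>z. f e g z \<partial>\<mu>) \<le> ?U ^ card A * D" by (simp add: mult.commute)
  qed
  finally show "(\<integral>y. weighted u abs A y \<partial>M) \<le> real (card A) * ?U ^ card A * D"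
    by (simp add: mult.assoc)
qed

text \<open>Products over different edge sets are orthogonal: an edge in exactly one of the sets
  contributes the mean of \<open>g\<close>, which is 0. Only the diagonal survives, with one second
  moment of \<open>g\<close> per edge.\<close>

lemma expectation_chaos_square:
  fixes c :: "'e set \<Rightarrow> real"
  assumes g: "integrable \<mu> g" "(\<integral>z. g z \<partial>\<mu>) = 0" and g2: "integrable \<mu> (\<lambda>z. (g z)\<^sup>2)"
  shows "integrable M (\<lambda>y. (\<Sum>\<Gamma>\<in>Pow E. c \<Gamma> * (\<Prod>e\<in>\<Gamma>. g (\<omega> e y)))\<^sup>2)"
    and "(\<integral>y. (\<Sum>\<Gamma>\<in>Pow E. c \<Gamma> * (\<Prod>e\<in>\<Gamma>. g (\<omega> e y)))\<^sup>2 \<partial>M)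
      = (\<Sum>\<Gamma>\<in>Pow E. (\<integral>z. (g z)\<^sup>2 \<partial>\<mu>) ^ card \<Gamma> * (c \<Gamma>)\<^sup>2)"
proof -
  let ?G = "\<lambda>\<Gamma> y. \<Prod>e\<in>\<Gamma>. g (\<omega> e y)"
  have prod: "integrable M (\<lambda>y. ?G \<Gamma> y * ?G \<Delta> y) \<and>
      (\<integral>y. ?G \<Gamma> y * ?G \<Delta> y \<partial>M) = (if \<Gamma> = \<Delta> then (\<integral>z. (g z)\<^sup>2 \<partial>\<mu>) ^ card \<Gamma> else 0)"
    if sub: "\<Gamma> \<in> Pow E" "\<Delta> \<in> Pow E" for \<Gamma> \<Delta>
  proof -
    have fin: "finite \<Gamma>" "finite \<Delta>" using sub finite_index by (auto dest: finite_subset)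
    define f where "f e z = (if e \<in> \<Gamma> \<inter> \<Delta> then (g z)\<^sup>2 else g z)" for e z
    have f_int: "integrable \<mu> (f e)" for e
    proof -
      have "f e = (if e \<in> \<Gamma> \<inter> \<Delta> then (\<lambda>z. (g z)\<^sup>2) else g)" by (auto simp: f_def fun_eq_iff)
      then show ?thesis using g g2 by simp
    qed
    have eq: "?G \<Gamma> y * ?G \<Delta> y = (\<Prod>e\<in>\<Gamma> \<union> \<Delta>. f e (\<omega> e y))" for y
    proof -
      have "?G \<Gamma> y = (\<Prod>e\<in>\<Gamma> \<union> \<Delta>. if e \<in> \<Gamma> then g (\<omega> e y) else 1)"
        "?G \<Delta> y = (\<Prod>e\<in>\<Gamma> \<union> \<Delta>. if e \<in> \<Delta> then g (\<omega> e y) else 1)"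
        using fin by (auto intro!: prod.mono_neutral_cong_left)
      then have "?G \<Gamma> y * ?G \<Delta> y = (\<Prod>e\<in>\<Gamma> \<union> \<Delta>.
          (if e \<in> \<Gamma> then g (\<omega> e y) else 1) * (if e \<in> \<Delta> then g (\<omega> e y) else 1))"
        by (simp only: prod.distrib)
      also have "\<dots> = (\<Prod>e\<in>\<Gamma> \<union> \<Delta>. f e (\<omega> e y))"
        by (intro prod.cong) (auto simp: f_def power2_eq_square)
      finally show ?thesis .
    qed
    have "(\<integral>y. ?G \<Gamma> y * ?G \<Delta> y \<partial>M) = (\<Prod>e\<in>\<Gamma> \<union> \<Delta>. \<integral>z. f e z \<partial>\<mu>)"
      unfolding eq using sub by (intro expectation_prod f_int) auto
    also have "\<dots> = (if \<Gamma> = \<Delta> then (\<integral>z. (g z)\<^sup>2 \<partial>\<mu>) ^ card \<Gamma> else 0)"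
    proof (cases "\<Gamma> = \<Delta>")
      case True
      then show ?thesis by (simp add: f_def[abs_def])
    next
      case False
      then obtain e where "e \<in> \<Gamma> \<union> \<Delta>" "e \<notin> \<Gamma> \<inter> \<Delta>" by auto
      then have "(\<Prod>e\<in>\<Gamma> \<union> \<Delta>. \<integral>z. f e z \<partial>\<mu>) = 0"
        using fin g(2) by (auto intro!: prod_zero bexI[of _ e] simp: f_def[abs_def])
      then show ?thesis using False by simp
    qed
    moreover have "integrable M (\<lambda>y. ?G \<Gamma> y * ?G \<Delta> y)"
      unfolding eq using sub by (intro integrable_prod f_int) auto
    ultimately show ?thesis by simp
  qed
  have expand: "(\<Sum>\<Gamma>\<in>Pow E. c \<Gamma> * ?G \<Gamma> y)\<^sup>2
      = (\<Sum>\<Gamma>\<in>Pow E. \<Sum>\<Delta>\<in>Pow E. c \<Gamma> * c \<Delta> * (?G \<Gamma> y * ?G \<Delta> y))" for y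
    by (simp add: power2_eq_square sum_product mult_ac)
  show "integrable M (\<lambda>y. (\<Sum>\<Gamma>\<in>Pow E. c \<Gamma> * ?G \<Gamma> y)\<^sup>2)"
    unfolding expand using prod by (intro Bochner_Integration.integrable_sum integrable_mult_right) auto
  have "(\<integral>y. (\<Sum>\<Gamma>\<in>Pow E. c \<Gamma> * ?G \<Gamma> y)\<^sup>2 \<partial>M)
      = (\<Sum>\<Gamma>\<in>Pow E. \<Sum>\<Delta>\<in>Pow E. c \<Gamma> * c \<Delta> * (\<integral>y. ?G \<Gamma> y * ?G \<Delta> y \<partial>M))"
    unfolding expand using prod
    by (subst Bochner_Integration.integral_sum; (intro Bochner_Integration.integrable_sum integrable_mult_right sum.cong refl)?; auto)
  also have "\<dots> = (\<Sum>\<Gamma>\<in>Pow E. (\<integral>z. (g z)\<^sup>2 \<partial>\<mu>) ^ card \<Gamma> * (c \<Gamma>)\<^sup>2)"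
  proof (rule sum.cong[OF refl])
    fix \<Gamma> assume \<Gamma>: "\<Gamma> \<in> Pow E"
    have "(\<Sum>\<Delta>\<in>Pow E. c \<Gamma> * c \<Delta> * (\<integral>y. ?G \<Gamma> y * ?G \<Delta> y \<partial>M))
      = (\<Sum>\<Delta>\<in>Pow E. if \<Delta> = \<Gamma> then (c \<Gamma>)\<^sup>2 * (\<integral>z. (g z)\<^sup>2 \<partial>\<mu>) ^ card \<Gamma> else 0)"
      using prod \<Gamma> by (intro sum.cong) (auto simp: power2_eq_square)
    then show "(\<Sum>\<Delta>\<in>Pow E. c \<Gamma> * c \<Delta> * (\<integral>y. ?G \<Gamma> y * ?G \<Delta> y \<partial>M))
      = (\<integral>z. (g z)\<^sup>2 \<partial>\<mu>) ^ card \<Gamma> * (c \<Gamma>)\<^sup>2"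
      using \<Gamma> finite_index by (simp add: mult.commute)
  qed
  finally show "(\<integral>y. (\<Sum>\<Gamma>\<in>Pow E. c \<Gamma> * ?G \<Gamma> y)\<^sup>2 \<partial>M)
      = (\<Sum>\<Gamma>\<in>Pow E. (\<integral>z. (g z)\<^sup>2 \<partial>\<mu>) ^ card \<Gamma> * (c \<Gamma>)\<^sup>2)" .
qed

end

section \<open>Pairs of subgraphs under normalised factors\<close>

locale tilted_weights = iid_weights M E \<omega> \<mu> x
  for M :: "'w measure" and E :: "'e set" and \<omega> \<mu> x +
  fixes w :: "ereal \<Rightarrow> real" and D :: real
  assumes w_measurable[measurable]: "w \<in> borel_measurable borel"
    and w_nonneg: "\<And>z. 0 \<le> w z"
    and w_integrable: "integrable \<mu> w" and w_integral: "(\<integral>z. w z \<partial>\<mu>) = 1"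
    and w2_integrable: "integrable \<mu> (\<lambda>z. (w z)\<^sup>2)"
    and wx_integrable: "integrable \<mu> (\<lambda>z. w z * \<bar>x z\<bar>)"
    and wx_le: "(\<integral>z. w z * \<bar>x z\<bar> \<partial>\<mu>) \<le> D"
    and w2x_integrable: "integrable \<mu> (\<lambda>z. (w z)\<^sup>2 * \<bar>x z\<bar>)"
    and w2x_le: "(\<integral>z. (w z)\<^sup>2 * \<bar>x z\<bar> \<partial>\<mu>) \<le> D"
begin

text \<open>For the normalised Boltzmann factor this is
  \<open>exp (\<psi> (2 * \<beta>) - 2 * \<psi> \<beta>)\<close>: the price of each edge shared by
  two subgraphs.\<close>

definition q :: real where "q = (\<integral>z. (w z)\<^sup>2 \<partial>\<mu>)"

lemma D_nonneg: "0 \<le> D"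
  using w_nonneg by (intro order_trans[OF _ wx_le] integral_nonneg_AE) auto

lemma
  shows eta_integrable: "integrable \<mu> (\<lambda>z. w z - 1)"
    and eta_integral: "(\<integral>z. w z - 1 \<partial>\<mu>) = 0"
    and eta2_integrable: "integrable \<mu> (\<lambda>z. (w z - 1)\<^sup>2)"
    and eta2_integral: "(\<integral>z. (w z - 1)\<^sup>2 \<partial>\<mu>) = q - 1"
proof -
  interpret mu: prob_space \<mu> by (rule mu_prob)
  show "integrable \<mu> (\<lambda>z. w z - 1)" "(\<integral>z. w z - 1 \<partial>\<mu>) = 0"
    using w_integrable w_integral by (auto simp: mu.prob_space)
  have eq: "(w z - 1)\<^sup>2 = (w z)\<^sup>2 - 2 * w z + 1" for z by (simp add: power2_diff)
  show "integrable \<mu> (\<lambda>z. (w z - 1)\<^sup>2)" "(\<integral>z. (w z - 1)\<^sup>2 \<partial>\<mu>) = q - 1"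
    unfolding eq using w_integrable w_integral w2_integrable by (auto simp: mu.prob_space q_def)
qed

lemma q_ge_1: "1 \<le> q"
proof -
  have "0 \<le> (\<integral>z. (w z - 1)\<^sup>2 \<partial>\<mu>)" by (intro integral_nonneg_AE) auto
  then show ?thesis by (simp add: eta2_integral)
qed

lemma abs_expectation_weighted_le:
  assumes A: "A \<subseteq> E" and h: "h \<in> borel_measurable borel" and b: "\<And>t. \<bar>h t\<bar> \<le> C"
  shows "\<bar>\<integral>y. weighted w h A y \<partial>M\<bar> \<le> C"
proof -
  have "\<bar>\<integral>y. weighted w h A y \<partial>M\<bar> \<le> (\<integral>y. \<bar>weighted w h A y\<bar> \<partial>M)"
    by (rule integral_abs_bound)
  also have "\<dots> \<le> (\<integral>y. C * weighted w (\<lambda>_. 1) A y \<partial>M)"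
  proof (rule integral_mono)
    show "integrable M (\<lambda>y. \<bar>weighted w h A y\<bar>)"
      by (intro integrable_abs integrable_weighted_bounded[OF A w_integrable h b])
    show "integrable M (\<lambda>y. C * weighted w (\<lambda>_. 1) A y)"
      by (intro integrable_mult_right integrable_weighted_one A w_integrable)
    show "\<bar>weighted w h A y\<bar> \<le> C * weighted w (\<lambda>_. 1) A y" for y
      using mult_right_mono[OF b[of "total A y"], of "\<Prod>e\<in>A. w (\<omega> e y)"] w_nonneg
      by (simp add: weighted_def abs_mult prod_nonneg mult.commute)
  qed
  also have "\<dots> = C"
    using expectation_weighted_one[OF A w_integrable] by (simp add: w_integral)
  finally show ?thesis .
qed

text \<open>Shared edges occur in both products and so receive the factor \<open>w^2\<close>; every
  other edge keeps a single \<open>w\<close>. This prepares the three-block form, up to the two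
  values of \<open>h\<close>.\<close>

lemma weighted_square_decomp:
  assumes "finite \<pi>" "finite \<pi>'"
  shows "weighted w h \<pi> y * weighted w h \<pi>' y
    = weighted (\<lambda>z. (w z)\<^sup>2) (\<lambda>_. 1) (\<pi> \<inter> \<pi>') y * weighted w (\<lambda>_. 1) (\<pi> - \<pi>') y
       * weighted w (\<lambda>_. 1) (\<pi>' - \<pi>) y * (h (total \<pi> y) * h (total \<pi>' y))"
proof -
  have *: "(\<Prod>e\<in>\<pi>. w (\<omega> e y)) = (\<Prod>e\<in>\<pi> \<inter> \<pi>'. w (\<omega> e y)) * (\<Prod>e\<in>\<pi> - \<pi>'. w (\<omega> e y))"
    if "finite \<pi>" for \<pi> \<pi>'
    using that by (metis prod.Int_Diff)
  show ?thesis
    using *[OF assms(1), of \<pi>'] *[OF assms(2), of \<pi>]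
    by (simp add: weighted_def prod_power_distrib power2_eq_square prod.distrib Int_commute mult_ac)
qed

text \<open>The edges shared by \<open>\<pi>\<close> and \<open>\<pi>'\<close> are the only source of dependence between the two weighted
  totals. Removing their contribution from the argument of \<open>h\<close> makes the factors independent.\<close>

lemma abs_expectation_weighted_mult_le:
  assumes sub: "\<pi> \<subseteq> E" "\<pi>' \<subseteq> E"
    and h[measurable]: "h \<in> borel_measurable borel" and b: "\<And>t. \<bar>h t\<bar> \<le> C"
    and lip: "\<And>s t. \<bar>h s - h t\<bar> \<le> \<epsilon> + l * \<bar>s - t\<bar>" and eps: "0 \<le> \<epsilon>" and l: "0 \<le> l"
    and \<eta>: "\<bar>\<integral>y. weighted w h \<pi> y \<partial>M\<bar> \<le> \<eta>"
  shows "\<bar>\<integral>y. weighted w h \<pi> y * weighted w h \<pi>' y \<partial>M\<bar>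
    \<le> (2 * q) ^ card (\<pi> \<inter> \<pi>') * (C * (\<eta> + 3 * \<epsilon> + 3 * l * D))"
    and "integrable M (\<lambda>y. weighted w h \<pi> y * weighted w h \<pi>' y)"
proof -
  let ?I = "\<pi> \<inter> \<pi>'" and ?A = "\<pi> - \<pi>'" and ?B = "\<pi>' - \<pi>"
  let ?k = "card ?I" and ?w2 = "\<lambda>z. (w z)\<^sup>2"
  let ?one = "\<lambda>_::real. 1::real"
  have fin: "finite \<pi>" "finite \<pi>'" using sub finite_index by (auto dest: finite_subset)
  have subs: "?I \<subseteq> E" "?A \<subseteq> E" "?B \<subseteq> E" using sub by auto
  have disj: "?I \<inter> ?A = {}" "?I \<inter> ?B = {}" "?A \<inter> ?B = {}" by auto
  have C: "0 \<le> C" using b[of 0] by linarith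
  have tot: "total \<pi> y = total ?I y + total ?A y" "total \<pi>' y = total ?I y + total ?B y" for y
    using fin by (simp_all add: total_def sum.Int_Diff Int_commute)
       (metis Int_commute sum.Int_Diff)+
  let ?P = "\<lambda>y. weighted ?w2 ?one ?I y * weighted w ?one ?A y * weighted w ?one ?B y"
  have P0: "0 \<le> ?P y" for y
    unfolding weighted_def by (intro mult_nonneg_nonneg prod_nonneg) (auto intro: w_nonneg)
  have iI: "integrable M (weighted ?w2 ?one ?I)" "integrable M (weighted w ?one ?A)" "integrable M (weighted w ?one ?B)"
    "integrable M (weighted w ?one ?I)"
    by (intro integrable_weighted_one subs w_integrable w2_integrable)+
  have ih: "integrable M (weighted w h ?A)" "integrable M (weighted w h ?B)" "integrable M (weighted w h \<pi>)"
    by (intro integrable_weighted_bounded[OF _ w_integrable h b] subs sub)+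
  have wone: "(\<integral>y. weighted w ?one A y \<partial>M) = 1" if "A \<subseteq> E" for A
    using expectation_weighted_one[OF that w_integrable] by (simp add: w_integral)
  have w2one: "(\<integral>y. weighted ?w2 ?one ?I y \<partial>M) = q ^ ?k"
    using expectation_weighted_one[OF subs(1) w2_integrable] by (simp add: q_def)
  have abs2: "integrable M (weighted ?w2 abs ?I)" "(\<integral>y. weighted ?w2 abs ?I y \<partial>M) \<le> real ?k * q ^ ?k * D"
    using integrable_weighted_abs[OF subs(1) w2_integrable _ _ w2x_integrable w2x_le]
      expectation_weighted_abs_le[OF subs(1) w2_integrable _ _ w2x_integrable w2x_le] q_ge_1
    by (simp_all add: q_def)
  have abs1: "integrable M (weighted w abs ?I)" "(\<integral>y. weighted w abs ?I y \<partial>M) \<le> real ?k * D"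
    using integrable_weighted_abs[OF subs(1) w_integrable w_nonneg _ wx_integrable wx_le]
      expectation_weighted_abs_le[OF subs(1) w_integrable w_nonneg _ wx_integrable wx_le]
    by (simp_all add: w_integral)

  let ?T = "\<lambda>y. weighted w h \<pi> y * weighted w h \<pi>' y"
  \<comment> \<open>\<open>?T1\<close> drops the shared total from both arguments of
    \<open>h\<close>, so its expectation factorises over the three blocks; \<open>?W1\<close> pays
    for the change through the modulus of \<open>h\<close>.\<close>
  let ?T1 = "\<lambda>y. weighted ?w2 ?one ?I y * weighted w h ?A y * weighted w h ?B y"
  let ?W1 = "\<lambda>y. weighted ?w2 abs ?I y * weighted w ?one ?A y * weighted w ?one ?B y"
  have T: "?T y = ?P y * (h (total \<pi> y) * h (total \<pi>' y))" for y
    by (rule weighted_square_decomp[OF fin])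
  have T1: "?T1 y = ?P y * (h (total ?A y) * h (total ?B y))" for y
    by (simp add: weighted_def)
  have W1: "?W1 y = ?P y * \<bar>total ?I y\<bar>" for y
    by (simp add: weighted_def)
  have P_int: "integrable M ?P" "(\<integral>y. ?P y \<partial>M) = q ^ ?k"
    using integrable_weighted_mult[OF subs disj _ _ _ _ _ _ iI(1-3)]
      expectation_weighted_mult[OF subs disj _ _ _ _ _ _ iI(1-3)] wone subs w2one by auto
  have W1_int: "integrable M ?W1" "(\<integral>y. ?W1 y \<partial>M) \<le> real ?k * q ^ ?k * D"
    using integrable_weighted_mult[OF subs disj _ _ _ _ _ _ abs2(1) iI(2,3)]
      expectation_weighted_mult[OF subs disj _ _ _ _ _ _ abs2(1) iI(2,3)] wone subs abs2(2) by auto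
  have T1_int: "integrable M ?T1" "(\<integral>y. ?T1 y \<partial>M)
      = q ^ ?k * (\<integral>y. weighted w h ?A y \<partial>M) * (\<integral>y. weighted w h ?B y \<partial>M)"
    using integrable_weighted_mult[OF subs disj _ _ _ _ _ _ iI(1) ih(1,2)]
      expectation_weighted_mult[OF subs disj _ _ _ _ _ _ iI(1) ih(1,2)] w2one by auto
  show T_int: "integrable M ?T"
  proof (rule Bochner_Integration.integrable_bound[OF integrable_mult_right[OF P_int(1), of "C * C"]])
    show "?T \<in> borel_measurable M"
      by (intro borel_measurable_times weighted_measurable sub) auto
    have "\<bar>?T y\<bar> \<le> C * C * ?P y" for y
    proof -
      have "\<bar>?T y\<bar> = ?P y * (\<bar>h (total \<pi> y)\<bar> * \<bar>h (total \<pi>' y)\<bar>)"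
        unfolding T by (subst abs_mult, subst abs_of_nonneg[OF P0]) (simp only: abs_mult)
      also have "\<dots> \<le> ?P y * (C * C)"
        using C by (intro mult_left_mono mult_mono b P0) auto
      finally show ?thesis by (simp only: mult_ac)
    qed
    then show "AE y in M. norm (?T y) \<le> norm (C * C * ?P y)"
      using P0 C by (intro AE_I2) (simp only: real_norm_def, rule order_trans[OF _ abs_ge_self])
  qed
  have "\<bar>(\<integral>y. ?T y \<partial>M) - (\<integral>y. ?T1 y \<partial>M)\<bar> = \<bar>\<integral>y. ?T y - ?T1 y \<partial>M\<bar>"
    using T_int T1_int by simp
  also have "\<dots> \<le> (\<integral>y. \<bar>?T y - ?T1 y\<bar> \<partial>M)" by (rule integral_abs_bound)
  also have "\<dots> \<le> (\<integral>y. 2 * C * (\<epsilon> * ?P y + l * ?W1 y) \<partial>M)"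
  proof (rule integral_mono)
    show "integrable M (\<lambda>y. \<bar>?T y - ?T1 y\<bar>)" using T_int T1_int by simp
    show "integrable M (\<lambda>y. 2 * C * (\<epsilon> * ?P y + l * ?W1 y))" using P_int W1_int by simp
    fix y
    have "\<bar>h (total \<pi> y) * h (total \<pi>' y) - h (total ?A y) * h (total ?B y)\<bar>
        \<le> 2 * C * (\<epsilon> + l * \<bar>total ?I y\<bar>)"
      using lip[of "total \<pi> y" "total ?A y"] lip[of "total \<pi>' y" "total ?B y"]
      by (intro abs_diff_mult_le b) (simp_all add: tot)
    then have "?P y * \<bar>h (total \<pi> y) * h (total \<pi>' y) - h (total ?A y) * h (total ?B y)\<bar>
        \<le> ?P y * (2 * C * (\<epsilon> + l * \<bar>total ?I y\<bar>))"
      by (intro mult_left_mono P0)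
    moreover have "\<bar>?T y - ?T1 y\<bar> = ?P y * \<bar>h (total \<pi> y) * h (total \<pi>' y) - h (total ?A y) * h (total ?B y)\<bar>"
      unfolding T T1 right_diff_distrib[symmetric] by (subst abs_mult, subst abs_of_nonneg[OF P0]) (rule refl)
    moreover have "?P y * (2 * C * (\<epsilon> + l * \<bar>total ?I y\<bar>)) = 2 * C * (\<epsilon> * ?P y + l * ?W1 y)"
      unfolding W1 by (simp only: algebra_simps)
    ultimately show "\<bar>?T y - ?T1 y\<bar> \<le> 2 * C * (\<epsilon> * ?P y + l * ?W1 y)" by simp
  qed
  also have "\<dots> = 2 * C * (\<epsilon> * q ^ ?k + l * (\<integral>y. ?W1 y \<partial>M))"
    using P_int W1_int by simp
  also have "\<dots> \<le> 2 * C * (\<epsilon> * q ^ ?k + l * (real ?k * q ^ ?k * D))"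
    using C l W1_int(2) by (intro mult_left_mono add_left_mono) auto
  finally have 1: "\<bar>(\<integral>y. ?T y \<partial>M) - (\<integral>y. ?T1 y \<partial>M)\<bar> \<le> q ^ ?k * (2 * C * (\<epsilon> + l * real ?k * D))"
    by (simp add: algebra_simps)

  \<comment> \<open>The smallness hypothesis concerns the whole of \<open>\<pi>\<close>, while
    \<open>?T1\<close> sees only \<open>\<pi> - \<pi>'\<close>. Reinserting the shared factors
    \<open>w\<close>, whose mean is 1, makes the two means comparable. The third block is empty so
    that the three-block lemma still applies.\<close>
  let ?H = "\<lambda>y. weighted w ?one ?I y * weighted w h ?A y * weighted w ?one {} y"
  let ?H2 = "\<lambda>y. weighted w abs ?I y * weighted w ?one ?A y * weighted w ?one {} y"
  let ?H1 = "\<lambda>y. weighted w ?one ?I y * weighted w ?one ?A y * weighted w ?one {} y"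
  have e: "{} \<subseteq> E" "?I \<inter> {} = {}" "?A \<inter> {} = {}" by auto
  have ie: "integrable M (weighted w ?one {})" by (rule integrable_weighted_one[OF e(1) w_integrable])
  have H: "integrable M ?H" "(\<integral>y. ?H y \<partial>M) = (\<integral>y. weighted w h ?A y \<partial>M)"
    using integrable_weighted_mult[OF subs(1,2) e(1) disj(1) e(2,3) _ _ _ _ _ _ iI(4) ih(1) ie]
      expectation_weighted_mult[OF subs(1,2) e(1) disj(1) e(2,3) _ _ _ _ _ _ iI(4) ih(1) ie] wone subs e by auto
  have H1: "integrable M ?H1" "(\<integral>y. ?H1 y \<partial>M) = 1"
    using integrable_weighted_mult[OF subs(1,2) e(1) disj(1) e(2,3) _ _ _ _ _ _ iI(4) iI(2) ie]
      expectation_weighted_mult[OF subs(1,2) e(1) disj(1) e(2,3) _ _ _ _ _ _ iI(4) iI(2) ie] wone subs e by auto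
  have H2: "integrable M ?H2" "(\<integral>y. ?H2 y \<partial>M) \<le> real ?k * D"
    using integrable_weighted_mult[OF subs(1,2) e(1) disj(1) e(2,3) _ _ _ _ _ _ abs1(1) iI(2) ie]
      expectation_weighted_mult[OF subs(1,2) e(1) disj(1) e(2,3) _ _ _ _ _ _ abs1(1) iI(2) ie] wone subs e abs1 by auto
  have wpi: "(\<Prod>e\<in>\<pi>. w (\<omega> e y)) = ?H1 y" for y
    using fin by (simp add: weighted_def prod.Int_Diff[of \<pi> _ \<pi>'])
  have H1_nonneg: "0 \<le> ?H1 y" for y
    unfolding weighted_def by (intro mult_nonneg_nonneg prod_nonneg) (auto intro: w_nonneg)
  have "\<bar>(\<integral>y. weighted w h \<pi> y \<partial>M) - (\<integral>y. ?H y \<partial>M)\<bar> = \<bar>\<integral>y. weighted w h \<pi> y - ?H y \<partial>M\<bar>"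
    using ih H by simp
  also have "\<dots> \<le> (\<integral>y. \<bar>weighted w h \<pi> y - ?H y\<bar> \<partial>M)" by (rule integral_abs_bound)
  also have "\<dots> \<le> (\<integral>y. \<epsilon> * ?H1 y + l * ?H2 y \<partial>M)"
  proof (rule integral_mono)
    show "integrable M (\<lambda>y. \<bar>weighted w h \<pi> y - ?H y\<bar>)" using ih H by simp
    show "integrable M (\<lambda>y. \<epsilon> * ?H1 y + l * ?H2 y)" using H1 H2 by simp
    fix y
    have d: "weighted w h \<pi> y - ?H y = ?H1 y * (h (total \<pi> y) - h (total ?A y))"
      unfolding weighted_def[of w h \<pi>] wpi by (simp add: weighted_def algebra_simps)
    have "\<bar>weighted w h \<pi> y - ?H y\<bar> = ?H1 y * \<bar>h (total \<pi> y) - h (total ?A y)\<bar>"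
      unfolding d by (subst abs_mult, subst abs_of_nonneg[OF H1_nonneg]) (rule refl)
    also have "\<dots> \<le> ?H1 y * (\<epsilon> + l * \<bar>total ?I y\<bar>)"
      using lip[of "total \<pi> y" "total ?A y"] by (intro mult_left_mono H1_nonneg) (simp add: tot)
    also have "\<dots> = \<epsilon> * ?H1 y + l * ?H2 y" by (simp add: weighted_def algebra_simps)
    finally show "\<bar>weighted w h \<pi> y - ?H y\<bar> \<le> \<epsilon> * ?H1 y + l * ?H2 y" .
  qed
  also have "\<dots> = \<epsilon> + l * (\<integral>y. ?H2 y \<partial>M)" using H1 H2 by simp
  also have "\<dots> \<le> \<epsilon> + l * (real ?k * D)" using H2 l by (intro add_left_mono mult_left_mono)
  finally have 2: "\<bar>\<integral>y. weighted w h ?A y \<partial>M\<bar> \<le> \<eta> + \<epsilon> + l * real ?k * D"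
    using \<eta> H(2) by (simp add: mult.assoc)
  \<comment> \<open>It is enough that one of the two means is small; the other is merely bounded by
    \<open>C\<close>.\<close>
  have 3: "\<bar>\<integral>y. weighted w h ?B y \<partial>M\<bar> \<le> C"
    by (rule abs_expectation_weighted_le[OF subs(3) h b])
  have "\<bar>\<integral>y. ?T1 y \<partial>M\<bar> = q ^ ?k * (\<bar>\<integral>y. weighted w h ?A y \<partial>M\<bar> * \<bar>\<integral>y. weighted w h ?B y \<partial>M\<bar>)"
    using q_ge_1 by (simp add: T1_int(2) abs_mult)
  also have "\<dots> \<le> q ^ ?k * ((\<eta> + \<epsilon> + l * real ?k * D) * C)"
    using q_ge_1 2 3 by (intro mult_left_mono mult_mono) auto
  finally have "\<bar>\<integral>y. ?T y \<partial>M\<bar> \<le> q ^ ?k * (C * (\<eta> + 3 * \<epsilon> + 3 * l * D * real ?k))"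
    using 1 by (simp add: algebra_simps)
  \<comment> \<open>The factor \<open>?k\<close>, from one first moment per shared edge, is absorbed
    by \<open>?k \<le> 2 ^ ?k\<close>. The overlap then enters as a pure power, the form in which it
    can be averaged.\<close>
  also have "\<dots> \<le> q ^ ?k * (C * ((\<eta> + 3 * \<epsilon> + 3 * l * D) * 2 ^ ?k))"
  proof -
    have k: "real ?k \<le> 2 ^ ?k" using of_nat_less_two_power[of ?k, where 'a = real] by linarith
    have "0 \<le> \<eta>" using \<eta> by linarith
    then have "\<eta> + 3 * \<epsilon> \<le> (\<eta> + 3 * \<epsilon>) * 2 ^ ?k"
      using eps by (simp add: mult_le_cancel_left1)
    moreover have "3 * l * D * real ?k \<le> 3 * l * D * 2 ^ ?k"
      using k l D_nonneg by (intro mult_left_mono) auto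
    ultimately show ?thesis
      using q_ge_1 C by (intro mult_left_mono) (auto simp: algebra_simps)
  qed
  finally show "\<bar>\<integral>y. ?T y \<partial>M\<bar> \<le> (2 * q) ^ ?k * (C * (\<eta> + 3 * \<epsilon> + 3 * l * D))"
    by (simp add: power_mult_distrib mult_ac)
qed

end

section \<open>Moments of the normalised partition sums\<close>

lemma
  assumes "\<And>\<pi>. \<pi> \<in> S \<Longrightarrow> integrable M (f \<pi>)"
  shows integrable_average: "integrable M (\<lambda>y. average S (\<lambda>\<pi>. f \<pi> y))"
    and integral_average: "(\<integral>y. average S (\<lambda>\<pi>. f \<pi> y) \<partial>M) = average S (\<lambda>\<pi>. \<integral>y. f \<pi> y \<partial>M)"
  using assms by (simp_all add: average_def)

text \<open>\<open>(1 - t + 2 * t^2) * (1 + t) = 1 + t^2 * (1 + 2 * t)\<close>, and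
  \<open>1 + 2 * t\<close> is nonnegative. The linear term is kept explicit because it has mean 0 in
  the application.\<close>

lemma inverse_one_plus_le:
  fixes t :: real
  assumes "1/2 \<le> 1 + t"
  shows "1 / (1 + t) \<le> 1 - t + 2 * t\<^sup>2"
proof -
  have "1 \<le> (1 - t + 2 * t\<^sup>2) * (1 + t)"
    using mult_nonneg_nonneg[of "t\<^sup>2" "1 + 2 * t"] assms by (simp add: algebra_simps power2_eq_square)
  then show ?thesis using assms by (simp add: pos_divide_le_eq)
qed

locale weighted_subgraphs = spread_subgraphs V E S m \<rho> R p + tilted_weights M E \<omega> \<mu> x w D
  for V :: "'v set" and E S m \<rho> R p and M :: "'w measure" and \<omega> \<mu> x w D
begin

text \<open>The square is an average over pairs, each bounded by
  \<open>(2 * q) ^ card (\<pi> \<inter> \<pi>')\<close> times a factor that will be small. Taking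
  \<open>\<theta> = 2 * q - 1\<close> in the overlap bound turns the average of these powers into a
  bounded exponential.\<close>

lemma
  assumes h: "h \<in> borel_measurable borel" and b: "\<And>t. \<bar>h t\<bar> \<le> C"
    and lip: "\<And>s t. \<bar>h s - h t\<bar> \<le> \<epsilon> + l * \<bar>s - t\<bar>" and eps: "0 \<le> \<epsilon>" and l: "0 \<le> l"
    and \<eta>: "\<And>\<pi>. \<pi> \<in> S \<Longrightarrow> \<bar>\<integral>y. weighted w h \<pi> y \<partial>M\<bar> \<le> \<eta>"
  shows integrable_average_square: "integrable M (\<lambda>y. (average S (\<lambda>\<pi>. weighted w h \<pi> y))\<^sup>2)"
    and expectation_average_square_le:
      "(\<integral>y. (average S (\<lambda>\<pi>. weighted w h \<pi> y))\<^sup>2 \<partial>M)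
        \<le> exp ((2 * q - 1) * R\<^sup>2 * (p\<^sup>2 * real (card E))) * (C * (\<eta> + 3 * \<epsilon> + 3 * l * D))"
proof -
  let ?K = "C * (\<eta> + 3 * \<epsilon> + 3 * l * D)"
  obtain \<pi>0 where "\<pi>0 \<in> S" using S_nonempty by auto
  then have \<eta>0: "0 \<le> \<eta>" using \<eta>[of \<pi>0] by linarith
  have C: "0 \<le> C" using b[of 0] by linarith
  have K: "0 \<le> ?K" using \<eta>0 C eps l D_nonneg by simp
  have eq: "(average S (\<lambda>\<pi>. weighted w h \<pi> y))\<^sup>2
      = average S (\<lambda>\<pi>. average S (\<lambda>\<pi>'. weighted w h \<pi> y * weighted w h \<pi>' y))" for y
    by (simp add: power2_eq_square average_mult_average)
  note pair = abs_expectation_weighted_mult_le[OF S_subgraphs S_subgraphs h b lip eps l \<eta>]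
  show "integrable M (\<lambda>y. (average S (\<lambda>\<pi>. weighted w h \<pi> y))\<^sup>2)"
    unfolding eq by (intro integrable_average pair(2))
  have "(\<integral>y. (average S (\<lambda>\<pi>. weighted w h \<pi> y))\<^sup>2 \<partial>M)
      = average S (\<lambda>\<pi>. average S (\<lambda>\<pi>'. \<integral>y. weighted w h \<pi> y * weighted w h \<pi>' y \<partial>M))"
    unfolding eq by (simp add: integral_average integrable_average pair(2) cong: average_cong)
  also have "\<dots> \<le> average S (\<lambda>\<pi>. average S (\<lambda>\<pi>'. ?K * (1 + (2 * q - 1)) ^ card (\<pi> \<inter> \<pi>')))"
  proof (intro average_mono)
    fix \<pi> \<pi>' assume "\<pi> \<in> S" "\<pi>' \<in> S"
    then show "(\<integral>y. weighted w h \<pi> y * weighted w h \<pi>' y \<partial>M) \<le> ?K * (1 + (2 * q - 1)) ^ card (\<pi> \<inter> \<pi>')"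
      using pair(1)[of \<pi> \<pi>'] by (simp add: mult.commute)
  qed
  also have "\<dots> = ?K * average S (\<lambda>\<pi>. average S (\<lambda>\<pi>'. (1 + (2 * q - 1)) ^ card (\<pi> \<inter> \<pi>')))"
    by (simp only: average_cmult)
  also have "\<dots> \<le> ?K * exp ((2 * q - 1) * R\<^sup>2 * (p\<^sup>2 * real (card E)))"
    using q_ge_1 by (intro mult_left_mono average_overlap_le K) auto
  finally show "(\<integral>y. (average S (\<lambda>\<pi>. weighted w h \<pi> y))\<^sup>2 \<partial>M)
        \<le> exp ((2 * q - 1) * R\<^sup>2 * (p\<^sup>2 * real (card E))) * ?K"
    by (simp only: mult.commute)
qed

text \<open>\<open>Y \<le> \<delta>\<close> forces \<open>P \<le> 2 * \<delta>\<close> or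
  \<open>\<bar>Y - P\<bar> \<ge> \<delta>\<close>, where \<open>P\<close> is the product over all
  edges. Markov's inequality for \<open>1 / P\<close> handles the first event, Chebyshev's for the
  orthogonal expansion of \<open>Y - P\<close> the second.\<close>

lemma prob_average_weight_le:
  assumes p: "p \<le> 1/2" and \<delta>: "0 < \<delta>"
  shows "prob {y\<in>space M. average S (\<lambda>\<pi>. weighted w (\<lambda>_. 1) \<pi> y) \<le> \<delta>}
    \<le> 2 * \<delta> * exp (2 * (q - 1) * (p\<^sup>2 * real (card E)))
      + (\<Sum>\<Gamma>\<in>Pow E. (q - 1) ^ card \<Gamma> * (prob0 S \<Gamma> - p ^ card \<Gamma>)\<^sup>2) / \<delta>\<^sup>2"
proof -
  let ?\<eta> = "\<lambda>z. w z - 1"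
  define Y where "Y y = average S (\<lambda>\<pi>. weighted w (\<lambda>_. 1) \<pi> y)" for y
  define P where "P y = (\<Prod>e\<in>E. 1 + p * ?\<eta> (\<omega> e y))" for y
  define d where "d y = (\<Sum>\<Gamma>\<in>Pow E. (prob0 S \<Gamma> - p ^ card \<Gamma>) * (\<Prod>e\<in>\<Gamma>. ?\<eta> (\<omega> e y)))" for y
  define f where "f z = 1 / (1 + p * ?\<eta> z)" for z
  have Y_eq: "Y y = (\<Sum>\<Gamma>\<in>Pow E. prob0 S \<Gamma> * (\<Prod>e\<in>\<Gamma>. ?\<eta> (\<omega> e y)))" for y
    using average_prod_expand[OF finite_E S_nonempty S_subgraphs, of "\<lambda>e. ?\<eta> (\<omega> e y)"]
    by (simp add: Y_def weighted_def)
  have P_eq: "P y = (\<Sum>\<Gamma>\<in>Pow E. p ^ card \<Gamma> * (\<Prod>e\<in>\<Gamma>. ?\<eta> (\<omega> e y)))" for y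
    using prod_one_plus_expand[OF finite_E, of "\<lambda>e. p * ?\<eta> (\<omega> e y)"]
    by (simp add: P_def prod.distrib)
  have d_eq: "d y = Y y - P y" for y
    by (simp add: d_def Y_eq P_eq left_diff_distrib sum_subtractf)
  \<comment> \<open>Here \<open>p \<le> 1/2\<close> enters: with \<open>w \<ge> 0\<close> each
    factor is at least \<open>1 - p\<close>.\<close>
  have low: "1/2 \<le> 1 + p * ?\<eta> z" for z
    using p mult_nonneg_nonneg[OF less_imp_le[OF p_pos] w_nonneg[of z]] by (simp add: algebra_simps)
  have f: "0 < f z" "f z \<le> 2" "f z \<le> 1 - p * ?\<eta> z + 2 * (p * ?\<eta> z)\<^sup>2" for z
    using low[of z] inverse_one_plus_le[OF low[of z]] by (simp_all add: f_def field_simps)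
  interpret mu: prob_space \<mu> by (rule mu_prob)
  have f_meas: "f \<in> borel_measurable borel" unfolding f_def by measurable
  have f_int: "integrable \<mu> f"
    using f f_meas by (intro mu.integrable_const_bound[of _ 2]) (auto simp: mu_measurable_eq abs_if less_le_not_le)
  have P_pos: "0 < P y" for y
    unfolding P_def using low by (intro prod_pos) (metis less_le_trans half_gt_zero zero_less_one)
  \<comment> \<open>The linear term integrates to 0, so the excess over 1 is of order
    \<open>p^2\<close>, and the \<open>card E\<close>-th power of the integral stays bounded
    whenever \<open>p^2 * card E\<close> does.\<close>
  have f_le: "(\<integral>z. f z \<partial>\<mu>) \<le> 1 + 2 * p\<^sup>2 * (q - 1)"
  proof -
    have "(\<integral>z. f z \<partial>\<mu>) \<le> (\<integral>z. 1 - p * ?\<eta> z + 2 * p\<^sup>2 * (?\<eta> z)\<^sup>2 \<partial>\<mu>)"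
      using f(3) eta_integrable eta2_integrable
      by (intro integral_mono f_int) (auto simp: power_mult_distrib mult.assoc)
    also have "\<dots> = 1 + 2 * p\<^sup>2 * (q - 1)"
      using eta_integrable eta2_integrable eta_integral eta2_integral
      by (simp add: mu.prob_space)
    finally show ?thesis .
  qed
  have f0: "0 \<le> (\<integral>z. f z \<partial>\<mu>)" using f(1) by (intro integral_nonneg_AE) (auto intro: less_imp_le)
  have invP: "1 / P y = (\<Prod>e\<in>E. f (\<omega> e y))" for y
    by (simp add: P_def f_def prod_dividef)
  have invP_int: "integrable M (\<lambda>y. 1 / P y)"
    unfolding invP by (intro integrable_prod f_int) auto
  have "(\<integral>y. 1 / P y \<partial>M) = (\<integral>z. f z \<partial>\<mu>) ^ card E"
    unfolding invP by (subst expectation_prod) (auto intro: f_int)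
  also have "\<dots> \<le> (1 + 2 * p\<^sup>2 * (q - 1)) ^ card E"
    by (intro power_mono f_le f0)
  also have "\<dots> \<le> exp (2 * p\<^sup>2 * (q - 1) * real (card E))"
    using q_ge_1 by (intro one_plus_power_le_exp) auto
  finally have invP_le: "(\<integral>y. 1 / P y \<partial>M) \<le> exp (2 * (q - 1) * (p\<^sup>2 * real (card E)))"
    by (simp only: mult_ac)
  have [measurable]: "P \<in> borel_measurable M"
    unfolding P_def by (intro borel_measurable_prod borel_measurable_add borel_measurable_times
        borel_measurable_diff measurable_compose[OF omega_measurable w_measurable]) auto
  have d_meas[measurable]: "d \<in> borel_measurable M"
    unfolding d_def by (intro borel_measurable_sum borel_measurable_times borel_measurable_prod
        borel_measurable_diff measurable_compose[OF omega_measurable w_measurable]) auto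
  note chaos = expectation_chaos_square[OF eta_integrable eta_integral eta2_integrable,
      of "\<lambda>\<Gamma>. prob0 S \<Gamma> - p ^ card \<Gamma>", folded d_def, unfolded eta2_integral]
  have "prob {y\<in>space M. Y y \<le> \<delta>} \<le> prob ({y\<in>space M. 1 / P y \<ge> 1 / (2 * \<delta>)} \<union> {y\<in>space M. \<bar>d y\<bar> \<ge> \<delta>})"
  proof (rule finite_measure_mono)
    show "{y\<in>space M. Y y \<le> \<delta>} \<subseteq> {y\<in>space M. 1 / P y \<ge> 1 / (2 * \<delta>)} \<union> {y\<in>space M. \<bar>d y\<bar> \<ge> \<delta>}"
    proof safe
      fix y assume "Y y \<le> \<delta>" "\<not> \<delta> \<le> \<bar>d y\<bar>"
      then have "P y \<le> 2 * \<delta>" by (simp add: d_eq)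
      then show "1 / P y \<ge> 1 / (2 * \<delta>)" using P_pos[of y] by (intro divide_left_mono) auto
    qed
    show "{y\<in>space M. 1 / P y \<ge> 1 / (2 * \<delta>)} \<union> {y\<in>space M. \<bar>d y\<bar> \<ge> \<delta>} \<in> events"
      by measurable
  qed
  also have "\<dots> \<le> prob {y\<in>space M. 1 / P y \<ge> 1 / (2 * \<delta>)} + prob {y\<in>space M. \<bar>d y\<bar> \<ge> \<delta>}"
    by (intro measure_Un_le) measurable
  also have "\<dots> \<le> (\<integral>y. 1 / P y \<partial>M) / (1 / (2 * \<delta>)) + (\<integral>y. (d y)\<^sup>2 \<partial>M) / \<delta>\<^sup>2"
    using P_pos \<delta> chaos(1) d_meas
    by (intro add_mono integral_Markov_inequality_measure[where A = "space M"] second_moment_method invP_int)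
      (auto intro: less_imp_le)
  also have "\<dots> \<le> 2 * \<delta> * exp (2 * (q - 1) * (p\<^sup>2 * real (card E)))
      + (\<Sum>\<Gamma>\<in>Pow E. (q - 1) ^ card \<Gamma> * (prob0 S \<Gamma> - p ^ card \<Gamma>)\<^sup>2) / \<delta>\<^sup>2"
    using mult_left_mono[OF invP_le, of "2 * \<delta>"] \<delta> by (simp add: chaos(2) mult_ac)
  finally show ?thesis by (simp add: Y_def)
qed

end

section \<open>Moments and limits of the tilted law\<close>

lemma abs_one_minus_exp_le:
  fixes y :: real
  shows "\<bar>1 - exp (- y)\<bar> \<le> \<bar>y\<bar> * max 1 (exp (- y))"
proof (cases "0 \<le> y")
  case True
  then show ?thesis using exp_ge_add_one_self[of "- y"] by (simp add: max_def)
next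
  case False
  have "exp (- y) * (1 + y) \<le> exp (- y) * exp y"
    by (intro mult_left_mono) auto
  then have "exp (- y) - 1 \<le> - y * exp (- y)"
    by (simp add: exp_minus algebra_simps)
  then show ?thesis using False by (simp add: max_def)
qed

text \<open>The bound does not depend on \<open>h\<close>, as dominated convergence needs. For
  \<open>x < 0\<close> write \<open>u = - x\<close>: the square is at most
  \<open>u^2 * exp (2 * u)\<close>, and \<open>u^2 \<le> 2 * exp u\<close>. The exponent 3 is
  harmless because the Laplace transform is finite on the whole half line.\<close>

lemma exp_difference_quotient_square_le:
  fixes h x :: real
  assumes h: "0 < h" "h \<le> 1"
  shows "((1 - exp (- (h * x))) / h)\<^sup>2 \<le> x\<^sup>2 + 2 * exp (- (3 * x))"
proof -
  have "\<bar>(1 - exp (- (h * x))) / h\<bar> \<le> \<bar>x\<bar> * max 1 (exp (- (h * x)))"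
    using abs_one_minus_exp_le[of "h * x"] h by (simp add: pos_divide_le_eq abs_mult mult_ac)
  then have le: "((1 - exp (- (h * x))) / h)\<^sup>2 \<le> (\<bar>x\<bar> * max 1 (exp (- (h * x))))\<^sup>2"
    by (intro abs_le_square_iff[THEN iffD1]) (rule order_trans[OF _ abs_ge_self])
  show ?thesis
  proof (cases "0 \<le> x")
    case True
    then have "max 1 (exp (- (h * x))) = 1" using h by (simp add: max_absorb1)
    then show ?thesis using le by (simp add: add_increasing2)
  next
    case False
    define u where "u = - x"
    have u: "0 < u" using False by (simp add: u_def)
    have "max 1 (exp (- (h * x))) \<le> exp u"
      using h u mult_right_mono[of h 1 u] by (simp add: u_def)
    then have "(\<bar>x\<bar> * max 1 (exp (- (h * x))))\<^sup>2 \<le> (u * exp u)\<^sup>2"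
      using u by (intro power_mono mult_mono mult_nonneg_nonneg) (auto simp: u_def le_max_iff_disj)
    also have "\<dots> = u\<^sup>2 * exp (2 * u)"
      by (simp add: power_mult_distrib exp_double)
    also have "\<dots> \<le> (2 * exp u) * exp (2 * u)"
      using exp_lower_Taylor_quadratic[of u] u by (intro mult_right_mono) auto
    also have "\<dots> = 2 * exp (- (3 * x))" by (simp add: u_def mult_exp_exp)
    finally show ?thesis using le by (simp add: add_increasing)
  qed
qed

lemma exp_difference_quotient_tendsto:
  fixes x :: real
  assumes "h \<longlonglongrightarrow> 0" "\<And>n. h n \<noteq> 0"
  shows "(\<lambda>n. (1 - exp (- (h n * x))) / h n) \<longlonglongrightarrow> x"
proof -
  have "((\<lambda>t. 1 - exp (- (t * x))) has_real_derivative x) (at 0)"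
    by (auto intro!: derivative_eq_intros)
  then have "((\<lambda>t. (1 - exp (- (t * x))) / t) \<longlongrightarrow> x) (at 0)"
    by (simp add: DERIV_def)
  moreover have "filterlim h (at 0) sequentially"
    using assms by (intro filterlim_atI) auto
  ultimately show ?thesis by (rule filterlim_compose)
qed

text \<open>The second difference of the Laplace transform at the left end of its domain is the integral of
  \<open>w ((1 - exp (- h x)) / h)\<^sup>2\<close>; by Fatou's lemma a second-order expansion there bounds the second
  moment.\<close>

lemma moments_from_laplace_expansion:
  fixes w x :: "'a \<Rightarrow> real"
  assumes w0: "\<And>z. 0 \<le> w z" and w1: "(\<integral>z. w z \<partial>\<mu>) = 1"
    and x[measurable]: "x \<in> borel_measurable \<mu>"
    and int: "\<And>h. 0 \<le> h \<Longrightarrow> integrable \<mu> (\<lambda>z. w z * exp (- (h * x z)))"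
    and lim: "((\<lambda>h. ((\<integral>z. w z * exp (- (h * x z)) \<partial>\<mu>) - 1) / h\<^sup>2) \<longlongrightarrow> a / 2) (at_right 0)"
  shows "integrable \<mu> (\<lambda>z. w z * (x z)\<^sup>2)" "(\<integral>z. w z * (x z)\<^sup>2 \<partial>\<mu>) = a"
    "integrable \<mu> (\<lambda>z. w z * \<bar>x z\<bar>)" "(\<integral>z. w z * x z \<partial>\<mu>) = 0"
proof -
  define L where "L h = (\<integral>z. w z * exp (- (h * x z)) \<partial>\<mu>)" for h
  define h where "h n = inverse (real (Suc n))" for n
  define F where "F n z = w z * ((1 - exp (- (h n * x z))) / h n)\<^sup>2" for n z
  have h: "0 < h n" "h n \<le> 1" for n by (auto simp: h_def field_simps)
  have h0: "h n \<noteq> 0" for n using h(1)[of n] by simp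
  have h_lim: "h \<longlonglongrightarrow> 0" unfolding h_def by (rule LIMSEQ_inverse_real_of_nat)
  have w_int: "integrable \<mu> w" using int[of 0] by simp
  have [measurable]: "w \<in> borel_measurable \<mu>" using w_int by simp
  have L_lim: "(\<lambda>n. (L (c * h n) - 1) / (c * h n)\<^sup>2) \<longlonglongrightarrow> a / 2" if "0 < c" for c
  proof -
    have "filterlim (\<lambda>n. c * h n) (at_right 0) sequentially"
      using h(1) that tendsto_mult[OF tendsto_const[of c] h_lim]
      by (auto simp: filterlim_at h0)
    from filterlim_compose[OF lim this] show ?thesis by (simp add: L_def)
  qed
  \<comment> \<open>Expanding the square exhibits a second difference of the Laplace transform at
    the points 0, \<open>h\<close> and \<open>2 * h\<close>, all on the side where it is
    finite.\<close>
  have F_eq: "F n z = (w z * exp (- (2 * h n * x z)) - 2 * (w z * exp (- (h n * x z))) + w z) / (h n)\<^sup>2" for n z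
  proof -
    have "exp (- (2 * h n * x z)) = (exp (- (h n * x z)))\<^sup>2"
      by (simp add: exp_double[symmetric] mult_ac)
    then show ?thesis by (simp add: F_def power_divide power2_diff) (simp add: algebra_simps)
  qed
  have F_int: "integrable \<mu> (F n)" for n
    unfolding F_eq[abs_def] using int[of "2 * h n"] int[of "h n"] w_int h[of n]
    by (intro integrable_divide_zero) auto
  have F_val: "(\<integral>z. F n z \<partial>\<mu>) = (L (2 * h n) - 2 * L (h n) + 1) / (h n)\<^sup>2" for n
    unfolding F_eq using int[of "2 * h n"] int[of "h n"] w_int h[of n] by (simp add: w1 L_def)
  have F_val_lim: "(\<lambda>n. \<integral>z. F n z \<partial>\<mu>) \<longlonglongrightarrow> a"
  proof -
    \<comment> \<open>In the second difference the expansion enters at \<open>2 * h\<close> with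
      weight 4 and at \<open>h\<close> with weight -2, which leaves
      \<open>4 * (a / 2) - 2 * (a / 2) = a\<close>.\<close>
    have "(\<lambda>n. 4 * ((L (2 * h n) - 1) / (2 * h n)\<^sup>2) - 2 * ((L (1 * h n) - 1) / (1 * h n)\<^sup>2))
        \<longlonglongrightarrow> 4 * (a / 2) - 2 * (a / 2)"
      by (intro tendsto_intros L_lim) auto
    moreover have "4 * ((L (2 * h n) - 1) / (2 * h n)\<^sup>2) - 2 * ((L (1 * h n) - 1) / (1 * h n)\<^sup>2)
        = (\<integral>z. F n z \<partial>\<mu>)" for n
      using h(1)[of n] by (simp add: F_val field_simps)
    ultimately show ?thesis by simp
  qed
  have F_lim: "(\<lambda>n. F n z) \<longlonglongrightarrow> w z * (x z)\<^sup>2" for z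
    unfolding F_def
    by (intro tendsto_intros exp_difference_quotient_tendsto h_lim) (rule h0)
  have F0: "0 \<le> F n z" for n z by (simp add: F_def w0)
  show x2_int: "integrable \<mu> (\<lambda>z. w z * (x z)\<^sup>2)"
  proof (rule integrableI_bounded)
    have "(\<integral>\<^sup>+ z. ennreal (w z * (x z)\<^sup>2) \<partial>\<mu>) = (\<integral>\<^sup>+ z. liminf (\<lambda>n. ennreal (F n z)) \<partial>\<mu>)"
      by (intro nn_integral_cong lim_imp_Liminf[symmetric] tendsto_ennrealI F_lim) auto
    also have "\<dots> \<le> liminf (\<lambda>n. \<integral>\<^sup>+ z. ennreal (F n z) \<partial>\<mu>)"
      by (intro nn_integral_liminf) (auto simp: F_def)
    also have "\<dots> = liminf (\<lambda>n. ennreal (\<integral>z. F n z \<partial>\<mu>))"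
      using F_int F0 by (simp add: nn_integral_eq_integral)
    also have "\<dots> = ennreal a"
      by (intro lim_imp_Liminf tendsto_ennrealI F_val_lim) auto
    finally have "(\<integral>\<^sup>+ z. ennreal (w z * (x z)\<^sup>2) \<partial>\<mu>) \<le> ennreal a" .
    then show "(\<integral>\<^sup>+ z. ennreal (norm (w z * (x z)\<^sup>2)) \<partial>\<mu>) < \<infinity>"
      using w0 by (simp add: abs_mult le_less_trans[OF _ ennreal_less_top])
  qed simp
  \<comment> \<open>Fatou's lemma gives only an inequality. Now that \<open>w * x^2\<close> is
    integrable it can serve in a majorant, and dominated convergence gives equality.\<close>
  have dom_int: "integrable \<mu> (\<lambda>z. w z * (x z)\<^sup>2 + 2 * (w z * exp (- (3 * x z))))"
    using x2_int int[of 3] by simp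
  have dom: "F n z \<le> w z * (x z)\<^sup>2 + 2 * (w z * exp (- (3 * x z)))" for n z
    using mult_left_mono[OF exp_difference_quotient_square_le[OF h, of n "x z"] w0[of z]]
    by (simp add: F_def algebra_simps)
  have "(\<lambda>n. \<integral>z. F n z \<partial>\<mu>) \<longlonglongrightarrow> (\<integral>z. w z * (x z)\<^sup>2 \<partial>\<mu>)"
    using F_lim dom F0 F_int by (intro integral_dominated_convergence[OF _ _ dom_int]) auto
  then show "(\<integral>z. w z * (x z)\<^sup>2 \<partial>\<mu>) = a"
    using F_val_lim by (rule LIMSEQ_unique)
  have abs_le: "\<bar>t\<bar> \<le> 1 + t\<^sup>2" for t :: real
    using zero_le_power2[of "\<bar>t\<bar> - 1"] by (simp add: power2_diff)
  show "integrable \<mu> (\<lambda>z. w z * \<bar>x z\<bar>)"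
  proof (rule Bochner_Integration.integrable_bound[OF Bochner_Integration.integrable_add[OF w_int x2_int]])
    show "AE z in \<mu>. norm (w z * \<bar>x z\<bar>) \<le> norm (w z + w z * (x z)\<^sup>2)"
    proof (rule AE_I2)
      fix z
      show "norm (w z * \<bar>x z\<bar>) \<le> norm (w z + w z * (x z)\<^sup>2)"
        using mult_left_mono[OF abs_le[of "x z"] w0[of z]] w0[of z] by (simp add: algebra_simps abs_mult)
    qed
  qed simp
  \<comment> \<open>The first difference quotient identifies the mean: its integral is
    \<open>- h\<close> times the quotient in the assumed expansion, hence tends to 0.\<close>
  define G where "G n z = w z * ((1 - exp (- (h n * x z))) / h n)" for n z
  have G_int: "integrable \<mu> (G n)" for n
    unfolding G_def using w_int int[of "h n"] h[of n] by (simp add: right_diff_distrib)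
  have G_val: "(\<integral>z. G n z \<partial>\<mu>) = (1 - L (h n)) / h n" for n
    unfolding G_def using w_int int[of "h n"] h[of n] by (simp add: right_diff_distrib w1 L_def)
  have "(\<lambda>n. \<integral>z. G n z \<partial>\<mu>) \<longlonglongrightarrow> (\<integral>z. w z * x z \<partial>\<mu>)"
  proof (rule integral_dominated_convergence[OF _ _ Bochner_Integration.integrable_add[OF w_int dom_int]])
    show "AE z in \<mu>. (\<lambda>n. G n z) \<longlonglongrightarrow> w z * x z"
      unfolding G_def
      by (intro AE_I2 tendsto_intros exp_difference_quotient_tendsto h_lim) (rule h0)
    show "AE z in \<mu>. norm (G n z) \<le> w z + (w z * (x z)\<^sup>2 + 2 * (w z * exp (- (3 * x z))))" for n
    proof (rule AE_I2)
      fix z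
      have "norm (G n z) \<le> w z + F n z"
        using mult_left_mono[OF abs_le w0[of z], of "(1 - exp (- (h n * x z))) / h n"]
        by (simp only: G_def F_def real_norm_def abs_mult abs_of_nonneg[OF w0] distrib_left mult_1_right)
      then show "norm (G n z) \<le> w z + (w z * (x z)\<^sup>2 + 2 * (w z * exp (- (3 * x z))))"
        using dom[of n z] by linarith
    qed
  qed (use G_int in auto)
  moreover have "(\<lambda>n. \<integral>z. G n z \<partial>\<mu>) \<longlonglongrightarrow> 0"
  proof -
    have "(\<lambda>n. - h n * ((L (1 * h n) - 1) / (1 * h n)\<^sup>2)) \<longlonglongrightarrow> - 0 * (a / 2)"
      by (intro tendsto_intros L_lim h_lim) auto
    moreover have "- h n * ((L (1 * h n) - 1) / (1 * h n)\<^sup>2) = (\<integral>z. G n z \<partial>\<mu>)" for n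
      using h(1)[of n] by (simp add: G_val power2_eq_square field_simps)
    ultimately show ?thesis by simp
  qed
  ultimately show "(\<integral>z. w z * x z \<partial>\<mu>) = 0" by (rule LIMSEQ_unique)
qed

section \<open>Central limit theorem for the tilted law\<close>

text \<open>In the unit disc \<open>n\<close>-th powers differ by at most \<open>n\<close> times the
  difference of their bases, so a remainder of order \<open>o(1/n)\<close> for one factor suffices.
  Dominated convergence provides it from a second moment alone. The degenerate case
  \<open>a = 0\<close> is included.\<close>

lemma (in real_distribution) char_power_tendsto:
  assumes int: "integrable M (\<lambda>x. x)" "integrable M (\<lambda>x. x\<^sup>2)"
    and mean: "expectation (\<lambda>x. x) = 0" and var: "expectation (\<lambda>x. x\<^sup>2) = a"
  shows "(\<lambda>n. char M (t / sqrt (real n)) ^ n) \<longlonglongrightarrow> exp (- (a * t\<^sup>2 / 2))"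
proof -
  let ?t = "\<lambda>n. t / sqrt (real n)"
  let ?R = "\<lambda>n. t\<^sup>2 / 6 * expectation (\<lambda>x. min (6 * x\<^sup>2) (\<bar>?t n\<bar> * \<bar>x\<bar> ^ 3))"
  have a0: "0 \<le> a" unfolding var[symmetric] by (intro integral_nonneg_AE) auto
  \<comment> \<open>From this index on \<open>\<bar>1 - a * t^2 / (2 * n)\<bar> \<le> 1\<close>, as
    the comparison of powers requires.\<close>
  obtain n0 :: nat where n0: "t\<^sup>2 * a / 4 \<le> real n0" using real_arch_simple by blast
  have main: "norm (char M (?t n) ^ n - complex_of_real ((1 + (- (a * t\<^sup>2 / 2)) / real n) ^ n)) \<le> ?R n"
    if n: "max 1 n0 \<le> n" for n
  proof -
    have npos: "0 < real n" using n by auto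
    have "norm (char M (?t n) - (1 - (?t n)\<^sup>2 * a / 2))
      \<le> ((?t n)\<^sup>2 / 6) * expectation (\<lambda>x. min (6 * x\<^sup>2) (\<bar>?t n\<bar> * \<bar>x\<bar> ^ 3))"
      using char_approx3[of a "?t n"] int mean var by simp
    also have "(?t n)\<^sup>2 = t\<^sup>2 / real n" by (simp add: power_divide)
    finally have *: "norm (char M (?t n) - complex_of_real (1 + (- (a * t\<^sup>2 / 2)) / real n)) \<le> ?R n / real n"
      using npos by (simp add: field_simps)
    have "\<bar>1 + (- (a * t\<^sup>2 / 2)) / real n\<bar> \<le> 1"
    proof -
      have "t\<^sup>2 * a / 4 \<le> real n" using n0 n by auto
      then have "a * t\<^sup>2 / 2 / real n \<le> 2" using npos by (simp add: field_simps)
      moreover have "0 \<le> a * t\<^sup>2 / 2 / real n" using a0 by simp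
      ultimately show ?thesis by (simp add: abs_le_iff)
    qed
    then have "norm (complex_of_real (1 + (- (a * t\<^sup>2 / 2)) / real n)) \<le> 1"
      by (simp only: norm_of_real)
    then have "norm (char M (?t n) ^ n - complex_of_real (1 + (- (a * t\<^sup>2 / 2)) / real n) ^ n)
      \<le> real n * norm (char M (?t n) - complex_of_real (1 + (- (a * t\<^sup>2 / 2)) / real n))"
      by (intro norm_power_diff cmod_char_le_1)
    also have "\<dots> \<le> real n * (?R n / real n)"
      by (intro mult_left_mono *) auto
    finally show ?thesis using npos by simp
  qed
  have "(\<lambda>n. expectation (\<lambda>x. min (6 * x\<^sup>2) (\<bar>?t n\<bar> * \<bar>x\<bar> ^ 3))) \<longlonglongrightarrow> expectation (\<lambda>x. 0)"
  proof (rule integral_dominated_convergence[where w = "\<lambda>x. 6 * x\<^sup>2"])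
    show "AE x in M. (\<lambda>n. min (6 * x\<^sup>2) (\<bar>?t n\<bar> * \<bar>x\<bar> ^ 3)) \<longlonglongrightarrow> 0"
    proof (rule AE_I2)
      fix x :: real
      have "(\<lambda>n. ?t n) \<longlonglongrightarrow> 0"
        by (intro tendsto_divide_0[OF tendsto_const] filterlim_at_top_imp_at_infinity
            filterlim_compose[OF sqrt_at_top filterlim_real_sequentially])
      then have "(\<lambda>n. min (6 * x\<^sup>2) (\<bar>?t n\<bar> * \<bar>x\<bar> ^ 3)) \<longlonglongrightarrow> min (6 * x\<^sup>2) (\<bar>0\<bar> * \<bar>x\<bar> ^ 3)"
        by (intro tendsto_intros)
      moreover have "min (6 * x\<^sup>2) (\<bar>0\<bar> * \<bar>x\<bar> ^ 3) = 0" by (simp add: min_absorb2)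
      ultimately show "(\<lambda>n. min (6 * x\<^sup>2) (\<bar>?t n\<bar> * \<bar>x\<bar> ^ 3)) \<longlonglongrightarrow> 0" by (simp only:)
    qed
    show "integrable M (\<lambda>x. 6 * x\<^sup>2)" using int by simp
  qed auto
  then have R: "?R \<longlonglongrightarrow> 0"
    using tendsto_mult[OF tendsto_const[of "t\<^sup>2 / 6"]] by fastforce
  have "(\<lambda>n. complex_of_real ((1 + (- (a * t\<^sup>2 / 2)) / real n) ^ n)) \<longlonglongrightarrow> complex_of_real (exp (- (a * t\<^sup>2 / 2)))"
    by (intro tendsto_of_real tendsto_exp_limit_sequentially)
  then show ?thesis
  proof (rule Lim_transform)
    show "(\<lambda>n. char M (?t n) ^ n - complex_of_real ((1 + (- (a * t\<^sup>2 / 2)) / real n) ^ n)) \<longlonglongrightarrow> 0"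
      using main by (intro Lim_null_comparison[OF _ R] eventually_sequentiallyI[of "max 1 n0"]) auto
  qed
qed

text \<open>Scaling the standard normal law treats the degenerate case together with the others: for
  \<open>a = 0\<close> the map is constantly 0 and the image is the point mass.\<close>

lemma normal_law_eq_distr:
  assumes "0 \<le> a"
  shows "normal_law 0 a = distr std_normal_distribution borel (\<lambda>x. sqrt a * x)"
proof (cases "a = 0")
  case True
  interpret N: prob_space std_normal_distribution by (rule prob_space_normal_density) simp
  show ?thesis using True by (simp add: normal_law_def)
next
  case False
  then have a: "0 < sqrt a" using assms by simp
  interpret N: prob_space std_normal_distribution by (rule prob_space_normal_density) simp
  have "distributed std_normal_distribution lborel (\<lambda>x. x) (normal_density 0 1)"
    by (auto simp: distributed_def distr_id2)
  from N.normal_density_affine[OF this, of "sqrt a" 0] a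
  have "distributed std_normal_distribution lborel (\<lambda>x. sqrt a * x) (normal_density 0 (sqrt a))"
    by simp
  then show ?thesis
    using False by (simp add: normal_law_def distributed_distr_eq_density[symmetric] cong: distr_cong)
qed

lemma real_distribution_normal_law:
  assumes "0 \<le> a"
  shows "real_distribution (normal_law 0 a)"
proof -
  interpret N: prob_space std_normal_distribution by (rule prob_space_normal_density) simp
  show ?thesis unfolding normal_law_eq_distr[OF assms] by (rule N.real_distribution_distr) simp
qed

lemma char_normal_law:
  assumes "0 \<le> a"
  shows "char (normal_law 0 a) t = exp (- (a * t\<^sup>2 / 2))"
proof -
  have "char (normal_law 0 a) t = char std_normal_distribution (t * sqrt a)"
    by (simp add: normal_law_eq_distr[OF assms] char_def integral_distr mult_ac)
  then show ?thesis using assms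
    by (simp add: char_std_normal_distribution power_mult_distrib mult.commute)
qed

context tilted_weights
begin

text \<open>The density has integral 1 because its factors are independent with mean 1. Under it the
  values \<open>x (\<omega> e)\<close> for \<open>e\<close> in \<open>A\<close> are again i.i.d.,
  with law \<open>single_law\<close>.\<close>

definition tilted_total_law :: "'e set \<Rightarrow> real \<Rightarrow> real measure" where
  "tilted_total_law A r
     = distr (density M (\<lambda>y. ennreal (\<Prod>e\<in>A. w (\<omega> e y)))) borel (\<lambda>y. r * total A y)"

definition single_law :: "real measure" where
  "single_law = distr (density \<mu> (\<lambda>z. ennreal (w z))) borel x"

lemma prod_w_measurable: "A \<subseteq> E \<Longrightarrow> (\<lambda>y. \<Prod>e\<in>A. w (\<omega> e y)) \<in> borel_measurable M"
  by (intro borel_measurable_prod measurable_compose[OF omega_measurable w_measurable]) auto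

lemma prod_w_nonneg: "0 \<le> (\<Prod>e\<in>A. w (\<omega> e y))"
  by (intro prod_nonneg) (auto intro: w_nonneg)

lemma real_distribution_tilted_total_law:
  assumes A: "A \<subseteq> E"
  shows "real_distribution (tilted_total_law A r)"
proof -
  have "(\<integral>\<^sup>+ y. ennreal (\<Prod>e\<in>A. w (\<omega> e y)) \<partial>M) = ennreal (\<integral>y. (\<Prod>e\<in>A. w (\<omega> e y)) \<partial>M)"
    using integrable_prod[OF A, of "\<lambda>_. w"] w_integrable
    by (intro nn_integral_eq_integral) (auto intro: prod_w_nonneg)
  then have "emeasure (density M (\<lambda>y. ennreal (\<Prod>e\<in>A. w (\<omega> e y)))) (space M) = 1"
    using expectation_prod[OF A, of "\<lambda>_. w"] w_integrable w_integral prod_w_measurable[OF A]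
    by (subst emeasure_density) (auto cong: nn_integral_cong)
  then interpret T: prob_space "density M (\<lambda>y. ennreal (\<Prod>e\<in>A. w (\<omega> e y)))"
    by (intro prob_spaceI) simp
  show ?thesis unfolding tilted_total_law_def
    using total_measurable[OF A] by (intro T.real_distribution_distr) simp
qed

lemma integral_tilted_total_law:
  fixes h :: "real \<Rightarrow> 'b::{banach, second_countable_topology}"
  assumes A: "A \<subseteq> E" and h: "h \<in> borel_measurable borel"
  shows "(\<integral>t. h t \<partial>tilted_total_law A r) = (\<integral>y. (\<Prod>e\<in>A. w (\<omega> e y)) *\<^sub>R h (r * total A y) \<partial>M)"
proof -
  have m: "(\<lambda>y. r * total A y) \<in> borel_measurable M" using total_measurable[OF A] by simp
  have m2: "(\<lambda>y. h (r * total A y)) \<in> borel_measurable M" by (rule measurable_compose[OF m h])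
  show ?thesis
    unfolding tilted_total_law_def using m m2 prod_w_measurable[OF A] h
    by (subst integral_distr) (auto intro!: integral_density prod_w_nonneg)
qed

lemma real_distribution_single_law: "real_distribution single_law"
proof -
  have "(\<integral>\<^sup>+ z. ennreal (w z) \<partial>\<mu>) = 1"
    using w_integrable w_nonneg by (subst nn_integral_eq_integral) (auto simp: w_integral)
  then have "emeasure (density \<mu> (\<lambda>z. ennreal (w z))) (space \<mu>) = 1"
    using w_integrable by (subst emeasure_density) (auto cong: nn_integral_cong)
  then interpret T: prob_space "density \<mu> (\<lambda>z. ennreal (w z))"
    by (intro prob_spaceI) simp
  show ?thesis unfolding single_law_def
    by (intro T.real_distribution_distr) (simp add: mu_measurable_eq)
qed

lemma
  fixes h :: "real \<Rightarrow> 'b::{banach, second_countable_topology}"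
  assumes [measurable]: "h \<in> borel_measurable borel"
  shows integrable_single_law: "integrable single_law h \<longleftrightarrow> integrable \<mu> (\<lambda>z. w z *\<^sub>R h (x z))"
    and integral_single_law: "(\<integral>t. h t \<partial>single_law) = (\<integral>z. w z *\<^sub>R h (x z) \<partial>\<mu>)"
proof -
  have [measurable]: "x \<in> borel_measurable \<mu>" "w \<in> borel_measurable \<mu>" by (auto simp: mu_measurable_eq)
  show "integrable single_law h \<longleftrightarrow> integrable \<mu> (\<lambda>z. w z *\<^sub>R h (x z))"
    unfolding single_law_def using w_nonneg by (simp add: integrable_distr_eq integrable_density)
  show "(\<integral>t. h t \<partial>single_law) = (\<integral>z. w z *\<^sub>R h (x z) \<partial>\<mu>)"
    unfolding single_law_def using w_nonneg by (simp add: integral_distr integral_density)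
qed

text \<open>Density and exponential are both products over the edges, so the expectation factorises
  into \<open>card A\<close> copies of the transform of one tilted edge.\<close>

lemma char_tilted_total_law:
  assumes A: "A \<subseteq> E"
  shows "char (tilted_total_law A r) t = char single_law (t * r) ^ card A"
proof -
  let ?f = "\<lambda>z. w z *\<^sub>R iexp (t * r * x z)"
  have int: "integrable \<mu> ?f"
  proof -
    interpret nu: real_distribution single_law by (rule real_distribution_single_law)
    have "integrable single_law (\<lambda>s. iexp (t * r * s))"
      by (intro nu.integrable_const_bound[of _ 1]) auto
    then show ?thesis by (subst (asm) integrable_single_law) auto
  qed
  have "char (tilted_total_law A r) t = (\<integral>y. (\<Prod>e\<in>A. w (\<omega> e y)) *\<^sub>R iexp (t * (r * total A y)) \<partial>M)"
    unfolding char_def by (rule integral_tilted_total_law[OF A]) simp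
  also have "\<dots> = (\<integral>y. (\<Prod>e\<in>A. ?f (\<omega> e y)) \<partial>M)"
  proof (intro Bochner_Integration.integral_cong refl)
    fix y
    have "iexp (t * (r * total A y)) = (\<Prod>e\<in>A. iexp (t * r * x (\<omega> e y)))"
      using A finite_index
      by (subst exp_sum[symmetric]) (auto simp: total_def sum_distrib_left mult_ac dest: finite_subset)
    then show "(\<Prod>e\<in>A. w (\<omega> e y)) *\<^sub>R iexp (t * (r * total A y)) = (\<Prod>e\<in>A. ?f (\<omega> e y))"
      by (simp add: scaleR_conv_of_real prod.distrib)
  qed
  also have "\<dots> = (\<integral>z. ?f z \<partial>\<mu>) ^ card A"
    by (subst expectation_prod[OF A, of "\<lambda>_. ?f"]) (rule int, simp)
  also have "(\<integral>z. ?f z \<partial>\<mu>) = char single_law (t * r)"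
    unfolding char_def by (subst integral_single_law) auto
  finally show ?thesis .
qed

end

text \<open>One application of l'Hospital's rule: it leaves \<open>exp (?K h) / 2\<close> times the
  difference quotient of \<open>\<psi>'\<close> at \<open>\<beta>\<close>, which tends to
  \<open>a\<close> by definition. Second derivatives away from \<open>\<beta>\<close> never
  appear.\<close>

lemma laplace_exponent_expansion:
  fixes \<psi> \<psi>' :: "real \<Rightarrow> real"
  assumes beta: "0 \<le> \<beta>"
    and near: "\<forall>\<^sub>F b in at \<beta> within {0..}. (\<psi> has_real_derivative \<psi>' b) (at b within {0..})"
    and at: "(\<psi> has_real_derivative \<psi>' \<beta>) (at \<beta> within {0..})"
    and deriv2: "(\<psi>' has_real_derivative a) (at \<beta> within {0..})"
  shows "((\<lambda>h. (exp (\<psi> (\<beta> + h) - \<psi> \<beta> - h * \<psi>' \<beta>) - 1) / h\<^sup>2) \<longlongrightarrow> a / 2) (at_right 0)"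
proof -
  let ?K = "\<lambda>h. \<psi> (\<beta> + h) - \<psi> \<beta> - h * \<psi>' \<beta>"
  have pos: "\<forall>\<^sub>F h in at_right 0. 0 < (h::real)" by (rule eventually_at_right_less)
  have shift: "filterlim (\<lambda>h. \<beta> + h) (at \<beta> within {0..}) (at_right 0)"
  proof -
    have "((\<lambda>h. \<beta> + h) \<longlongrightarrow> \<beta> + 0) (at_right 0)" by (intro tendsto_intros)
    moreover have "\<forall>\<^sub>F h in at_right 0. \<beta> + h \<in> {0..} \<and> \<beta> + h \<noteq> \<beta>"
      using pos by eventually_elim (use beta in auto)
    ultimately show ?thesis by (simp add: filterlim_at)
  qed
  have "(\<psi> \<longlongrightarrow> \<psi> \<beta>) (at \<beta> within {0..})"
    using DERIV_continuous[OF at] by (simp add: continuous_within)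
  from filterlim_compose[OF this shift]
  have "(?K \<longlongrightarrow> \<psi> \<beta> - \<psi> \<beta> - 0 * \<psi>' \<beta>) (at_right 0)"
    by (intro tendsto_intros) auto
  then have K_lim: "((\<lambda>h. exp (?K h)) \<longlongrightarrow> 1) (at_right 0)"
    using tendsto_exp by fastforce
  show ?thesis
  proof (rule lhopital_right_0[where f' = "\<lambda>h. exp (?K h) * (\<psi>' (\<beta> + h) - \<psi>' \<beta>)" and g' = "\<lambda>h. 2 * h"])
    show "((\<lambda>h. exp (?K h) - 1) \<longlongrightarrow> 0) (at_right 0)"
      using tendsto_diff[OF K_lim tendsto_const[of 1]] by simp
    show "((\<lambda>h::real. h\<^sup>2) \<longlongrightarrow> 0) (at_right 0)"
      by (auto intro!: tendsto_eq_intros)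
    show "\<forall>\<^sub>F h in at_right 0. h\<^sup>2 \<noteq> (0::real)" "\<forall>\<^sub>F h in at_right 0. 2 * h \<noteq> (0::real)"
      using pos by (eventually_elim; simp)+
    have "\<forall>\<^sub>F h in at_right 0. (\<psi> has_real_derivative \<psi>' (\<beta> + h)) (at (\<beta> + h) within {0..})"
      by (rule eventually_compose_filterlim[OF near shift])
    then show "\<forall>\<^sub>F h in at_right 0. ((\<lambda>h. exp (?K h) - 1) has_real_derivative
        exp (?K h) * (\<psi>' (\<beta> + h) - \<psi>' \<beta>)) (at h)"
      using pos
    proof eventually_elim
      case (elim h)
      \<comment> \<open>For \<open>h > 0\<close> the point lies inside the half line, so the
        derivative within \<open>{0..}\<close> is two-sided even if
        \<open>\<beta> = 0\<close>.\<close>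
      have "\<beta> + h \<in> interior {0..}" using elim(2) beta by simp
      then have "(\<psi> has_real_derivative \<psi>' (\<beta> + h)) (at (\<beta> + h))"
        using elim(1) at_within_interior by metis
      then have "((\<lambda>h. \<psi> (\<beta> + h)) has_real_derivative \<psi>' (\<beta> + h)) (at h)"
        using DERIV_shift[of \<psi> "\<psi>' (\<beta> + h)" h \<beta>] by (simp add: add.commute)
      then show ?case by (auto intro!: derivative_eq_intros)
    qed
    show "\<forall>\<^sub>F h in at_right 0. ((\<lambda>h. h\<^sup>2) has_real_derivative 2 * h) (at (h::real))"
      by (auto intro!: always_eventually derivative_eq_intros)
    have "((\<lambda>y. (\<psi>' y - \<psi>' \<beta>) / (y - \<beta>)) \<longlongrightarrow> a) (at \<beta> within {0..})"
      using deriv2 by (simp add: has_field_derivative_iff)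
    from filterlim_compose[OF this shift]
    have "((\<lambda>h. exp (?K h) * ((\<psi>' (\<beta> + h) - \<psi>' \<beta>) / h) / 2) \<longlongrightarrow> 1 * a / 2) (at_right 0)"
      by (intro tendsto_intros K_lim) auto
    then show "((\<lambda>h. exp (?K h) * (\<psi>' (\<beta> + h) - \<psi>' \<beta>) / (2 * h)) \<longlongrightarrow> a / 2) (at_right 0)"
      by (simp add: mult.commute)
  qed
qed

section \<open>Boltzmann factors and the Gibbs measure\<close>

lemma boltzmann_nonneg: "0 \<le> boltzmann \<beta> z"
  by (simp add: boltzmann_def)

lemma boltzmann_measurable[measurable]: "boltzmann \<beta> \<in> borel_measurable borel"
  unfolding boltzmann_def[abs_def] by measurable

lemma boltzmann_add: "boltzmann (b + h) z = boltzmann b z * exp (- (h * real_of_ereal z))"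
  by (simp add: boltzmann_def mult_exp_exp algebra_simps)

definition tilt :: "ereal measure \<Rightarrow> real \<Rightarrow> ereal \<Rightarrow> real" where
  "tilt \<mu> \<beta> z = boltzmann \<beta> z / (\<integral>z. boltzmann \<beta> z \<partial>\<mu>)"

text \<open>At \<open>\<infinity>\<close> this takes the default value \<open>d\<close>, since
  \<open>real_of_ereal\<close> returns 0 there. The value is harmless because \<open>tilt\<close>
  vanishes at \<open>\<infinity>\<close>.\<close>

definition shifted :: "real \<Rightarrow> ereal \<Rightarrow> real" where
  "shifted d z = real_of_ereal z + d"

lemma tilt_measurable[measurable]: "tilt \<mu> \<beta> \<in> borel_measurable borel"
  unfolding tilt_def[abs_def] by measurable

lemma shifted_measurable[measurable]: "shifted d \<in> borel_measurable borel"
  unfolding shifted_def[abs_def] by measurable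

lemma integral_boltzmann_pos:
  assumes "\<not> (AE w in \<mu>. w = \<infinity>)" and int: "integrable \<mu> (boltzmann b)"
  shows "0 < (\<integral>z. boltzmann b z \<partial>\<mu>)"
proof -
  have nn: "AE z in \<mu>. 0 \<le> boltzmann b z" by (simp add: boltzmann_nonneg)
  have "(\<integral>z. boltzmann b z \<partial>\<mu>) \<noteq> 0"
  proof
    assume "(\<integral>z. boltzmann b z \<partial>\<mu>) = 0"
    then have "AE z in \<mu>. boltzmann b z = 0"
      using integral_nonneg_eq_0_iff_AE[OF int nn] by simp
    then have "AE z in \<mu>. z = \<infinity>"
      by eventually_elim (auto simp: boltzmann_def split: if_splits)
    with assms(1) show False by simp
  qed
  moreover have "0 \<le> (\<integral>z. boltzmann b z \<partial>\<mu>)" using nn by (rule integral_nonneg_AE)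
  ultimately show ?thesis by simp
qed

text \<open>The integral of \<open>w * exp (- (h * x))\<close> equals \<open>exp (\<psi> (\<beta> +
  h) - \<psi> \<beta> - h * \<psi>' \<beta>)\<close> with \<open>\<psi> = log_laplace \<mu>\<close>,
  so the expansion of this exponential feeds the moment lemma. Shifting the weight by
  \<open>\<psi>' \<beta>\<close> is what removes the linear term.\<close>

lemma
  fixes \<psi>' :: "real \<Rightarrow> real"
  assumes mu_sets: "sets \<mu> = sets borel"
    and mu_not_PInf: "\<not> (AE w in \<mu>. w = \<infinity>)"
    and psi_finite_all: "\<forall>b\<ge>0. integrable \<mu> (boltzmann b)"
    and beta_nonneg: "\<beta> \<ge> 0"
    and psi_deriv_near: "\<forall>\<^sub>F b in at \<beta> within {0..}.
          (log_laplace \<mu> has_real_derivative \<psi>' b) (at b within {0..})"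
    and psi_deriv: "(log_laplace \<mu> has_real_derivative \<psi>' \<beta>) (at \<beta> within {0..})"
    and psi_deriv2: "(\<psi>' has_real_derivative a) (at \<beta> within {0..})"
  defines "w \<equiv> tilt \<mu> \<beta>" and "x \<equiv> shifted (\<psi>' \<beta>)"
  shows tilt_nonneg: "0 \<le> w z"
    and tilt_integrable: "integrable \<mu> w" and tilt_integral: "(\<integral>z. w z \<partial>\<mu>) = 1"
    and tilt2_integrable: "integrable \<mu> (\<lambda>z. (w z)\<^sup>2)"
    and tilt_abs_integrable: "integrable \<mu> (\<lambda>z. w z * \<bar>x z\<bar>)"
    and tilt2_abs_integrable: "integrable \<mu> (\<lambda>z. (w z)\<^sup>2 * \<bar>x z\<bar>)"
    and tilt_mean: "(\<integral>z. w z * x z \<partial>\<mu>) = 0"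
    and tilt_square_integrable: "integrable \<mu> (\<lambda>z. w z * (x z)\<^sup>2)"
    and tilt_variance: "(\<integral>z. w z * (x z)\<^sup>2 \<partial>\<mu>) = a"
proof -
  let ?g = "\<lambda>b. \<integral>z. boltzmann b z \<partial>\<mu>"
  note psi_finite = psi_finite_all[rule_format]
  have meas: "borel_measurable \<mu> = (borel_measurable borel :: (ereal \<Rightarrow> real) set)"
    by (rule measurable_cong_sets[OF mu_sets refl])
  have x_meas: "x \<in> borel_measurable \<mu>" by (simp add: meas x_def)
  have w_meas: "w \<in> borel_measurable \<mu>" by (simp add: meas w_def)
  have g_pos: "0 < ?g b" if "0 \<le> b" for b
    using integral_boltzmann_pos[OF mu_not_PInf psi_finite[OF that]] .
  have g\<beta>: "0 < ?g \<beta>" by (rule g_pos[OF beta_nonneg])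
  show w0: "0 \<le> w z" for z
    using g\<beta> by (simp add: w_def tilt_def boltzmann_nonneg)
  have w_exp: "w z * exp (- (h * x z)) = exp (- (h * \<psi>' \<beta>)) / ?g \<beta> * boltzmann (\<beta> + h) z" for h z
    by (simp add: w_def tilt_def x_def shifted_def boltzmann_add mult_exp_exp algebra_simps)
  have w_exp_int: "integrable \<mu> (\<lambda>z. w z * exp (- (h * x z)))" if "0 \<le> h" for h
    unfolding w_exp using psi_finite[of "\<beta> + h"] that beta_nonneg by (intro integrable_mult_right) auto
  have w_exp_val: "(\<integral>z. w z * exp (- (h * x z)) \<partial>\<mu>)
      = exp (log_laplace \<mu> (\<beta> + h) - log_laplace \<mu> \<beta> - h * \<psi>' \<beta>)" if "0 \<le> h" for h
  proof -
    have "exp (log_laplace \<mu> (\<beta> + h) - log_laplace \<mu> \<beta> - h * \<psi>' \<beta>) = exp (- (h * \<psi>' \<beta>)) / ?g \<beta> * ?g (\<beta> + h)"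
      using g\<beta> g_pos[of "\<beta> + h"] that beta_nonneg unfolding exp_diff
      by (simp add: log_laplace_def exp_minus divide_inverse mult_ac)
    then show ?thesis unfolding w_exp by simp
  qed
  show w_int: "integrable \<mu> w" using w_exp_int[of 0] by simp
  show w1: "(\<integral>z. w z \<partial>\<mu>) = 1" using w_exp_val[of 0] by simp
  have "((\<lambda>h. ((\<integral>z. w z * exp (- (h * x z)) \<partial>\<mu>) - 1) / h\<^sup>2) \<longlongrightarrow> a / 2) (at_right 0)"
  proof (rule Lim_transform_eventually[OF laplace_exponent_expansion[OF beta_nonneg psi_deriv_near psi_deriv psi_deriv2]])
    show "\<forall>\<^sub>F h in at_right 0. (exp (log_laplace \<mu> (\<beta> + h) - log_laplace \<mu> \<beta> - h * \<psi>' \<beta>) - 1) / h\<^sup>2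
        = ((\<integral>z. w z * exp (- (h * x z)) \<partial>\<mu>) - 1) / h\<^sup>2"
      using eventually_at_right_less[of "0::real"] by eventually_elim (simp add: w_exp_val)
  qed
  note moments = moments_from_laplace_expansion[OF w0 w1 x_meas w_exp_int this]
  show "integrable \<mu> (\<lambda>z. w z * \<bar>x z\<bar>)" "(\<integral>z. w z * x z \<partial>\<mu>) = 0"
    "(\<integral>z. w z * (x z)\<^sup>2 \<partial>\<mu>) = a"
    using moments by auto
  show x2: "integrable \<mu> (\<lambda>z. w z * (x z)\<^sup>2)" by (rule moments)
  \<comment> \<open>Positive powers of Boltzmann factors are Boltzmann factors at multiples of
    \<open>\<beta>\<close>, so finiteness of the Laplace transform on the half line makes them all
    integrable.\<close>
  have pow: "boltzmann \<beta> z ^ Suc k = boltzmann (real (Suc k) * \<beta>) z" for k z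
    by (cases "z = \<infinity>")
      (simp_all add: boltzmann_def exp_of_nat_mult[symmetric] mult_ac del: power_Suc of_nat_Suc)
  have w_pow: "integrable \<mu> (\<lambda>z. w z ^ Suc k)" for k
    unfolding w_def tilt_def power_divide pow using beta_nonneg
    by (intro integrable_divide_zero impI psi_finite) simp
  show "integrable \<mu> (\<lambda>z. (w z)\<^sup>2)" using w_pow[of 1] by (simp add: numeral_2_eq_2)
  show "integrable \<mu> (\<lambda>z. (w z)\<^sup>2 * \<bar>x z\<bar>)"
  proof (rule Bochner_Integration.integrable_bound[OF Bochner_Integration.integrable_add[OF x2 w_pow[of 2]]])
    show "(\<lambda>z. (w z)\<^sup>2 * \<bar>x z\<bar>) \<in> borel_measurable \<mu>" using x_meas w_meas by measurable
    show "AE z in \<mu>. norm ((w z)\<^sup>2 * \<bar>x z\<bar>) \<le> norm (w z * (x z)\<^sup>2 + w z ^ Suc 2)"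
    proof (rule AE_I2)
      fix z
      \<comment> \<open>Multiplied by \<open>w\<close>, this consequence of the arithmetic-geometric
        mean inequality dominates \<open>w^2 * \<bar>x\<bar>\<close> by the integrable
        \<open>w * x^2 + w^3\<close>.\<close>
      have "w z * \<bar>x z\<bar> \<le> (x z)\<^sup>2 + (w z)\<^sup>2"
        using sum_squares_bound[of "w z" "\<bar>x z\<bar>"] mult_nonneg_nonneg[OF w0[of z] abs_ge_zero[of "x z"]]
        by simp
      from mult_left_mono[OF this w0[of z]]
      show "norm ((w z)\<^sup>2 * \<bar>x z\<bar>) \<le> norm (w z * (x z)\<^sup>2 + w z ^ Suc 2)"
        using w0[of z] by (simp add: abs_mult power2_eq_square power3_eq_cube algebra_simps)
    qed
  qed
qed

section \<open>Gibbs averages as quotients of averages\<close>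

lemma total_weight_eq_ereal:
  assumes "finite \<pi>" "\<And>e. e \<in> \<pi> \<Longrightarrow> \<omega> e \<noteq> - \<infinity>" "\<And>e. e \<in> \<pi> \<Longrightarrow> \<omega> e \<noteq> \<infinity>"
  shows "total_weight \<omega> \<pi> = ereal (\<Sum>e\<in>\<pi>. real_of_ereal (\<omega> e))"
proof -
  have "total_weight \<omega> \<pi> = (\<Sum>e\<in>\<pi>. ereal (real_of_ereal (\<omega> e)))"
    unfolding total_weight_def using assms by (intro sum.cong) (auto simp: ereal_real)
  then show ?thesis by simp
qed

text \<open>An edge of weight \<open>\<infinity>\<close> makes both sides 0. The value
  \<open>- \<infinity>\<close> must be excluded, since \<open>boltzmann\<close> is 1 there and
  multiplicativity could fail.\<close>

lemma boltzmann_total_weight: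
  assumes fin: "finite \<pi>" and mi: "\<And>e. e \<in> \<pi> \<Longrightarrow> \<omega> e \<noteq> - \<infinity>"
  shows "boltzmann \<beta> (total_weight \<omega> \<pi>) = (\<Prod>e\<in>\<pi>. boltzmann \<beta> (\<omega> e))"
proof (cases "\<exists>e\<in>\<pi>. \<omega> e = \<infinity>")
  case True
  then have "total_weight \<omega> \<pi> = \<infinity>"
    unfolding total_weight_def using fin by (simp add: sum_Pinfty)
  moreover have "(\<Prod>e\<in>\<pi>. boltzmann \<beta> (\<omega> e)) = 0"
    using True fin by (auto simp: boltzmann_def)
  ultimately show ?thesis by (simp add: boltzmann_def)
next
  case False
  then have "total_weight \<omega> \<pi> = ereal (\<Sum>e\<in>\<pi>. real_of_ereal (\<omega> e))"
    using fin mi by (intro total_weight_eq_ereal) auto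
  moreover have "(\<Prod>e\<in>\<pi>. boltzmann \<beta> (\<omega> e)) = (\<Prod>e\<in>\<pi>. exp (- \<beta> * real_of_ereal (\<omega> e)))"
    using False by (intro prod.cong) (auto simp: boltzmann_def)
  moreover have "exp (- \<beta> * (\<Sum>e\<in>\<pi>. real_of_ereal (\<omega> e))) = (\<Prod>e\<in>\<pi>. exp (- \<beta> * real_of_ereal (\<omega> e)))"
    unfolding sum_distrib_left using fin by (rule exp_sum)
  ultimately show ?thesis by (simp add: boltzmann_def)
qed

text \<open>Subgraphs with an infinite edge have weight 0 on both sides, which hides the different
  arguments of \<open>f\<close> there: \<open>\<infinity>\<close> on the left, a real number on the
  right. For the others \<open>card \<pi> = m\<close> turns \<open>m * d\<close> into one
  \<open>d\<close> per edge.\<close>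

lemma integral_rescaled_weight_law:
  fixes f :: "ereal \<Rightarrow> real"
  assumes S: "finite S" "S \<noteq> {}" and \<pi>: "\<And>\<pi>. \<pi> \<in> S \<Longrightarrow> finite \<pi> \<and> card \<pi> = m"
    and mi: "\<And>\<pi> e. \<pi> \<in> S \<Longrightarrow> e \<in> \<pi> \<Longrightarrow> \<omega> e \<noteq> - \<infinity>"
    and f: "f \<in> borel_measurable borel"
    and pos: "0 < average S (\<lambda>\<pi>. \<Prod>e\<in>\<pi>. boltzmann \<beta> (\<omega> e))"
  shows "(\<integral>z. f z \<partial>rescaled_weight_law S m d \<beta> \<omega>)
    = average S (\<lambda>\<pi>. (\<Prod>e\<in>\<pi>. boltzmann \<beta> (\<omega> e)) * f (ereal (1 / sqrt (real m) * (\<Sum>e\<in>\<pi>. shifted d (\<omega> e)))))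
      / average S (\<lambda>\<pi>. \<Prod>e\<in>\<pi>. boltzmann \<beta> (\<omega> e))"
proof -
  let ?Z = "average S (\<lambda>\<pi>. \<Prod>e\<in>\<pi>. boltzmann \<beta> (\<omega> e))"
  let ?X = "\<lambda>\<pi>. ereal (1 / sqrt (real m)) * (total_weight \<omega> \<pi> + ereal (real m * d))"
  have boltz: "boltzmann \<beta> (total_weight \<omega> \<pi>) = (\<Prod>e\<in>\<pi>. boltzmann \<beta> (\<omega> e))" if "\<pi> \<in> S" for \<pi>
    using \<pi>[OF that] mi[OF that] by (intro boltzmann_total_weight) auto
  have Z: "partition_function S \<beta> \<omega> = ?Z"
    by (simp add: partition_function_def average_def boltz)
  have gibbs: "gibbs S \<beta> \<omega> = point_measure S (\<lambda>\<pi>. ennreal (boltzmann \<beta> (total_weight \<omega> \<pi>) / (?Z * real (card S))))"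
    using pos by (simp add: gibbs_def Z)
  have "(\<integral>z. f z \<partial>rescaled_weight_law S m d \<beta> \<omega>) = (\<integral>\<pi>. f (?X \<pi>) \<partial>gibbs S \<beta> \<omega>)"
    unfolding rescaled_weight_law_def gibbs using f by (intro integral_distr) auto
  also have "\<dots> = (\<Sum>\<pi>\<in>S. boltzmann \<beta> (total_weight \<omega> \<pi>) / (?Z * real (card S)) * f (?X \<pi>))"
    unfolding gibbs point_measure_def
    using S pos boltzmann_nonneg
    by (simp add: integral_density lebesgue_integral_count_space_finite AE_count_space sum_divide_distrib)
  also have "\<dots> = (\<Sum>\<pi>\<in>S. (\<Prod>e\<in>\<pi>. boltzmann \<beta> (\<omega> e))
      * f (ereal (1 / sqrt (real m) * (\<Sum>e\<in>\<pi>. shifted d (\<omega> e)))) / (?Z * real (card S)))"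
  proof (rule sum.cong[OF refl])
    fix \<pi> assume S\<pi>: "\<pi> \<in> S"
    show "boltzmann \<beta> (total_weight \<omega> \<pi>) / (?Z * real (card S)) * f (?X \<pi>)
      = (\<Prod>e\<in>\<pi>. boltzmann \<beta> (\<omega> e))
      * f (ereal (1 / sqrt (real m) * (\<Sum>e\<in>\<pi>. shifted d (\<omega> e)))) / (?Z * real (card S))"
    proof (cases "\<exists>e\<in>\<pi>. \<omega> e = \<infinity>")
      case True
      then have "(\<Prod>e\<in>\<pi>. boltzmann \<beta> (\<omega> e)) = 0"
        using \<pi>[OF S\<pi>] by (auto simp: boltzmann_def)
      then show ?thesis by (simp add: boltz[OF S\<pi>])
    next
      case False
      then have "total_weight \<omega> \<pi> = ereal (\<Sum>e\<in>\<pi>. real_of_ereal (\<omega> e))"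
        using \<pi>[OF S\<pi>] mi[OF S\<pi>] by (intro total_weight_eq_ereal) auto
      then have "?X \<pi> = ereal (1 / sqrt (real m) * (\<Sum>e\<in>\<pi>. shifted d (\<omega> e)))"
        using \<pi>[OF S\<pi>] by (simp add: shifted_def sum.distrib)
      then show ?thesis by (simp add: boltz[OF S\<pi>])
    qed
  qed
  finally show ?thesis
    by (simp add: average_def sum_divide_distrib[symmetric] mult.commute)
qed

text \<open>Continuity at the two infinite points gives limits at both ends, so \<open>f\<close> is
  uniformly continuous on the reals; boundedness controls distant points. The form with a linear
  term suits the pair estimate, which then needs only first absolute moments of
  \<open>x\<close>.\<close>

lemma uniform_modulus_of_ereal_continuous:
  fixes f :: "ereal \<Rightarrow> real"
  assumes cont: "continuous_on UNIV f" and bound: "\<And>z. \<bar>f z\<bar> \<le> C" and \<epsilon>: "0 < \<epsilon>"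
  obtains L where "0 \<le> L" "\<And>s t. \<bar>f (ereal s) - f (ereal t)\<bar> \<le> \<epsilon> + L * \<bar>s - t\<bar>"
proof -
  define h where "h s = f (ereal s)" for s
  have C: "0 \<le> C" using bound[of 0] by linarith
  have h_cont: "continuous_on A h" for A
    unfolding h_def
    by (rule continuous_on_compose2[OF cont continuous_on_ereal]) (auto intro: continuous_on_id)
  have "(ereal \<longlongrightarrow> \<infinity>) at_top" "(ereal \<longlongrightarrow> - \<infinity>) at_bot"
    by (auto simp: tendsto_PInfty tendsto_MInfty eventually_at_top_dense eventually_at_bot_dense)
  then have "(h \<longlongrightarrow> f \<infinity>) at_top" "(h \<longlongrightarrow> f (- \<infinity>)) at_bot"
    unfolding h_def using cont by (auto intro!: isCont_tendsto_compose[of _ f] simp: continuous_on_eq_continuous_at)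
  then have "\<forall>\<^sub>F s in at_top. dist (h s) (f \<infinity>) < \<epsilon> / 2" "\<forall>\<^sub>F s in at_bot. dist (h s) (f (- \<infinity>)) < \<epsilon> / 2"
    using \<epsilon> by (auto elim!: tendstoD simp del: divide_less_eq_numeral1 less_divide_eq_numeral1)
  then obtain T1 T2 where T12: "\<And>s. T1 \<le> s \<Longrightarrow> dist (h s) (f \<infinity>) < \<epsilon> / 2"
    "\<And>s. s \<le> T2 \<Longrightarrow> dist (h s) (f (- \<infinity>)) < \<epsilon> / 2"
    by (auto simp: eventually_at_top_linorder eventually_at_bot_linorder)
  define T where "T = max \<bar>T1\<bar> \<bar>T2\<bar>"
  have T: "dist (h s) (f \<infinity>) < \<epsilon> / 2" if "T \<le> s" for s using T12(1)[of s] that by (auto simp: T_def)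
  have T': "dist (h s) (f (- \<infinity>)) < \<epsilon> / 2" if "s \<le> - T" for s using T12(2)[of s] that by (auto simp: T_def)
  have "uniformly_continuous_on {- T - 1..T + 1} h"
    by (intro compact_uniformly_continuous h_cont) auto
  then obtain \<delta> where \<delta>: "0 < \<delta>" "\<And>s t. s \<in> {- T - 1..T + 1} \<Longrightarrow> t \<in> {- T - 1..T + 1} \<Longrightarrow>
      dist s t < \<delta> \<Longrightarrow> dist (h s) (h t) < \<epsilon>"
    using \<epsilon> unfolding uniformly_continuous_on_def by metis
  define \<delta>' where "\<delta>' = min \<delta> 1"
  have \<delta>': "0 < \<delta>'" using \<delta> by (simp add: \<delta>'_def)
  have near: "\<bar>h s - h t\<bar> \<le> \<epsilon>" if st: "\<bar>s - t\<bar> < \<delta>'" for s t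
  proof -
    have "s \<le> t + 1" "t \<le> s + 1" using st by (auto simp: \<delta>'_def)
    \<comment> \<open>Points at distance less than 1 cannot jump over the margin of width 1, so both
      lie in the enlarged interval or both in the same tail.\<close>
    then have "s \<in> {- T - 1..T + 1} \<and> t \<in> {- T - 1..T + 1} \<or> T \<le> s \<and> T \<le> t \<or> s \<le> - T \<and> t \<le> - T"
      by (auto simp: not_le)
    then consider "s \<in> {- T - 1..T + 1}" "t \<in> {- T - 1..T + 1}" | "T \<le> s" "T \<le> t" | "s \<le> - T" "t \<le> - T"
      by blast
    then show ?thesis
    proof cases
      case 1
      then show ?thesis using \<delta>(2)[OF 1] st by (simp add: dist_real_def \<delta>'_def)
    next
      case 2
      then show ?thesis using T[OF 2(1)] T[OF 2(2)] unfolding dist_real_def by linarith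
    next
      case 3
      then show ?thesis using T'[OF 3(1)] T'[OF 3(2)] unfolding dist_real_def by linarith
    qed
  qed
  show ?thesis
  proof (rule that)
    \<comment> \<open>The slope is chosen so that at distance \<open>\<delta>'\<close> the linear
      term already reaches the oscillation bound \<open>2 * C\<close>.\<close>
    show "0 \<le> 2 * C / \<delta>'" using C \<delta>' by simp
    fix s t
    show "\<bar>f (ereal s) - f (ereal t)\<bar> \<le> \<epsilon> + 2 * C / \<delta>' * \<bar>s - t\<bar>"
    proof (cases "\<bar>s - t\<bar> < \<delta>'")
      case True
      then show ?thesis using near[OF True] C \<delta>' by (simp add: h_def add_increasing2)
    next
      case False
      have "\<bar>f (ereal s) - f (ereal t)\<bar> \<le> 2 * C"
        using bound[of "ereal s"] bound[of "ereal t"] by linarith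
      also have "\<dots> \<le> 2 * C / \<delta>' * \<bar>s - t\<bar>"
      proof -
        have "2 * C / \<delta>' * \<delta>' \<le> 2 * C / \<delta>' * \<bar>s - t\<bar>"
          using False C \<delta>' by (intro mult_left_mono) auto
        then show ?thesis using \<delta>' by simp
      qed
      finally show ?thesis using \<epsilon> by linarith
    qed
  qed
qed

section \<open>Limits\<close>

text \<open>For any threshold \<open>\<delta>\<close> the bad event requires
  \<open>Y1 \<le> \<delta>\<close> or \<open>\<bar>Yh\<bar> \<ge> \<epsilon> * \<delta>\<close>.
  With \<open>\<delta>\<close> fixed, the second moment of \<open>Yh\<close> and the distance of
  \<open>Y1\<close> from the product tend to 0, and what remains is of order
  \<open>\<delta>\<close>.\<close>

lemma weighted_average_ratio_tendsto:
  fixes V :: "nat \<Rightarrow> 'v set" and M :: "nat \<Rightarrow> 'w measure" and h :: "real \<Rightarrow> real"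
  assumes G: "\<And>n. weighted_subgraphs (V n) (E n) (S n) (m n) \<rho> R (p n) (M n) (\<omega> n) \<mu> x w D"
    and m_lim: "filterlim m at_top sequentially"
    and p_half: "\<And>n. p n \<le> 1/2" and B: "\<And>n. (p n)\<^sup>2 * real (card (E n)) \<le> B"
    and VE: "(\<lambda>n. real (card (V n)) / real (card (E n))) \<longlonglongrightarrow> 0"
    and mean: "(\<integral>z. w z * x z \<partial>\<mu>) = 0" and x2: "integrable \<mu> (\<lambda>z. w z * (x z)\<^sup>2)"
    and var: "(\<integral>z. w z * (x z)\<^sup>2 \<partial>\<mu>) = a"
    and h_cont: "continuous_on UNIV h" and h_bound: "\<And>t. \<bar>h t\<bar> \<le> C"
    and h_mod: "\<And>\<epsilon>. 0 < \<epsilon> \<Longrightarrow> \<exists>L\<ge>0. \<forall>s t. \<bar>h s - h t\<bar> \<le> \<epsilon> + L * \<bar>s - t\<bar>"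
    and h_mean: "(\<integral>t. h t \<partial>normal_law 0 a) = 0"
    and \<epsilon>: "0 < \<epsilon>"
  defines "Y1 \<equiv> \<lambda>n y. average (S n) (\<lambda>\<pi>. \<Prod>e\<in>\<pi>. w (\<omega> n e y))"
    and "Yh \<equiv> \<lambda>n y. average (S n) (\<lambda>\<pi>. (\<Prod>e\<in>\<pi>. w (\<omega> n e y))
      * h (1 / sqrt (real (m n)) * (\<Sum>e\<in>\<pi>. x (\<omega> n e y))))"
  shows "{y\<in>space (M n). \<not> (0 < Y1 n y \<and> \<bar>Yh n y\<bar> \<le> \<epsilon> * Y1 n y)} \<in> sets (M n)"
    and "(\<lambda>n. measure (M n) {y\<in>space (M n). \<not> (0 < Y1 n y \<and> \<bar>Yh n y\<bar> \<le> \<epsilon> * Y1 n y)}) \<longlonglongrightarrow> 0"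
proof -
  interpret G: weighted_subgraphs "V n" "E n" "S n" "m n" \<rho> R "p n" "M n" "\<omega> n" \<mu> x w D for n
    by (rule G)
  define r where "r n = 1 / sqrt (real (m n))" for n
  define hn where "hn n s = h (r n * s)" for n s
  have r_pos: "0 < r n" for n using G.m_pos[of n] by (simp add: r_def)
  have h_meas[measurable]: "h \<in> borel_measurable borel"
    by (rule borel_measurable_continuous_onI[OF h_cont])
  have hn_meas: "hn n \<in> borel_measurable borel" for n unfolding hn_def by measurable
  have hn_bound: "\<bar>hn n t\<bar> \<le> C" for n t unfolding hn_def by (rule h_bound)
  have Y1_eq: "Y1 n y = average (S n) (\<lambda>\<pi>. G.weighted n w (\<lambda>_. 1) \<pi> y)" for n y
    by (simp add: Y1_def G.weighted_def)
  have Yh_eq: "Yh n y = average (S n) (\<lambda>\<pi>. G.weighted n w (hn n) \<pi> y)" for n y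
    by (simp add: Yh_def G.weighted_def G.total_def hn_def r_def)
  have Y1_meas[measurable]: "Y1 n \<in> borel_measurable (M n)" for n
    unfolding Y1_eq[abs_def] average_def
    by (intro borel_measurable_divide borel_measurable_sum G.weighted_measurable G.S_subgraphs) auto
  have Yh_meas[measurable]: "Yh n \<in> borel_measurable (M n)" for n
    unfolding Yh_eq[abs_def] average_def
    by (intro borel_measurable_divide borel_measurable_sum G.weighted_measurable G.S_subgraphs hn_meas) auto
  let ?bad = "\<lambda>n. {y\<in>space (M n). \<not> (0 < Y1 n y \<and> \<bar>Yh n y\<bar> \<le> \<epsilon> * Y1 n y)}"
  show bad: "?bad n \<in> sets (M n)" for n by measurable

  define H where "H n \<pi> = (\<integral>y. G.weighted n w (hn n) \<pi> y \<partial>M n)" for n \<pi>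
  \<comment> \<open>The central limit theorem is needed uniformly over \<open>S n\<close>. Choosing
    a maximiser reduces this to one sequence of subgraphs.\<close>
  have "\<exists>\<pi>\<in>S n. \<forall>\<pi>'\<in>S n. \<bar>H n \<pi>'\<bar> \<le> \<bar>H n \<pi>\<bar>" for n
  proof -
    have "Max ((\<lambda>\<pi>. \<bar>H n \<pi>\<bar>) ` S n) \<in> (\<lambda>\<pi>. \<bar>H n \<pi>\<bar>) ` S n"
      using G.finite_S[of n] G.S_nonempty[of n] by (intro Max_in) auto
    then obtain \<pi> where "\<pi> \<in> S n" "Max ((\<lambda>\<pi>. \<bar>H n \<pi>\<bar>) ` S n) = \<bar>H n \<pi>\<bar>" by auto
    then show ?thesis using G.finite_S[of n] by (metis Max_ge finite_imageI imageI)
  qed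
  then obtain \<pi>s where \<pi>s: "\<And>n. \<pi>s n \<in> S n" "\<And>n \<pi>. \<pi> \<in> S n \<Longrightarrow> \<bar>H n \<pi>\<bar> \<le> \<bar>H n (\<pi>s n)\<bar>"
    by metis
  have a0: "0 \<le> a" unfolding var[symmetric] by (intro integral_nonneg_AE) (simp add: G.w_nonneg)
  have H_lim: "(\<lambda>n. H n (\<pi>s n)) \<longlonglongrightarrow> 0"
  proof -
    let ?law = "\<lambda>n. G.tilted_total_law n (\<pi>s n) (r n)"
    have sub: "\<pi>s n \<subseteq> E n" for n by (rule G.S_subgraphs[OF \<pi>s(1)])
    interpret nu: real_distribution G.single_law by (rule G.real_distribution_single_law)
    have nu1: "integrable G.single_law (\<lambda>t. t)"
    proof (subst G.integrable_single_law)
      have m: "(\<lambda>z. w z *\<^sub>R x z) \<in> borel_measurable \<mu>" by (simp add: G.mu_measurable_eq)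
      show "integrable \<mu> (\<lambda>z. w z *\<^sub>R x z)"
        by (rule Bochner_Integration.integrable_bound[OF G.wx_integrable m]) (simp add: abs_mult)
    qed simp
    have nu2: "integrable G.single_law (\<lambda>t. t\<^sup>2)"
      by (subst G.integrable_single_law) (use x2 in auto)
    have char_lim: "(\<lambda>k. char G.single_law (t / sqrt (real k)) ^ k) \<longlonglongrightarrow> exp (- (a * t\<^sup>2 / 2))" for t
      by (rule nu.char_power_tendsto[OF nu1 nu2]) (simp_all add: G.integral_single_law mean var)
    \<comment> \<open>The number of summands is \<open>m n\<close>, not \<open>n\<close>, so the
      limit of the powers is composed with \<open>m\<close> tending to infinity.\<close>
    have "weak_conv_m ?law (normal_law 0 a)"
    proof (rule levy_continuity)
      show "real_distribution (?law n)" for n by (rule G.real_distribution_tilted_total_law[OF sub])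
      show "real_distribution (normal_law 0 a)" by (rule real_distribution_normal_law[OF a0])
      fix t
      have "char (?law n) t = char G.single_law (t / sqrt (real (m n))) ^ m n" for n
        by (simp add: G.char_tilted_total_law[OF sub] G.S_card[OF \<pi>s(1)] r_def)
      then show "(\<lambda>n. char (?law n) t) \<longlonglongrightarrow> char (normal_law 0 a) t"
        using filterlim_compose[OF char_lim m_lim] by (simp add: char_normal_law[OF a0])
    qed
    then have "(\<lambda>n. \<integral>t. h t \<partial>?law n) \<longlonglongrightarrow> (\<integral>t. h t \<partial>normal_law 0 a)"
      using h_cont h_bound
      by (intro weak_conv_imp_integral_bdd_continuous_conv G.real_distribution_tilted_total_law[OF sub]
          real_distribution_normal_law[OF a0]) (auto simp: continuous_on_eq_continuous_at)
    moreover have "(\<integral>t. h t \<partial>?law n) = H n (\<pi>s n)" for n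
      unfolding H_def by (subst G.integral_tilted_total_law[OF sub h_meas]) (simp add: G.weighted_def[abs_def] hn_def)
    ultimately show ?thesis by (simp add: h_mean)
  qed

  have r_lim: "r \<longlonglongrightarrow> 0"
    unfolding r_def
    by (intro tendsto_divide_0[OF tendsto_const] filterlim_at_top_imp_at_infinity
        filterlim_compose[OF sqrt_at_top] filterlim_compose[OF filterlim_real_sequentially m_lim])
  have C0: "0 \<le> C" using h_bound[of 0] by linarith
  define K where "K = exp ((2 * G.q - 1) * R\<^sup>2 * B)"
  define E2 where "E2 n = (\<integral>y. (Yh n y)\<^sup>2 \<partial>M n)" for n
  have Yh2_int: "integrable (M n) (\<lambda>y. (Yh n y)\<^sup>2)"
    and E2_le: "E2 n \<le> K * (C * (\<bar>H n (\<pi>s n)\<bar> + 3 * \<epsilon>' + 3 * (L * r n) * D))"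
    if L: "0 \<le> L" "\<forall>s t. \<bar>h s - h t\<bar> \<le> \<epsilon>' + L * \<bar>s - t\<bar>" and \<epsilon>': "0 < \<epsilon>'" for n L \<epsilon>'
  proof -
    have lip: "\<bar>hn n s - hn n t\<bar> \<le> \<epsilon>' + L * r n * \<bar>s - t\<bar>" for s t
    proof -
      have "\<bar>hn n s - hn n t\<bar> \<le> \<epsilon>' + L * \<bar>r n * s - r n * t\<bar>"
        unfolding hn_def using L(2) by blast
      also have "\<bar>r n * s - r n * t\<bar> = r n * \<bar>s - t\<bar>"
        using r_pos[of n] by (simp add: abs_mult right_diff_distrib[symmetric])
      finally show ?thesis by (simp add: mult.assoc)
    qed
    have l0: "0 \<le> L * r n" using L(1) r_pos[of n] by simp
    note * = hn_meas hn_bound lip less_imp_le[OF \<epsilon>'] l0 \<pi>s(2)[unfolded H_def]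
    show "integrable (M n) (\<lambda>y. (Yh n y)\<^sup>2)"
      unfolding Yh_eq by (rule G.integrable_average_square[OF *])
    have "E2 n \<le> exp ((2 * G.q - 1) * R\<^sup>2 * ((p n)\<^sup>2 * real (card (E n))))
        * (C * (\<bar>H n (\<pi>s n)\<bar> + 3 * \<epsilon>' + 3 * (L * r n) * D))"
      unfolding E2_def Yh_eq H_def by (rule G.expectation_average_square_le[OF *])
    also have "\<dots> \<le> K * (C * (\<bar>H n (\<pi>s n)\<bar> + 3 * \<epsilon>' + 3 * (L * r n) * D))"
      unfolding K_def using G.q_ge_1 C0 l0 \<epsilon>' G.D_nonneg
      by (intro mult_right_mono exp_le_cancel_iff[THEN iffD2] mult_left_mono B) auto
    finally show "E2 n \<le> K * (C * (\<bar>H n (\<pi>s n)\<bar> + 3 * \<epsilon>' + 3 * (L * r n) * D))" .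
  qed
  have E2_lim: "E2 \<longlonglongrightarrow> 0"
  proof (rule LIMSEQ_I)
    fix \<tau> :: real assume \<tau>: "0 < \<tau>"
    \<comment> \<open>With this choice \<open>3 * K * C * \<epsilon>'\<close> is at most
      \<open>\<tau> / 2\<close>; writing \<open>C + 1\<close> avoids division by 0.\<close>
    define \<epsilon>' where "\<epsilon>' = \<tau> / (6 * K * (C + 1))"
    have K: "0 < K" by (simp add: K_def)
    have \<epsilon>': "0 < \<epsilon>'" using \<tau> K C0 by (simp add: \<epsilon>'_def)
    obtain L where L: "0 \<le> L" "\<forall>s t. \<bar>h s - h t\<bar> \<le> \<epsilon>' + L * \<bar>s - t\<bar>"
      using h_mod[OF \<epsilon>'] by auto
    have "(\<lambda>n. K * (C * (\<bar>H n (\<pi>s n)\<bar> + 3 * \<epsilon>' + 3 * (L * r n) * D)))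
      \<longlonglongrightarrow> K * (C * (\<bar>0\<bar> + 3 * \<epsilon>' + 3 * (L * 0) * D))"
      by (intro tendsto_intros H_lim r_lim)
    moreover have "K * (C * (\<bar>0\<bar> + 3 * \<epsilon>' + 3 * (L * 0) * D)) < \<tau>"
    proof -
      have "K * (C * (\<bar>0\<bar> + 3 * \<epsilon>' + 3 * (L * 0) * D)) \<le> 3 * K * (C + 1) * \<epsilon>'"
        using K C0 \<epsilon>' by (simp add: algebra_simps)
      also have "\<dots> = \<tau> / 2"
      proof -
        have "6 * K * (C + 1) \<noteq> 0" using K C0 by simp
        then have "6 * K * (C + 1) * \<epsilon>' = \<tau>" unfolding \<epsilon>'_def by simp
        then show ?thesis by linarith
      qed
      finally show ?thesis using \<tau> by simp
    qed
    ultimately have "\<forall>\<^sub>F n in sequentially. K * (C * (\<bar>H n (\<pi>s n)\<bar> + 3 * \<epsilon>' + 3 * (L * r n) * D)) < \<tau>"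
      by (rule order_tendstoD(2))
    then have "\<forall>\<^sub>F n in sequentially. norm (E2 n - 0) < \<tau>"
    proof eventually_elim
      case (elim n)
      have "0 \<le> E2 n" unfolding E2_def by (intro integral_nonneg_AE) auto
      then show ?case using elim E2_le[OF L \<epsilon>', of n] by simp
    qed
    then show "\<exists>no. \<forall>n\<ge>no. norm (E2 n - 0) < \<tau>" by (simp add: eventually_sequentially)
  qed

  define dev where "dev n = (\<Sum>\<Gamma>\<in>Pow (E n). (G.q - 1) ^ card \<Gamma> * (prob0 (S n) \<Gamma> - p n ^ card \<Gamma>)\<^sup>2)" for n
  have dev_lim: "dev \<longlonglongrightarrow> 0"
  proof (rule tendsto_sandwich[OF _ _ tendsto_const])
    let ?v = "G.q - 1"
    have v: "0 \<le> ?v" using G.q_ge_1 by simp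
    let ?bd = "\<lambda>n. exp (?v * \<rho>\<^sup>2 * B) * (1 / real (m n))
      + 2 * (real (card (V n)) / real (card (E n))) * (?v * R\<^sup>2 * B)\<^sup>2 * exp (?v * R\<^sup>2 * B)"
    show "\<forall>\<^sub>F n in sequentially. 0 \<le> dev n"
      unfolding dev_def using v by (intro always_eventually allI sum_nonneg) auto
    show "\<forall>\<^sub>F n in sequentially. dev n \<le> ?bd n"
    proof (intro always_eventually allI)
      fix n
      let ?N = "(p n)\<^sup>2 * real (card (E n))"
      have N: "0 \<le> ?N" by simp
      have "dev n \<le> exp (?v * \<rho>\<^sup>2 * ?N) / real (m n)
        + 2 * real (card (V n)) / real (card (E n)) * (?v * R\<^sup>2 * ?N)\<^sup>2 * exp (?v * R\<^sup>2 * ?N)"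
        unfolding dev_def by (rule G.sum_deviation_le[OF v])
      also have "\<dots> \<le> exp (?v * \<rho>\<^sup>2 * B) / real (m n)
        + 2 * real (card (V n)) / real (card (E n)) * (?v * R\<^sup>2 * B)\<^sup>2 * exp (?v * R\<^sup>2 * B)"
        using v N B[of n]
        by (intro add_mono divide_right_mono mult_mono power_mono exp_le_cancel_iff[THEN iffD2] mult_left_mono) auto
      finally show "dev n \<le> ?bd n" by simp
    qed
    have "(\<lambda>n. 1 / real (m n)) \<longlonglongrightarrow> 0"
      by (intro tendsto_divide_0[OF tendsto_const] filterlim_at_top_imp_at_infinity
          filterlim_compose[OF filterlim_real_sequentially m_lim])
    then have "?bd \<longlonglongrightarrow> exp (?v * \<rho>\<^sup>2 * B) * 0 + 2 * 0 * (?v * R\<^sup>2 * B)\<^sup>2 * exp (?v * R\<^sup>2 * B)"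
      by (intro tendsto_intros VE)
    then show "?bd \<longlonglongrightarrow> 0" by simp
  qed

  show "(\<lambda>n. measure (M n) (?bad n)) \<longlonglongrightarrow> 0"
  proof (rule LIMSEQ_I)
    fix \<tau> :: real assume \<tau>: "0 < \<tau>"
    \<comment> \<open>This makes the Markov term
      \<open>2 * \<delta> * exp (2 * (G.q - 1) * B)\<close> equal to \<open>\<tau> / 2\<close> for
      every \<open>n\<close>.\<close>
    define \<delta> where "\<delta> = \<tau> / (4 * exp (2 * (G.q - 1) * B))"
    have \<delta>: "0 < \<delta>" using \<tau> by (simp add: \<delta>_def)
    \<comment> \<open>The modulus with constant 1 serves only to have \<open>Yh\<close> square
      integrable.\<close>
    obtain L where L: "0 \<le> L" "\<forall>s t. \<bar>h s - h t\<bar> \<le> 1 + L * \<bar>s - t\<bar>"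
      using h_mod[of 1] by auto
    have le: "measure (M n) (?bad n) \<le> \<tau> / 2 + dev n / \<delta>\<^sup>2 + E2 n / (\<epsilon> * \<delta>)\<^sup>2" for n
    proof -
      have "measure (M n) (?bad n)
        \<le> measure (M n) ({y\<in>space (M n). Y1 n y \<le> \<delta>} \<union> {y\<in>space (M n). \<epsilon> * \<delta> \<le> \<bar>Yh n y\<bar>})"
      proof (rule G.finite_measure_mono)
        show "?bad n \<subseteq> {y\<in>space (M n). Y1 n y \<le> \<delta>} \<union> {y\<in>space (M n). \<epsilon> * \<delta> \<le> \<bar>Yh n y\<bar>}"
        proof (rule subsetI, rule ccontr)
          fix y assume "y \<in> ?bad n"
            and "y \<notin> {y\<in>space (M n). Y1 n y \<le> \<delta>} \<union> {y\<in>space (M n). \<epsilon> * \<delta> \<le> \<bar>Yh n y\<bar>}"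
          then have "\<delta> < Y1 n y" "\<bar>Yh n y\<bar> < \<epsilon> * \<delta>" "\<not> (0 < Y1 n y \<and> \<bar>Yh n y\<bar> \<le> \<epsilon> * Y1 n y)"
            by auto
          then show False using \<delta> mult_strict_left_mono[of \<delta> "Y1 n y" \<epsilon>] \<epsilon> by linarith
        qed
      qed measurable
      also have "\<dots> \<le> measure (M n) {y\<in>space (M n). Y1 n y \<le> \<delta>}
          + measure (M n) {y\<in>space (M n). \<epsilon> * \<delta> \<le> \<bar>Yh n y\<bar>}"
        by (intro measure_Un_le) measurable
      also have "\<dots> \<le> (2 * \<delta> * exp (2 * (G.q - 1) * ((p n)\<^sup>2 * real (card (E n)))) + dev n / \<delta>\<^sup>2)
          + E2 n / (\<epsilon> * \<delta>)\<^sup>2"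
        unfolding dev_def E2_def Y1_eq using \<epsilon> \<delta>
        by (intro add_mono G.prob_average_weight_le p_half G.second_moment_method Yh2_int[OF L] Yh_meas) auto
      also have "2 * \<delta> * exp (2 * (G.q - 1) * ((p n)\<^sup>2 * real (card (E n)))) \<le> 2 * \<delta> * exp (2 * (G.q - 1) * B)"
        using \<delta> G.q_ge_1 by (intro mult_left_mono exp_le_cancel_iff[THEN iffD2] B) auto
      also have "2 * \<delta> * exp (2 * (G.q - 1) * B) = \<tau> / 2" by (simp add: \<delta>_def)
      finally show ?thesis by simp
    qed
    have "(\<lambda>n. \<tau> / 2 + dev n / \<delta>\<^sup>2 + E2 n / (\<epsilon> * \<delta>)\<^sup>2) \<longlonglongrightarrow> \<tau> / 2 + 0 / \<delta>\<^sup>2 + 0 / (\<epsilon> * \<delta>)\<^sup>2"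
      using \<epsilon> \<delta> by (intro tendsto_intros dev_lim E2_lim) auto
    then have "\<forall>\<^sub>F n in sequentially. \<tau> / 2 + dev n / \<delta>\<^sup>2 + E2 n / (\<epsilon> * \<delta>)\<^sup>2 < \<tau>"
      by (rule order_tendstoD(2)) (use \<tau> in simp)
    then have "\<forall>\<^sub>F n in sequentially. norm (measure (M n) (?bad n) - 0) < \<tau>"
    proof eventually_elim
      case (elim n)
      then show ?case using le[of n] measure_nonneg[of "M n" "?bad n"] by simp
    qed
    then show "\<exists>no. \<forall>n\<ge>no. norm (measure (M n) (?bad n) - 0) < \<tau>" by (simp add: eventually_sequentially)
  qed
qed

section \<open>Growth rates of vertices, edges and subgraph size\<close>

text \<open>\<open>N\<close> is at least of order \<open>v^2\<close>, so \<open>v / N\<close> is at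
  most of order \<open>1 / v\<close>; and \<open>m^2\<close> is of order \<open>N\<close>, so
  \<open>m\<close> diverges. The density \<open>m / N\<close> is \<open>(m^2 / N) / m\<close>,
  eventually at most a constant over \<open>m\<close>.\<close>

lemma subgraph_size_asymptotics:
  fixes N v :: "nat \<Rightarrow> real" and m :: "nat \<Rightarrow> nat"
  assumes theta: "N \<in> \<Theta>(\<lambda>n. (v n)\<^sup>2)" and v: "filterlim v at_top sequentially"
    and N0: "\<And>n. 0 \<le> N n" and gamma: "0 < \<gamma>" "(\<lambda>n. (real (m n))\<^sup>2 / (2 * N n)) \<longlonglongrightarrow> \<gamma>"
  shows "filterlim m at_top sequentially" "(\<lambda>n. v n / N n) \<longlonglongrightarrow> 0"
    "\<forall>\<^sub>F n in sequentially. 0 < m n \<and> 0 < N n \<and> real (m n) / N n \<le> 1/2 \<and>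
      (real (m n) / N n)\<^sup>2 * N n \<le> 2 * \<gamma> + 1"
proof -
  have "(\<lambda>n. (v n)\<^sup>2) \<in> O(N)" using theta by (simp add: bigtheta_def bigomega_iff_bigo)
  then obtain k where k: "0 < k" "\<forall>\<^sub>F n in sequentially. norm ((v n)\<^sup>2) \<le> k * norm (N n)"
    by (rule landau_o.bigE)
  have v_ge: "\<forall>\<^sub>F n in sequentially. b \<le> v n" for b
    using v by (simp add: filterlim_at_top)
  have N_lim: "filterlim N at_top sequentially"
  proof (rule filterlim_at_top_mono)
    show "filterlim (\<lambda>n. 1 / k * v n) at_top sequentially"
      using k(1) by (intro filterlim_tendsto_pos_mult_at_top[OF tendsto_const _ v]) auto
    show "\<forall>\<^sub>F n in sequentially. 1 / k * v n \<le> N n"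
      using k(2) v_ge[of 1]
    proof eventually_elim
      case (elim n)
      have "v n \<le> (v n)\<^sup>2" using elim(2) by (simp add: power2_eq_square)
      then show ?case using elim(1) k(1) N0[of n] by (simp add: field_simps)
    qed
  qed
  then have N_pos: "\<forall>\<^sub>F n in sequentially. 0 < N n" by (simp add: filterlim_at_top_dense)
  have v_inv: "(\<lambda>n. k / v n) \<longlonglongrightarrow> 0"
    by (intro tendsto_divide_0[OF tendsto_const] filterlim_at_top_imp_at_infinity v)
  show "(\<lambda>n. v n / N n) \<longlonglongrightarrow> 0"
  proof (rule tendsto_sandwich[OF _ _ tendsto_const v_inv])
    show "\<forall>\<^sub>F n in sequentially. 0 \<le> v n / N n"
      using v_ge[of 0] N_pos by eventually_elim simp
    show "\<forall>\<^sub>F n in sequentially. v n / N n \<le> k / v n"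
      using k(2) v_ge[of 1] N_pos
      by eventually_elim (simp add: field_simps power2_eq_square)
  qed
  have "filterlim (\<lambda>n. (real (m n))\<^sup>2 / (2 * N n) * (2 * N n)) at_top sequentially"
    by (intro filterlim_tendsto_pos_mult_at_top[OF gamma(2) gamma(1)]
        filterlim_tendsto_pos_mult_at_top[OF tendsto_const _ N_lim]) auto
  then have m2: "\<forall>\<^sub>F n in sequentially. b < (real (m n))\<^sup>2 / (2 * N n) * (2 * N n)" for b
    by (simp add: filterlim_at_top_dense)
  have m_ge: "\<forall>\<^sub>F n in sequentially. k \<le> m n" for k
    using m2[of "(real k)\<^sup>2"] N_pos
  proof eventually_elim
    case (elim n)
    then have "(real k)\<^sup>2 < (real (m n))\<^sup>2" by simp
    then have "real k < real (m n)" by (rule power2_less_imp_less) simp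
    then show ?case by simp
  qed
  then show "filterlim m at_top sequentially" by (simp add: filterlim_at_top)
  \<comment> \<open>\<open>m \<ge> 2 * (2 * \<gamma> + 1)\<close> together with
    \<open>m^2 \<le> (2 * \<gamma> + 1) * N\<close> gives \<open>2 * m \<le> N\<close>, that is,
    density at most 1/2.\<close>
  obtain k' :: nat where k': "2 * (2 * \<gamma> + 1) \<le> real k'" using real_arch_simple by blast
  have "\<forall>\<^sub>F n in sequentially. (real (m n))\<^sup>2 / (2 * N n) < \<gamma> + 1/2"
    by (rule order_tendstoD(2)[OF gamma(2)]) simp
  then show "\<forall>\<^sub>F n in sequentially. 0 < m n \<and> 0 < N n \<and> real (m n) / N n \<le> 1/2 \<and>
      (real (m n) / N n)\<^sup>2 * N n \<le> 2 * \<gamma> + 1"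
    using N_pos m_ge[of 1] m_ge[of k']
  proof eventually_elim
    case (elim n)
    have m: "0 < m n" using elim(3) by simp
    have sq: "(real (m n))\<^sup>2 \<le> (2 * \<gamma> + 1) * N n"
      using elim(1,2) by (simp add: field_simps)
    have "real (m n) * (2 * (2 * \<gamma> + 1)) \<le> real (m n) * real (m n)"
      using k' elim(4) by (intro mult_left_mono) auto
    also have "\<dots> \<le> (2 * \<gamma> + 1) * N n" using sq by (simp add: power2_eq_square)
    finally have "(2 * \<gamma> + 1) * (2 * real (m n)) \<le> (2 * \<gamma> + 1) * N n" by (simp add: mult_ac)
    then have "2 * real (m n) \<le> N n" using gamma(1) by (subst (asm) mult_le_cancel_left_pos) auto
    then have "real (m n) / N n \<le> 1/2" using elim(2) by (simp add: field_simps)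
    moreover have "(real (m n) / N n)\<^sup>2 * N n \<le> 2 * \<gamma> + 1"
      using sq elim(2) by (simp add: power_divide power2_eq_square pos_divide_le_eq)
    ultimately show ?case using m elim(2) by simp
  qed
qed

theorem theorem2p7:
  fixes V :: "nat \<Rightarrow> 'v set" and E :: "nat \<Rightarrow> 'v set set" and c :: nat
    and S :: "nat \<Rightarrow> 'v set set set" and m :: "nat \<Rightarrow> nat" and \<gamma> :: real
    and \<mu> :: "ereal measure"
    and M :: "nat \<Rightarrow> 'w measure" and \<omega> :: "nat \<Rightarrow> 'v set \<Rightarrow> 'w \<Rightarrow> ereal"
    and \<beta> :: real and \<psi>' :: "real \<Rightarrow> real" and \<psi>'' :: real
  assumes graph: "\<And>n. n \<ge> 1 \<Longrightarrow> finite_simple_graph (V n) (E n)"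
    and edge_trans: "\<And>n. n \<ge> 1 \<Longrightarrow> edge_transitive (V n) (E n)"
    and c_pos: "c \<ge> 1"
    and card_V: "\<And>n. n \<ge> 1 \<Longrightarrow> card (V n) = c * n"
    and card_E: "(\<lambda>n. real (card (E n))) \<in> \<Theta>(\<lambda>n. (real (card (V n)))\<^sup>2)"
    and mu_prob: "prob_space \<mu>"
    and mu_sets: "sets \<mu> = sets borel"
    and mu_not_MInf: "AE w in \<mu>. w \<noteq> -\<infinity>"
    and mu_not_PInf: "\<not> (AE w in \<mu>. w = \<infinity>)"
    and psi_finite: "\<And>b. b \<ge> 0 \<Longrightarrow> integrable \<mu> (boltzmann b)"
    and M_prob: "\<And>n. n \<ge> 1 \<Longrightarrow> prob_space (M n)"
    and weights_indep: "\<And>n. n \<ge> 1 \<Longrightarrow> prob_space.indep_vars (M n) (\<lambda>_. borel) (\<omega> n) (E n)"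
    and weights_law: "\<And>n e. n \<ge> 1 \<Longrightarrow> e \<in> E n \<Longrightarrow> distr (M n) borel (\<omega> n e) = \<mu>"
    and S_nonempty: "\<And>n. n \<ge> 1 \<Longrightarrow> S n \<noteq> {}"
    and S_subgraphs: "\<And>n \<pi>. n \<ge> 1 \<Longrightarrow> \<pi> \<in> S n \<Longrightarrow> \<pi> \<subseteq> E n"
    and S_card: "\<And>n \<pi>. n \<ge> 1 \<Longrightarrow> \<pi> \<in> S n \<Longrightarrow> card \<pi> = m n"
    and gamma_pos: "\<gamma> > 0"
    and gamma_lim: "(\<lambda>n. (real (m n))\<^sup>2 / (2 * real (card (E n)))) \<longlonglongrightarrow> \<gamma>"
    and matching_extends: "\<And>n \<Gamma>. n \<ge> 1 \<Longrightarrow> partial_matching (E n) \<Gamma> \<Longrightarrow> \<exists>\<pi>\<in>S n. \<Gamma> \<subseteq> \<pi>"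
    and matching_prob: "\<exists>\<rho>>0. \<forall>n\<ge>1. \<forall>k. \<forall>\<Gamma>. partial_matching (E n) \<Gamma> \<and> card \<Gamma> = k \<longrightarrow>
          \<bar>prob0 (S n) \<Gamma> / (\<Prod>e\<in>\<Gamma>. prob0 (S n) {e}) - 1\<bar> \<le> \<rho> ^ k / sqrt (real (m n))"
    and nonmatching_prob: "\<exists>\<rho>>0. \<forall>n\<ge>1. \<forall>k. \<forall>\<Gamma>\<in>sub_collection (S n).
          card \<Gamma> = k \<and> \<not> partial_matching (E n) \<Gamma> \<longrightarrow>
          prob0 (S n) \<Gamma> \<le> \<rho> ^ k * (\<Prod>e\<in>\<Gamma>. prob0 (S n) {e})"
    and edge_prob: "\<And>n e. n \<ge> 1 \<Longrightarrow> e \<in> E n \<Longrightarrow> prob0 (S n) {e} = real (m n) / real (card (E n))"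
    and beta_nonneg: "\<beta> \<ge> 0"
    and psi_deriv_near: "\<forall>\<^sub>F b in at \<beta> within {0..}.
          (log_laplace \<mu> has_real_derivative \<psi>' b) (at b within {0..})"
    and psi_deriv: "(log_laplace \<mu> has_real_derivative \<psi>' \<beta>) (at \<beta> within {0..})"
    and psi_deriv2: "(\<psi>' has_real_derivative \<psi>'') (at \<beta> within {0..})"
  shows "weak_conv_in_prob M
           (\<lambda>n x. rescaled_weight_law (S n) (m n) (\<psi>' \<beta>) \<beta> (\<lambda>e. \<omega> n e x))
           (distr (normal_law 0 \<psi>'') borel ereal)"
proof -
  obtain \<rho>1 where \<rho>1: "0 < \<rho>1" "\<And>n \<Gamma>. n \<ge> 1 \<Longrightarrow> partial_matching (E n) \<Gamma> \<Longrightarrow>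
      \<bar>prob0 (S n) \<Gamma> / (\<Prod>e\<in>\<Gamma>. prob0 (S n) {e}) - 1\<bar> \<le> \<rho>1 ^ card \<Gamma> / sqrt (real (m n))"
    using matching_prob by auto
  obtain \<rho>2 where \<rho>2: "0 < \<rho>2" "\<And>n \<Gamma>. n \<ge> 1 \<Longrightarrow> \<Gamma> \<in> sub_collection (S n) \<Longrightarrow> \<not> partial_matching (E n) \<Gamma> \<Longrightarrow>
      prob0 (S n) \<Gamma> \<le> \<rho>2 ^ card \<Gamma> * (\<Prod>e\<in>\<Gamma>. prob0 (S n) {e})"
    using nonmatching_prob by auto
  \<comment> \<open>Large enough for both hypotheses: \<open>1 + \<rho>1 \<le> R\<close> and
    \<open>\<rho>2 \<le> R\<close>.\<close>
  define R where "R = 1 + \<rho>1 + \<rho>2"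
  define p where "p n = real (m n) / real (card (E n))" for n
  define w where "w = tilt \<mu> \<beta>"
  define x where "x = shifted (\<psi>' \<beta>)"
  define D where "D = (\<integral>z. w z * \<bar>x z\<bar> \<partial>\<mu>) + (\<integral>z. (w z)\<^sup>2 * \<bar>x z\<bar> \<partial>\<mu>)"
  have psi_finite_all: "\<forall>b\<ge>0. integrable \<mu> (boltzmann b)" using psi_finite by blast
  note tilt_rules = mu_sets mu_not_PInf psi_finite_all beta_nonneg psi_deriv_near psi_deriv psi_deriv2
  note tilt_facts = tilt_nonneg[OF tilt_rules] tilt_integrable[OF tilt_rules] tilt_integral[OF tilt_rules]
    tilt2_integrable[OF tilt_rules] tilt_abs_integrable[OF tilt_rules] tilt2_abs_integrable[OF tilt_rules]
  note tilt_facts = tilt_facts[folded w_def x_def]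
  note w_nonneg = tilt_facts(1)
  have a0: "0 \<le> \<psi>''"
    unfolding tilt_variance[OF tilt_rules, symmetric] using w_nonneg
    by (intro integral_nonneg_AE) (simp add: w_def)
  have finE: "finite (E n)" if "n \<ge> 1" for n by (rule finite_simple_graph_finite_edges[OF graph[OF that]])

  have "filterlim (\<lambda>n. real (c * n)) at_top sequentially"
    using c_pos by (intro filterlim_compose[OF filterlim_real_sequentially]) (auto intro: mult_nat_left_at_top)
  then have v_lim: "filterlim (\<lambda>n. real (card (V n))) at_top sequentially"
    using card_V by (subst filterlim_cong[OF refl refl, of _ "\<lambda>n. real (c * n)"])
      (auto intro!: eventually_sequentiallyI[of 1])
  note asym = subgraph_size_asymptotics[OF card_E v_lim _ gamma_pos gamma_lim, simplified]
  have "\<forall>\<^sub>F n in sequentially. 1 \<le> n" by (rule eventually_ge_at_top)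
  with asym(3) have "\<forall>\<^sub>F n in sequentially. 1 \<le> n \<and> 0 < m n \<and> 0 < card (E n) \<and> p n \<le> 1/2 \<and>
      (p n)\<^sup>2 * real (card (E n)) \<le> 2 * \<gamma> + 1"
    by eventually_elim (simp add: p_def)
  \<comment> \<open>The numerical bounds hold only for large \<open>n\<close>. From here on the
    argument runs along \<open>n + k\<close>, and the skipped indices are restored at the
    end.\<close>
  then obtain k where k: "\<And>n. k \<le> n \<Longrightarrow> 1 \<le> n \<and> 0 < m n \<and> 0 < card (E n) \<and> p n \<le> 1/2 \<and>
      (p n)\<^sup>2 * real (card (E n)) \<le> 2 * \<gamma> + 1"
    by (auto simp: eventually_sequentially)
  have k1: "1 \<le> n + k" for n using k[of "n + k"] by simp

  have G: "weighted_subgraphs (V (n + k)) (E (n + k)) (S (n + k)) (m (n + k)) \<rho>1 R (p (n + k)) (M (n + k))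
      (\<omega> (n + k)) \<mu> x w D" for n
  proof -
    let ?n = "n + k"
    have "spread_subgraphs (V ?n) (E ?n) (S ?n) (m ?n) \<rho>1 R (p ?n)"
    proof
      show "E ?n \<noteq> {}" "0 < m ?n" using k[of ?n] by auto
      show "prob0 (S ?n) \<Gamma> \<le> R ^ card \<Gamma> * (\<Prod>e\<in>\<Gamma>. prob0 (S ?n) {e})"
        if "\<Gamma> \<in> sub_collection (S ?n)" "\<not> partial_matching (E ?n) \<Gamma>" for \<Gamma>
      proof -
        have "prob0 (S ?n) \<Gamma> \<le> \<rho>2 ^ card \<Gamma> * (\<Prod>e\<in>\<Gamma>. prob0 (S ?n) {e})"
          using \<rho>2(2) that k1 by blast
        also have "\<dots> \<le> R ^ card \<Gamma> * (\<Prod>e\<in>\<Gamma>. prob0 (S ?n) {e})"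
          using \<rho>1(1) \<rho>2(1) by (intro mult_right_mono power_mono prod_nonneg) (auto simp: R_def prob0_def)
        finally show ?thesis .
      qed
      show "prob0 (S ?n) {e} = p ?n" if "e \<in> E ?n" for e
        using edge_prob[OF k1 that] by (simp add: p_def)
      show "\<pi> \<subseteq> E ?n" "card \<pi> = m ?n" if "\<pi> \<in> S ?n" for \<pi>
        by (rule S_subgraphs[OF k1 that], rule S_card[OF k1 that])
      show "\<bar>prob0 (S ?n) \<Gamma> / (\<Prod>e\<in>\<Gamma>. prob0 (S ?n) {e}) - 1\<bar> \<le> \<rho>1 ^ card \<Gamma> / sqrt (real (m ?n))"
        if "partial_matching (E ?n) \<Gamma>" for \<Gamma> by (rule \<rho>1(2)[OF k1 that])
    qed (use \<rho>1(1) \<rho>2(1) in \<open>simp_all add: p_def R_def graph[OF k1] S_nonempty[OF k1]\<close>)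
    moreover have "tilted_weights (M ?n) (E ?n) (\<omega> ?n) \<mu> x w D"
    proof (intro tilted_weights.intro iid_weights.intro iid_weights_axioms.intro tilted_weights_axioms.intro)
      show "prob_space (M ?n)" by (rule M_prob[OF k1])
      show "x \<in> borel_measurable borel" "w \<in> borel_measurable borel" by (simp_all add: x_def w_def)
      show "(\<integral>z. w z * \<bar>x z\<bar> \<partial>\<mu>) \<le> D" "(\<integral>z. (w z)\<^sup>2 * \<bar>x z\<bar> \<partial>\<mu>) \<le> D"
        unfolding D_def using w_nonneg by (auto intro!: integral_nonneg_AE)
    qed (rule finE[OF k1] weights_indep[OF k1] weights_law[OF k1] mu_prob mu_sets tilt_facts; assumption?)+
    ultimately show ?thesis by (rule weighted_subgraphs.intro)
  qed

  show ?thesis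
    unfolding weak_conv_in_prob_def
  proof (intro allI impI)
    fix f :: "ereal \<Rightarrow> real" and \<epsilon> :: real
    assume f_cont: "continuous_on UNIV f" and f_bdd: "bounded (range f)" and \<epsilon>: "0 < \<epsilon>"
    obtain C where C: "\<And>z. \<bar>f z\<bar> \<le> C" using f_bdd by (auto simp: bounded_iff)
    have f_meas[measurable]: "f \<in> borel_measurable borel" by (rule borel_measurable_continuous_onI[OF f_cont])
    interpret N: real_distribution "normal_law 0 \<psi>''" by (rule real_distribution_normal_law[OF a0])
    define \<nu> where "\<nu> n y = rescaled_weight_law (S n) (m n) (\<psi>' \<beta>) \<beta> (\<lambda>e. \<omega> n e y)" for n y
    define b where "b = (\<integral>z. f z \<partial>distr (normal_law 0 \<psi>'') borel ereal)"
    \<comment> \<open>Centring by \<open>b\<close> turns the deviation of the Gibbs average from its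
      limit into the quotient \<open>Yh / Y1\<close>.\<close>
    define h where "h t = f (ereal t) - b" for t
    have b_eq: "b = (\<integral>t. f (ereal t) \<partial>normal_law 0 \<psi>'')"
      unfolding b_def by (rule integral_distr) auto
    have f_int: "integrable (normal_law 0 \<psi>'') (\<lambda>t. f (ereal t))"
      by (rule N.integrable_const_bound[of _ C]) (auto simp: C)
    have h_mean: "(\<integral>t. h t \<partial>normal_law 0 \<psi>'') = 0"
      unfolding h_def using f_int N.prob_space by (simp add: b_eq)
    have h_cont: "continuous_on UNIV h"
      unfolding h_def
      by (intro continuous_intros continuous_on_compose2[OF f_cont continuous_on_ereal]) auto
    have h_bound: "\<bar>h t\<bar> \<le> C + \<bar>b\<bar>" for t
      using C[of "ereal t"] unfolding h_def by linarith
    have h_mod: "\<exists>L\<ge>0. \<forall>s t. \<bar>h s - h t\<bar> \<le> \<epsilon>' + L * \<bar>s - t\<bar>" if "0 < \<epsilon>'" for \<epsilon>'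
      using uniform_modulus_of_ereal_continuous[OF f_cont C that] unfolding h_def by (metis diff_diff_eq2 diff_add_cancel)
    define Y1 where "Y1 n y = average (S n) (\<lambda>\<pi>. \<Prod>e\<in>\<pi>. w (\<omega> n e y))" for n y
    define Yh where "Yh n y = average (S n) (\<lambda>\<pi>. (\<Prod>e\<in>\<pi>. w (\<omega> n e y))
      * h (1 / sqrt (real (m n)) * (\<Sum>e\<in>\<pi>. x (\<omega> n e y))))" for n y
    let ?bad = "\<lambda>n. {y\<in>space (M n). \<not> (0 < Y1 n y \<and> \<bar>Yh n y\<bar> \<le> \<epsilon> * Y1 n y)}"
    let ?dev = "\<lambda>n. {y\<in>space (M n). \<bar>(\<integral>z. f z \<partial>\<nu> n y) - b\<bar> > \<epsilon>}"
    have p_half: "p (n + k) \<le> 1/2" and B: "(p (n + k))\<^sup>2 * real (card (E (n + k))) \<le> 2 * \<gamma> + 1" for n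
      using k[of "n + k"] by auto
    have m_lim: "filterlim (\<lambda>n. m (n + k)) at_top sequentially"
      by (rule filterlim_compose[OF asym(1) filterlim_add_const_nat_at_top])
    have VE: "(\<lambda>n. real (card (V (n + k))) / real (card (E (n + k)))) \<longlonglongrightarrow> 0"
      by (rule LIMSEQ_ignore_initial_segment[OF asym(2)])
    note ratio = weighted_average_ratio_tendsto[OF G m_lim p_half B VE
        tilt_mean[OF tilt_rules, folded w_def x_def] tilt_square_integrable[OF tilt_rules, folded w_def x_def]
        tilt_variance[OF tilt_rules, folded w_def x_def] h_cont h_bound h_mod h_mean \<epsilon>, folded Y1_def Yh_def]
    \<comment> \<open>Almost sure inclusion suffices, with measurability asked only of the larger
      set. The exceptional configurations are those in which some edge has weight
      \<open>- \<infinity>\<close>.\<close>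
    have "measure (M n) (?dev n) \<le> measure (M n) (?bad n)" if n: "k \<le> n" for n
    proof -
      have n1: "1 \<le> n" using k[OF n] by simp
      interpret M: prob_space "M n" by (rule M_prob[OF n1])
      have bad: "?bad n \<in> sets (M n)" using ratio(1)[of "n - k"] n by simp
      have "AE y in M n. \<omega> n e y \<noteq> - \<infinity>" if e: "e \<in> E n" for e
      proof (rule AE_distrD[where f = "\<omega> n e" and M' = borel and P = "\<lambda>z. z \<noteq> - \<infinity>"])
        show "\<omega> n e \<in> borel_measurable (M n)"
          using weights_indep[OF n1] e by (simp add: M.indep_vars_def)
        show "AE z in distr (M n) borel (\<omega> n e). z \<noteq> - \<infinity>"
          unfolding weights_law[OF n1 e] by (rule mu_not_MInf)
      qed
      then have "AE y in M n. \<forall>e\<in>E n. \<omega> n e y \<noteq> - \<infinity>"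
        by (intro AE_finite_allI finE n1) auto
      then have "AE y in M n. y \<in> ?dev n \<longrightarrow> y \<in> ?bad n"
      proof eventually_elim
        case (elim y)
        show ?case
        proof (rule impI, rule ccontr)
          assume dev: "y \<in> ?dev n" and "y \<notin> ?bad n"
          then have good: "0 < Y1 n y" "\<bar>Yh n y\<bar> \<le> \<epsilon> * Y1 n y" by auto
          let ?g = "\<integral>z. boltzmann \<beta> z \<partial>\<mu>"
          let ?b = "\<lambda>\<pi>. \<Prod>e\<in>\<pi>. boltzmann \<beta> (\<omega> n e y)"
          let ?F = "\<lambda>\<pi>. f (ereal (1 / sqrt (real (m n)) * (\<Sum>e\<in>\<pi>. x (\<omega> n e y))))"
          have g: "0 < ?g" by (rule integral_boltzmann_pos[OF mu_not_PInf psi_finite[OF beta_nonneg]])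
          have fin: "finite (S n)"
            using S_subgraphs[OF n1] finE[OF n1] by (meson PowI finite_Pow_iff finite_subset subsetI)
          have mem: "finite \<pi> \<and> card \<pi> = m n" if "\<pi> \<in> S n" for \<pi>
            using S_subgraphs[OF n1 that] finE[OF n1] S_card[OF n1 that] by (auto dest: finite_subset)
          \<comment> \<open>All subgraphs have \<open>m n\<close> edges, so the normalising
            constants form the common factor \<open>1 / ?g ^ m n\<close>, which cancels in the
            quotient.\<close>
          have prod_w: "(\<Prod>e\<in>\<pi>. w (\<omega> n e y)) = 1 / ?g ^ m n * ?b \<pi>" if "\<pi> \<in> S n" for \<pi>
            using mem[OF that] by (simp add: w_def tilt_def prod_dividef)
          have Y1_eq: "Y1 n y = 1 / ?g ^ m n * average (S n) ?b"
            unfolding Y1_def by (subst average_cmult[symmetric], rule average_cong, rule prod_w)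
          have Z: "0 < average (S n) ?b"
            using good(1) g by (simp add: Y1_eq zero_less_divide_iff)
          have Yh_eq: "Yh n y = 1 / ?g ^ m n * average (S n) (\<lambda>\<pi>. ?b \<pi> * ?F \<pi>) - b * Y1 n y"
          proof -
            have "Yh n y = average (S n) (\<lambda>\<pi>. 1 / ?g ^ m n * (?b \<pi> * ?F \<pi>)) - average (S n) (\<lambda>\<pi>. b * (\<Prod>e\<in>\<pi>. w (\<omega> n e y)))"
              unfolding Yh_def average_def diff_divide_distrib[symmetric] sum_subtractf[symmetric]
              by (intro arg_cong2[where f = "(/)"] sum.cong refl) (simp add: prod_w h_def right_diff_distrib diff_divide_distrib mult_ac)
            then show ?thesis by (simp only: average_cmult Y1_def)
          qed
          have "(\<integral>z. f z \<partial>\<nu> n y) = average (S n) (\<lambda>\<pi>. ?b \<pi> * ?F \<pi>) / average (S n) ?b"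
            unfolding \<nu>_def x_def using elim S_subgraphs[OF n1]
            by (intro integral_rescaled_weight_law fin S_nonempty[OF n1] mem f_meas Z) auto
          also have "\<dots> = (Yh n y + b * Y1 n y) / Y1 n y"
            using g Z by (simp add: Yh_eq Y1_eq)
          also have "\<dots> = Yh n y / Y1 n y + b" using good(1) by (simp add: add_divide_distrib)
          finally have "\<bar>(\<integral>z. f z \<partial>\<nu> n y) - b\<bar> = \<bar>Yh n y\<bar> / Y1 n y" using good(1) by simp
          also have "\<dots> \<le> \<epsilon>" using good by (simp add: pos_divide_le_eq)
          finally show False using dev by simp
        qed
      qed
      then show ?thesis by (rule M.finite_measure_mono_AE[OF _ bad])
    qed
    then have "(\<lambda>n. measure (M (n + k)) (?dev (n + k))) \<longlonglongrightarrow> 0"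
      by (intro tendsto_sandwich[OF _ _ tendsto_const ratio(2)]) (auto intro!: always_eventually)
    then have "(\<lambda>n. measure (M n) (?dev n)) \<longlonglongrightarrow> 0"
      by (rule LIMSEQ_offset)
    then show "(\<lambda>n. measure (M n) {y \<in> space (M n).
        \<bar>(\<integral>z. f z \<partial>rescaled_weight_law (S n) (m n) (\<psi>' \<beta>) \<beta> (\<lambda>e. \<omega> n e y))
          - (\<integral>z. f z \<partial>distr (normal_law 0 \<psi>'') borel ereal)\<bar> > \<epsilon>}) \<longlonglongrightarrow> 0"
      by (simp only: \<nu>_def b_def)
  qed
qed

end
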